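(* Let $T$ be a non-singular $d\times d$ integer matrix, regarded as a transformation of the torus $\mathbb{T}^d$. Let $\{f_n\}_{n\ge1}$ be a sequence of vector-valued functions $f_n:\mathbb{T}^d\to\mathbb{T}^d$ with a uniform Lipschitz constant, i.e. there is $c>0$ with $|f_n(\mathbf{x})-f_n(\mathbf{y})|\le c|\mathbf{x}-\mathbf{y}|$ for all $n\in\mathbb{N}$ and $\mathbf{x},\mathbf{y}\in\mathbb{T}^d$. Let $\psi:\mathbb{N}\to\mathbb{R}^+$ and $\tau:=\liminf_{n\to\infty}\frac{-\log\psi(n)}{n}$. Suppose that $T$ is diagonalizable over $\mathbb{Z}$ with all eigenvalues $\beta_i>1$, and assume that $1<\beta_1\le\beta_2\le\dots\le\beta_d$. Then $$\dim_{\mathrm H}W(T,\psi,\{f_n\})=\min_{1\le i\le d}\left\{\frac{i\log\beta_i-\sum_{j:\beta_j>\beta_ie^{\tau}}(\log\beta_j-\log\beta_i-\tau)+\sum_{j>i}\log\beta_j}{\tau+\log\beta_i}\right\},$$ where the right-hand side is read as $0$ if $\tau=\infty$.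
   Context: $\mathbb{T}^d=\mathbb{R}^d/\mathbb{Z}^d$; $|\cdot|$ denotes the usual metric on $\mathbb{T}$ (distance of the difference to the nearest integer) and also the metric on $\mathbb{T}^d$ induced by the Euclidean metric. An integer matrix $T$ acts on $\mathbb{T}^d$ by $\mathbf{x}\mapsto T\mathbf{x}\ (\mathrm{mod}\ 1)$ and $T^n$ is the $n$-th iterate of this map. $T$ is diagonalizable over $\mathbb{Z}$ if there is $P\in GL_d(\mathbb{Z})$ such that $PTP^{-1}$ is a diagonal integer matrix. For $\mathbf{y}\in\mathbb{T}^d$ let $L(\mathbf{y},\psi(n))=\{\mathbf{x}\in\mathbb{T}^d:|x_i-y_i|<\psi(n)\text{ for all }1\le i\le d\}$. Define $$W(T,\psi,\{f_n\})=\{\mathbf{x}\in\mathbb{T}^d:T^n(\mathbf{x})\in L(f_n(\mathbf{x}),\psi(n))\text{ for infinitely many }n\in\mathbb{N}\}.$$ $\mathbb{R}^+$ is the set of positive reals and $\dim_{\mathrm H}$ is Hausdorff dimension.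
   Formalization: The formal theorem additionally assumes τ > −log β_1, so all denominators τ + log β_i are positive (automatic if τ ≥ 0); without it the formula can be undefined (d=1, ψ(n)=β^n) or false (T=diag(2,4), ψ(n)=16^n, where W is the whole torus but the formula gives 3/2). *)

theory Defs
  imports "HOL-Analysis.Analysis"
begin

section \<open>The circle and the torus\<close>

definition circle_rel :: "real \<Rightarrow> real \<Rightarrow> bool" where
  "circle_rel x y \<longleftrightarrow> x - y \<in> \<int>"

lemma equivp_circle_rel: "equivp circle_rel"
proof (rule equivpI)
  show "reflp circle_rel" by (simp add: reflp_def circle_rel_def)
  show "symp circle_rel"
    unfolding symp_def circle_rel_def by (metis Ints_minus minus_diff_eq)
  show "transp circle_rel"
  proof (rule transpI)
    fix x y z assume "circle_rel x y" "circle_rel y z"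
    then have "(x - y) + (y - z) \<in> \<int>" unfolding circle_rel_def by (rule Ints_add)
    then show "circle_rel x z" by (simp add: circle_rel_def)
  qed
qed

quotient_type circle = real / circle_rel
  morphisms rep_circle to_circle
  by (rule equivp_circle_rel)

definition dist_to_int :: "real \<Rightarrow> real" where
  "dist_to_int x = \<bar>x - of_int (round x)\<bar>"

lemma dist_to_int_le: "dist_to_int x \<le> \<bar>x - of_int m\<bar>"
  unfolding dist_to_int_def by (rule round_diff_minimal)

lemma dist_to_int_add_Ints:
  assumes "k \<in> \<int>" shows "dist_to_int (x + k) = dist_to_int x"
proof -
  obtain m where k: "k = of_int m" using assms by (auto elim: Ints_cases)
  have "round (x + of_int m) = round x + m"
    unfolding round_def by linarith
  then show ?thesis by (simp add: dist_to_int_def k)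
qed

lemma dist_to_int_minus: "dist_to_int (- x) = dist_to_int x"
proof -
  have le: "dist_to_int (- y) \<le> dist_to_int y" for y
    using dist_to_int_le[of "- y" "- round y"] by (simp add: dist_to_int_def abs_minus_commute)
  show ?thesis using le[of x] le[of "- x"] by simp
qed

lemma dist_to_int_triangle: "dist_to_int (x + y) \<le> dist_to_int x + dist_to_int y"
  using dist_to_int_le[of "x + y" "round x + round y"] by (simp add: dist_to_int_def)

lemma dist_to_int_eq_0: "dist_to_int x = 0 \<longleftrightarrow> x \<in> \<int>"
  unfolding dist_to_int_def
  by (metis Ints_cases Ints_of_int abs_eq_0 eq_iff_diff_eq_0 round_of_int)

instantiation circle :: metric_space
begin

lift_definition dist_circle :: "circle \<Rightarrow> circle \<Rightarrow> real" is "\<lambda>x y. dist_to_int (x - y)"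
proof -
  fix x x' y y' assume "circle_rel x x'" "circle_rel y y'"
  then have "(x - x') - (y - y') \<in> \<int>" unfolding circle_rel_def by (rule Ints_diff)
  from dist_to_int_add_Ints[OF this, of "x' - y'"]
  show "dist_to_int (x - y) = dist_to_int (x' - y')" by (simp add: algebra_simps)
qed

definition uniformity_circle :: "(circle \<times> circle) filter" where
  "uniformity_circle = (INF e\<in>{0 <..}. principal {(x, y). dist x y < e})"

definition open_circle :: "circle set \<Rightarrow> bool" where
  "open_circle U \<longleftrightarrow> (\<forall>x\<in>U. eventually (\<lambda>(x', y). x' = x \<longrightarrow> y \<in> U) uniformity)"

instance
proof
  show "dist x y = 0 \<longleftrightarrow> x = y" for x y :: circle
    by transfer (simp add: dist_to_int_eq_0 circle_rel_def)
  show "dist x y \<le> dist x z + dist y z" for x y z :: circle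
  proof transfer
    fix x y z :: real
    show "dist_to_int (x - y) \<le> dist_to_int (x - z) + dist_to_int (y - z)"
      using dist_to_int_triangle[of "x - z" "z - y"] dist_to_int_minus[of "y - z"] by simp
  qed
qed (simp_all only: uniformity_circle_def open_circle_def)

end

text \<open>The library metric on \<open>circle ^ 'd\<close> is the Euclidean (\<open>\<ell>\<^sup>2\<close>) combination of the
  coordinate distances (lemma \<open>dist_vec_def\<close>), which is the quotient metric that \<open>\<real>\<^sup>d/\<int>\<^sup>d\<close>
  inherits from the Euclidean metric. The dimension is \<open>d = CARD('d)\<close>.\<close>

type_synonym 'd torus = "circle ^ 'd"

definition to_torus :: "real ^ 'd \<Rightarrow> 'd::finite torus" where
  "to_torus v = (\<chi> i. to_circle (v $ i))"

definition lift_torus :: "'d::finite torus \<Rightarrow> real ^ 'd" where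
  "lift_torus x = (\<chi> i. rep_circle (x $ i))"

definition torus_map :: "int ^ 'd ^ 'd \<Rightarrow> 'd::finite torus \<Rightarrow> 'd torus" where
  "torus_map T x = to_torus (map_matrix real_of_int T *v lift_torus x)"

text \<open>The choice of representative in \<open>torus_map\<close> is immaterial.\<close>

lemma torus_map_to_torus:
  "torus_map T (to_torus v) = to_torus (map_matrix real_of_int T *v v)"
proof -
  have "circle_rel ((map_matrix real_of_int T *v lift_torus (to_torus v)) $ i)
          ((map_matrix real_of_int T *v v) $ i)" for i
  proof -
    have "circle_rel (rep_circle (to_circle a)) a" for a
      using Quotient_rep_abs[OF Quotient_circle] by (simp add: circle_rel_def)
    then have "real_of_int (T $ i $ j) * (rep_circle (to_circle (v $ j)) - v $ j) \<in> \<int>" for j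
      by (simp add: circle_rel_def)
    then have "(\<Sum>j\<in>UNIV. real_of_int (T $ i $ j) * (rep_circle (to_circle (v $ j)) - v $ j)) \<in> \<int>"
      by (intro Ints_sum) auto
    then show ?thesis
      by (simp add: circle_rel_def matrix_vector_mult_def map_matrix_def lift_torus_def
          to_torus_def sum_subtractf right_diff_distrib)
  qed
  then show ?thesis
    by (simp add: torus_map_def to_torus_def vec_eq_iff circle.abs_eq_iff)
qed


section \<open>Hausdorff dimension\<close>

text \<open>\<open>|U|\<^sup>s\<close> with the usual conventions that the empty set contributes \<open>0\<close> and that
  \<open>0\<^sup>0 = 1\<close> (in the library \<open>0 powr 0 = 0\<close>).\<close>

definition diam_pow :: "real \<Rightarrow> 'a::metric_space set \<Rightarrow> real" where
  "diam_pow s U = (if U = {} then 0 else if s = 0 then 1 else diameter U powr s)"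

definition hausdorff_pre :: "real \<Rightarrow> real \<Rightarrow> 'a::metric_space set \<Rightarrow> ennreal" where
  "hausdorff_pre s \<delta> A =
     (INF U \<in> {U :: nat \<Rightarrow> 'a set.
         (\<forall>k. bounded (U k) \<and> diameter (U k) \<le> \<delta>) \<and> A \<subseteq> (\<Union>k. U k)}.
       \<Sum>k. ennreal (diam_pow s (U k)))"

definition hausdorff_measure :: "real \<Rightarrow> 'a::metric_space set \<Rightarrow> ennreal" where
  "hausdorff_measure s A = (SUP \<delta> \<in> {0<..}. hausdorff_pre s \<delta> A)"

definition hausdorff_dim :: "'a::metric_space set \<Rightarrow> ereal" where
  "hausdorff_dim A = (INF s \<in> {s. 0 \<le> s \<and> hausdorff_measure s A = 0}. ereal s)"


section \<open>Integer matrices\<close>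

text \<open>\<open>invertible P\<close> for \<open>P :: int ^ 'd ^ 'd\<close> asks for an inverse with integer entries,
  i.e. \<open>P \<in> GL\<^sub>d(\<int>)\<close>.\<close>

definition diagonalizable_int :: "int ^ 'd ^ 'd \<Rightarrow> bool" where
  "diagonalizable_int T \<longleftrightarrow>
     (\<exists>P :: int ^ 'd ^ 'd. invertible P \<and> (\<forall>i j. i \<noteq> j \<longrightarrow> (P ** T ** matrix_inv P) $ i $ j = 0))"

definition charpoly :: "int ^ 'd ^ 'd \<Rightarrow> real poly" where
  "charpoly T = det (\<chi> i j. (if i = j then [:0, 1:] else 0) - [: real_of_int (T $ i $ j) :])"

text \<open>\<open>\<beta> 1, \<dots>, \<beta> d\<close> are all the eigenvalues of \<open>T\<close>, listed with algebraic multiplicity.\<close>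

definition eigenvalue_list :: "int ^ 'd ^ 'd \<Rightarrow> (nat \<Rightarrow> real) \<Rightarrow> bool" where
  "eigenvalue_list T \<beta> \<longleftrightarrow> charpoly T = (\<Prod>i=1..CARD('d). [: - \<beta> i, 1 :])"


section \<open>The modified shrinking target set\<close>

definition target :: "'d::finite torus \<Rightarrow> real \<Rightarrow> 'd torus set" where
  "target y r = {x. \<forall>i. dist (x $ i) (y $ i) < r}"

definition W_set ::
  "int ^ 'd ^ 'd \<Rightarrow> (nat \<Rightarrow> real) \<Rightarrow> (nat \<Rightarrow> 'd::finite torus \<Rightarrow> 'd torus) \<Rightarrow> 'd torus set" where
  "W_set T \<psi> f = {x. infinite {n. 1 \<le> n \<and> (torus_map T ^^ n) x \<in> target (f n x) (\<psi> n)}}"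

definition dim_ratio :: "nat \<Rightarrow> (nat \<Rightarrow> real) \<Rightarrow> real \<Rightarrow> nat \<Rightarrow> real" where
  "dim_ratio d \<beta> \<tau> i =
     (real i * ln (\<beta> i)
        - (\<Sum>j | j \<in> {1..d} \<and> \<beta> j > \<beta> i * exp \<tau>. ln (\<beta> j) - ln (\<beta> i) - \<tau>)
        + (\<Sum>j\<in>{i<..d}. ln (\<beta> j)))
     / (\<tau> + ln (\<beta> i))"

end

theory Submission
  imports Defs
begin

text \<open>Let \<open>P ** T ** matrix_inv P\<close> be diagonal with entries \<open>D j \<ge> 2\<close> and put \<open>l j = ln (D j)\<close>. In the
coordinates \<open>y\<close> with \<open>\<theta> y = to_torus (P\<^sup>-\<^sup>1 y)\<close> the map \<open>T\<^sup>n\<close> multiplies the \<open>j\<close>-th coordinate by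
\<open>D j ^ n\<close>. On a cell with sides \<open>D j ^ (- n)\<close> the equation \<open>T\<^sup>n x = f n x\<close> has a solution, because the
inverse branch of \<open>T\<^sup>n\<close> followed by a Lipschitz map is a contraction for large \<open>n\<close>; and around that
solution the \<open>n\<close>-th shrinking target is comparable to a box with sides \<open>\<psi> n * D j ^ (- n)\<close>. Hence the
set is the limsup of boxes of this shape, one for each cell of the grid, and the exact positions
of the boxes inside the cells do not matter.

Assume \<open>\<psi> n = exp (- n * \<tau>)\<close> with \<open>\<tau> \<ge> 0\<close>. At scale \<open>r = exp (- n * u)\<close> everything is governed by
\<open>phi l \<tau> u = (\<Sum>j. min u (l j) + max 0 (u - \<tau> - l j))\<close>:
up to constants, \<open>exp (n * phi l \<tau> u)\<close> cubes of side \<open>r\<close> suffice to cover the \<open>n\<close>-th set, at least at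
the scales \<open>u = \<tau> + l i\<close>, and the normalized Lebesgue measure on the \<open>n\<close>-th set gives mass at most
\<open>exp (- n * phi l \<tau> u)\<close> to a cube of side \<open>r\<close>, at all scales. The value
\<open>phi l \<tau> (\<tau> + l i) / (\<tau> + l i)\<close> is the \<open>i\<close>-th term of the minimum in the theorem (\<open>phi_knot\<close>,
\<open>dim_ratio_eq\<close>).

Upper bound (\<open>cover_hits\<close>, \<open>dim_limsup_hits_le\<close>): use the covers at the scale \<open>\<tau> + l i\<close> for all large
\<open>n\<close> and sum. To count the cubes it is enough to know that two points of the \<open>n\<close>-th set in the same
cell are close, which follows from the triangle inequality (\<open>hits_close\<close>).

Lower bound (\<open>dim_limsup_hits_ge\<close>): \<open>phi\<close> is concave between two consecutive points \<open>\<tau> + l i\<close>, so the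
minimum over these points controls \<open>phi l \<tau> u / u\<close> for all \<open>u\<close> (\<open>phi_ge_linear\<close>). Therefore the
normalized measures on the \<open>n\<close>-th sets satisfy one bound \<open>C * r powr s\<close> for all \<open>n\<close>; they also converge
to Lebesgue measure, since the boxes are spread over a grid. These two properties alone imply that
the limsup set has dimension at least \<open>s\<close>: intersect \<open>n\<close>-th sets for a sequence of \<open>n\<close> that increases so
fast that each new set is equidistributed at the scales seen by the previous ones. The mass of a
cube is then controlled by the single-level bound at small scales and by the previous steps at large
scales (\<open>frostman_Int\<close>), and compactness turns this into a lower bound for every cover
(\<open>limsup_cube_content_pos\<close>).

For general \<open>\<psi>\<close> compare with \<open>exp (- n * t)\<close> for \<open>t\<close> on either side of \<open>\<tau>\<close>, and let \<open>t\<close> tend to \<open>\<tau>\<close>. If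
\<open>\<tau> \<le> 0\<close> both sides equal the dimension of the torus.\<close>

section \<open>Limsup sets of equidistributed boxes\<close>

text \<open>The boxes are required to be disjoint so that Lebesgue measure is additive over them. The class is closed
under intersections, which keeps every stage of the Cantor construction in it.\<close>

definition box_union :: "(real ^ 'd) set \<Rightarrow> bool" where
  "box_union K \<longleftrightarrow> (\<exists>\<R>. finite \<R> \<and> pairwise disjnt \<R> \<and> (\<forall>R\<in>\<R>. \<exists>a b. R = cbox a b) \<and> K = \<Union>\<R>)"

definition mcube :: "real ^ 'd \<Rightarrow> real \<Rightarrow> (real ^ 'd) set" where
  "mcube x r = {y. \<forall>i. \<bar>y $ i - x $ i\<bar> \<le> r}"

lemma mcube_eq_cbox: "mcube x r = cbox (x - vec r) (x + vec r)"
proof -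
  have *: "\<bar>a - b\<bar> \<le> r \<longleftrightarrow> b - r \<le> a \<and> a \<le> b + r" for a b :: real by auto
  show ?thesis by (auto simp: mcube_def mem_box_cart *)
qed

lemma measure_cbox_cart:
  fixes a b :: "real ^ 'd"
  assumes "\<And>i. a $ i \<le> b $ i"
  shows "measure lborel (cbox a b) = (\<Prod>i\<in>UNIV. b $ i - a $ i)"
  by (rule content_cbox_cart) (use assms in \<open>simp add: interval_ne_empty_cart\<close>)

lemma measure_mcube:
  fixes x :: "real ^ 'd"
  assumes "0 \<le> r" shows "measure lborel (mcube x r) = (2 * r) ^ CARD('d)"
  using assms by (simp add: mcube_eq_cbox measure_cbox_cart algebra_simps)

lemma box_union_cbox: "box_union (cbox a b)"
  unfolding box_union_def by (rule exI[of _ "{cbox a b}"]) (auto simp: pairwise_def)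

lemma box_union_compact: "box_union K \<Longrightarrow> compact K"
  unfolding box_union_def by (fastforce intro!: compact_Union)

lemma box_union_Int:
  assumes "box_union K" "box_union L" shows "box_union (K \<inter> L)"
proof -
  obtain \<R> where R: "finite \<R>" "pairwise disjnt \<R>" "\<forall>R\<in>\<R>. \<exists>a b. R = cbox a b" "K = \<Union>\<R>"
    using assms(1) unfolding box_union_def by blast
  obtain \<S> where S: "finite \<S>" "pairwise disjnt \<S>" "\<forall>R\<in>\<S>. \<exists>a b. R = cbox a b" "L = \<Union>\<S>"
    using assms(2) unfolding box_union_def by blast
  let ?T = "(\<lambda>(R, S). R \<inter> S) ` (\<R> \<times> \<S>)"
  have "finite ?T" using R(1) S(1) by simp
  moreover have "pairwise disjnt ?T"
  proof (rule pairwiseI)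
    fix X Y assume "X \<in> ?T" "Y \<in> ?T" "X \<noteq> Y"
    then obtain P Q P' Q' where *: "P \<in> \<R>" "Q \<in> \<S>" "P' \<in> \<R>" "Q' \<in> \<S>"
      "X = P \<inter> Q" "Y = P' \<inter> Q'" by blast
    then have "P \<noteq> P' \<or> Q \<noteq> Q'" using \<open>X \<noteq> Y\<close> by blast
    then have "disjnt P P' \<or> disjnt Q Q'"
      using pairwiseD[OF R(2) *(1) *(3)] pairwiseD[OF S(2) *(2) *(4)] by argo
    then show "disjnt X Y" using * unfolding disjnt_def by blast
  qed
  moreover have "\<forall>T\<in>?T. \<exists>a b. T = cbox a b"
  proof safe
    fix P Q assume "P \<in> \<R>" "Q \<in> \<S>"
    with R(3) S(3) obtain a b c d where "P = cbox a b" "Q = cbox c d" by metis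
    then show "\<exists>a b. P \<inter> Q = cbox a b" by (simp only: Int_interval) (intro exI, rule refl)
  qed
  moreover have "K \<inter> L = \<Union>?T" using R(4) S(4) by auto
  ultimately show ?thesis unfolding box_union_def by blast
qed

text \<open>Here \<open>E n\<close> carries the measure \<open>measure lborel (E n \<inter> _) / p n\<close>. The assumption \<open>equidistributed\<close>
says that these measures converge to Lebesgue measure uniformly over boxes, and \<open>cube_bound\<close> is a
Frostman condition with exponent \<open>s\<close> that is uniform in \<open>n\<close>.\<close>

locale equidistributed_boxes =
  fixes a b :: "real ^ 'd" and E :: "nat \<Rightarrow> (real ^ 'd) set" and p \<delta> :: "nat \<Rightarrow> real"
    and N :: "nat set" and s C :: real
  assumes infinite_N: "infinite N"
    and box_union_E: "\<And>n. n \<in> N \<Longrightarrow> box_union (E n)"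
    and p_pos: "\<And>n. n \<in> N \<Longrightarrow> 0 < p n"
    and equidistributed: "\<And>n c d. n \<in> N \<Longrightarrow> cbox c d \<subseteq> cbox a b \<Longrightarrow>
      \<bar>measure lborel (E n \<inter> cbox c d) / p n - measure lborel (cbox c d)\<bar> \<le> \<delta> n"
    and \<delta>_tendsto_0: "\<delta> \<longlonglongrightarrow> 0"
    and cube_bound: "\<And>n x r. n \<in> N \<Longrightarrow> 0 < r \<Longrightarrow> r \<le> 1 \<Longrightarrow>
      measure lborel (E n \<inter> mcube x r) / p n \<le> C * r powr s"
    and C_nonneg: "0 \<le> C"
    and start_pos: "0 < measure lborel (cbox a b)"
    and s_le: "s \<le> real CARD('d)"
begin

text \<open>The invariant of the Cantor construction: the measure \<open>c * measure lborel (K \<inter> _)\<close> has kept more than half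
of the mass of the starting box and satisfies the Frostman condition with exponent \<open>s'\<close>. The strict
inequalities leave room for the small losses of the later stages, so that the invariant need not
mention the stage.\<close>

definition frostman :: "real \<Rightarrow> real \<Rightarrow> (real ^ 'd) set \<Rightarrow> bool" where
  "frostman s' c K \<longleftrightarrow> box_union K \<and> K \<subseteq> cbox a b \<and> 0 < c
     \<and> measure lborel (cbox a b) / 2 < c * measure lborel K
     \<and> (\<exists>C' < 2 * 2 ^ CARD('d). \<forall>x r. 0 < r \<longrightarrow> r \<le> 1 \<longrightarrow>
          c * measure lborel (K \<inter> mcube x r) \<le> C' * r powr s')"

lemma box_union_fmeasurable: "box_union K \<Longrightarrow> K \<in> fmeasurable lborel"
  by (simp add: box_union_compact fmeasurable_compact)

text \<open>Since \<open>K\<close> consists of finitely many boxes, weak convergence of the normalized measures on \<open>E n\<close> passes to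
their restrictions to \<open>K\<close>.\<close>

lemma equidistributed_box_union:
  assumes "box_union K" "K \<subseteq> cbox a b"
  obtains B where "0 \<le> B" "\<And>n c d. n \<in> N \<Longrightarrow>
    \<bar>measure lborel (K \<inter> E n \<inter> cbox c d) / p n - measure lborel (K \<inter> cbox c d)\<bar> \<le> B * \<delta> n"
proof -
  obtain \<R> where R: "finite \<R>" "pairwise disjnt \<R>" "\<And>R. R \<in> \<R> \<Longrightarrow> \<exists>a b. R = cbox a b" "K = \<Union>\<R>"
    using assms(1) unfolding box_union_def by blast
  have "\<bar>measure lborel (K \<inter> E n \<inter> cbox c d) / p n - measure lborel (K \<inter> cbox c d)\<bar>
      \<le> real (card \<R>) * \<delta> n" if n: "n \<in> N" for n c d
  proof -
    have split: "measure lborel (K \<inter> F) = (\<Sum>R\<in>\<R>. measure lborel (R \<inter> F))"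
      if "F \<in> sets lborel" for F
    proof -
      have "K \<inter> F = (\<Union>R\<in>\<R>. R \<inter> F)" using R(4) by auto
      moreover have "measure lborel (\<Union>R\<in>\<R>. R \<inter> F) = (\<Sum>R\<in>\<R>. measure lborel (R \<inter> F))"
      proof (rule measure_UNION')
        show "R \<inter> F \<in> fmeasurable lborel" if "R \<in> \<R>" for R
          using R(3)[OF that] \<open>F \<in> sets lborel\<close>
          by (metis fmeasurable_Int_fmeasurable fmeasurable_cbox)
        show "pairwise (\<lambda>i j. disjnt (i \<inter> F) (j \<inter> F)) \<R>"
          using R(2) unfolding pairwise_def disjnt_def by blast
      qed (rule R(1))
      ultimately show ?thesis by simp
    qed
    have E: "E n \<in> sets lborel"
      using box_union_fmeasurable[OF box_union_E[OF n]] by (rule fmeasurableD)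
    have "measure lborel (K \<inter> E n \<inter> cbox c d) / p n - measure lborel (K \<inter> cbox c d)
      = (\<Sum>R\<in>\<R>. measure lborel (R \<inter> (E n \<inter> cbox c d)) / p n - measure lborel (R \<inter> cbox c d))"
      using split[of "E n \<inter> cbox c d"] split[of "cbox c d"] E
      by (simp add: sum_divide_distrib sum_subtractf Int_assoc sets.Int)
    also have "\<bar>\<dots>\<bar> \<le> (\<Sum>R\<in>\<R>. \<delta> n)"
    proof (rule order_trans[OF sum_abs], rule sum_mono)
      fix R assume "R \<in> \<R>"
      then obtain a' b' where "R = cbox a' b'" using R(3) by blast
      then have "\<exists>u v. R \<inter> cbox c d = cbox u v"
        by (simp only: Int_interval) (intro exI, rule refl)
      then obtain u v where uv: "R \<inter> cbox c d = cbox u v" by (elim exE)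
      have "cbox u v \<subseteq> cbox a b" using \<open>R \<in> \<R>\<close> R(4) assms(2) uv by blast
      from equidistributed[OF n this]
      show "\<bar>measure lborel (R \<inter> (E n \<inter> cbox c d)) / p n - measure lborel (R \<inter> cbox c d)\<bar> \<le> \<delta> n"
        unfolding uv[symmetric] by (simp only: Int_left_commute)
    qed
    finally show ?thesis by simp
  qed
  then show ?thesis using that[of "real (card \<R>)"] by simp
qed

lemma frostman_cbox:
  assumes "s' < s"
  shows "frostman s' 1 (cbox a b)"
  unfolding frostman_def
proof (intro conjI exI[of _ "2 ^ CARD('d)"] allI impI)
  fix x :: "real ^ 'd" and r :: real assume r: "0 < r" "r \<le> 1"
  have "measure lborel (cbox a b \<inter> mcube x r) \<le> measure lborel (mcube x r)"
    by (rule measure_mono_fmeasurable) (auto simp: mcube_eq_cbox)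
  also have "\<dots> = 2 ^ CARD('d) * r powr CARD('d)"
    using r by (simp add: measure_mcube power_mult_distrib powr_realpow)
  also have "\<dots> \<le> 2 ^ CARD('d) * r powr s'"
    using r assms s_le by (intro mult_left_mono powr_mono') auto
  finally show "1 * measure lborel (cbox a b \<inter> mcube x r) \<le> 2 ^ CARD('d) * r powr s'" by simp
qed (use start_pos in \<open>auto simp: box_union_cbox\<close>)

text \<open>The inductive step. As \<open>s' < s\<close>, there is a scale \<open>r0\<close>, depending on \<open>c\<close>, below which the uniform Frostman
condition with exponent \<open>s\<close> absorbs the factor \<open>c\<close>. Above \<open>r0\<close> the new measure is, for large \<open>n\<close>, as
close as desired to the old one.\<close>

lemma frostman_Int:
  assumes "s' < s" and K: "frostman s' c K"
  shows "\<forall>\<^sub>F n in sequentially. n \<in> N \<longrightarrow> frostman s' (c / p n) (K \<inter> E n)"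
proof -
  from K obtain C' where C': "C' < 2 * 2 ^ CARD('d)"
    "\<And>x r. 0 < r \<Longrightarrow> r \<le> 1 \<Longrightarrow> c * measure lborel (K \<inter> mcube x r) \<le> C' * r powr s'"
    and c: "0 < c" and bK: "box_union K" "K \<subseteq> cbox a b"
    and mK: "measure lborel (cbox a b) / 2 < c * measure lborel K"
    unfolding frostman_def by blast
  obtain B where B: "0 \<le> B" "\<And>n u v. n \<in> N \<Longrightarrow>
    \<bar>measure lborel (K \<inter> E n \<inter> cbox u v) / p n - measure lborel (K \<inter> cbox u v)\<bar> \<le> B * \<delta> n"
    using equidistributed_box_union[OF bK] by metis
  define C'' where "C'' = max 1 ((C' + 2 * 2 ^ CARD('d)) / 2)"
  have "(1::real) \<le> 2 ^ CARD('d)" by simp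
  then have "(1::real) < 2 * 2 ^ CARD('d)" by linarith
  moreover have "(C' + 2 * 2 ^ CARD('d)) / 2 < 2 * 2 ^ CARD('d)" "C' < (C' + 2 * 2 ^ CARD('d)) / 2"
    using C'(1) by (simp_all add: field_simps)
  ultimately have C'': "C'' < 2 * 2 ^ CARD('d)" "C' < C''" "1 \<le> C''"
    unfolding C''_def max_less_iff_conj less_max_iff_disj by (blast, blast, simp)
  define r0 where "r0 = (1 / (c * C + 1)) powr (1 / (s - s'))"
  have cC: "0 \<le> c * C" using c C_nonneg by simp
  have r0: "0 < r0" "r0 \<le> 1" using cC assms(1) by (auto simp: r0_def powr_le_one_le intro!: powr_le1)
  have r0_eq: "r0 powr (s - s') = 1 / (c * C + 1)"
    using assms(1) cC by (simp add: r0_def powr_powr)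
  have lim: "(\<lambda>n. c * (B * \<delta> n)) \<longlonglongrightarrow> 0"
    using tendsto_mult_right_zero[OF tendsto_mult_right_zero[OF \<delta>_tendsto_0]] .
  have "0 < min (c * measure lborel K - measure lborel (cbox a b) / 2) ((C'' - C') * min 1 (r0 powr s'))"
    using mK C'' r0 by simp
  from order_tendstoD(2)[OF lim this]
  have "\<forall>\<^sub>F n in sequentially. c * (B * \<delta> n) < c * measure lborel K - measure lborel (cbox a b) / 2 \<and>
    c * (B * \<delta> n) < (C'' - C') * min 1 (r0 powr s')"
    by eventually_elim simp
  then show ?thesis
  proof eventually_elim
    case (elim n)
    show "n \<in> N \<longrightarrow> frostman s' (c / p n) (K \<inter> E n)"
    proof
      assume n: "n \<in> N"
      have c_est: "c / p n * measure lborel (K \<inter> E n \<inter> cbox u v) \<le>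
          c * measure lborel (K \<inter> cbox u v) + c * (B * \<delta> n) \<and>
          c * measure lborel (K \<inter> cbox u v) - c * (B * \<delta> n) \<le> c / p n * measure lborel (K \<inter> E n \<inter> cbox u v)" for u v
      proof -
        have "measure lborel (K \<inter> E n \<inter> cbox u v) / p n \<le> measure lborel (K \<inter> cbox u v) + B * \<delta> n"
          "measure lborel (K \<inter> cbox u v) - B * \<delta> n \<le> measure lborel (K \<inter> E n \<inter> cbox u v) / p n"
          using B(2)[OF n, of u v] by linarith+
        from mult_left_mono[OF this(1), of c] mult_left_mono[OF this(2), of c] c
        show ?thesis by (simp add: algebra_simps)
      qed
      have Eb: "box_union (E n)" by (rule box_union_E[OF n])
      have bKE: "box_union (K \<inter> E n)" by (rule box_union_Int[OF bK(1) Eb])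
      have "measure lborel (cbox a b) / 2 < c / p n * measure lborel (K \<inter> E n)"
      proof -
        have "K \<inter> E n \<inter> cbox a b = K \<inter> E n" "K \<inter> cbox a b = K" using bK by auto
        with c_est[of a b] have "c * measure lborel K - c * (B * \<delta> n) \<le> c / p n * measure lborel (K \<inter> E n)"
          by simp
        with elim show ?thesis by linarith
      qed
      moreover have "c / p n * measure lborel (K \<inter> E n \<inter> mcube x r) \<le> C'' * r powr s'"
        if r: "0 < r" "r \<le> 1" for x r
      proof (cases "r \<le> r0")
        \<comment> \<open>Scales at which the bound for a single \<open>E n\<close> is strong enough.\<close>
        case True
        have "measure lborel (K \<inter> E n \<inter> mcube x r) \<le> measure lborel (E n \<inter> mcube x r)"
          by (rule measure_mono_fmeasurable)
            (use box_union_fmeasurable[OF bKE] box_union_fmeasurable[OF Eb] in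
              \<open>auto simp: mcube_eq_cbox fmeasurable_Int_fmeasurable intro!: sets.Int\<close>)
        then have "c / p n * measure lborel (K \<inter> E n \<inter> mcube x r)
            \<le> c * (measure lborel (E n \<inter> mcube x r) / p n)"
          using c p_pos[OF n] by (simp add: field_simps)
        also have "\<dots> \<le> c * (C * r powr s)"
          using cube_bound[OF n r] c by (intro mult_left_mono) auto
        also have "\<dots> = c * C * r powr (s - s') * r powr s'"
          by (simp add: mult.assoc flip: powr_add)
        also have "\<dots> \<le> c * C * r0 powr (s - s') * r powr s'"
          using True r assms(1) cC by (intro mult_right_mono mult_left_mono powr_mono2) auto
        also have "\<dots> \<le> 1 * r powr s'"
          using cC by (intro mult_right_mono) (auto simp: r0_eq)
        also have "\<dots> \<le> C'' * r powr s'" using C'' by (intro mult_right_mono) auto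
        finally show ?thesis .
      next
        case False
        \<comment> \<open>The minimum with \<open>1\<close> is the lower bound for \<open>r powr s'\<close> in case \<open>s'\<close> is negative.\<close>
        have "min 1 (r0 powr s') \<le> r powr s'"
        proof (cases "0 \<le> s'")
          case True
          then show ?thesis using False r r0 powr_mono2[of s' r0 r] by (simp add: min.coboundedI2)
        next
          case s': False
          then show ?thesis using False r r0 powr_mono'[of s' 0 r] by (simp add: min.coboundedI1)
        qed
        then have "c * (B * \<delta> n) \<le> (C'' - C') * r powr s'"
          using elim C'' mult_left_mono[of "min 1 (r0 powr s')" "r powr s'" "C'' - C'"] by linarith
        moreover have "c * measure lborel (K \<inter> mcube x r) \<le> C' * r powr s'"
          by (rule C'(2)[OF r])
        ultimately show ?thesis
          using c_est[of "x - vec r" "x + vec r"] by (simp add: mcube_eq_cbox algebra_simps)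
      qed
      ultimately show "frostman s' (c / p n) (K \<inter> E n)"
        unfolding frostman_def using bKE c p_pos[OF n] bK C'' by auto
    qed
  qed
qed

lemma frostman_sequence:
  assumes "s' < s"
  obtains n c K where "\<And>k. frostman s' (c k) (K k)" "\<And>k. K (Suc k) \<subseteq> K k"
    "\<And>k. n k < n (Suc k)" "\<And>k. n (Suc k) \<in> N" "\<And>k. K (Suc k) \<subseteq> E (n (Suc k))"
proof -
  define Q where "Q = (\<lambda>(i::nat) (x :: nat \<times> real \<times> (real ^ 'd) set) (y :: nat \<times> real \<times> (real ^ 'd) set).
      fst x < fst y \<and> fst y \<in> N \<and> snd (snd y) \<subseteq> snd (snd x) \<inter> E (fst y))"
  define P where "P = (\<lambda>(i::nat) (x :: nat \<times> real \<times> (real ^ 'd) set). frostman s' (fst (snd x)) (snd (snd x)))"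
  have "\<exists>f. \<forall>n. P n (f n) \<and> Q n (f n) (f (Suc n))"
  proof (rule dependent_nat_choice)
    show "\<exists>x. P 0 x"
      using frostman_cbox[OF assms] by (auto simp: P_def)
  next
    fix x i assume "P i x"
    then have "\<forall>\<^sub>F n in sequentially. n \<in> N \<longrightarrow> frostman s' (fst (snd x) / p n) (snd (snd x) \<inter> E n)"
      using frostman_Int[OF assms] by (simp add: P_def)
    then obtain n0 where n0: "\<And>n. n0 \<le> n \<Longrightarrow> n \<in> N \<Longrightarrow> frostman s' (fst (snd x) / p n) (snd (snd x) \<inter> E n)"
      unfolding eventually_sequentially by blast
    obtain n where "n \<in> N" "max n0 (fst x) < n"
      using infinite_N unfolding infinite_nat_iff_unbounded by blast
    with n0[of n] show "\<exists>y. P (Suc i) y \<and> Q i x y"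
      by (intro exI[of _ "(n, fst (snd x) / p n, snd (snd x) \<inter> E n)"]) (auto simp: P_def Q_def)
  qed
  then obtain f where "\<And>n. P n (f n) \<and> Q n (f n) (f (Suc n))" by blast
  then show ?thesis
    by (intro that[of "\<lambda>k. fst (snd (f k))" "\<lambda>k. snd (snd (f k))" "\<lambda>k. fst (f k)"])
      (auto simp: P_def Q_def)
qed

text \<open>The mass distribution principle without a limit measure. A cover of the limsup set covers the
intersection of the nested compact sets \<open>K k\<close>, hence finitely many slightly larger open cubes cover a
single \<open>K k\<close>, and the Frostman condition for \<open>K k\<close> bounds its mass by the sum over these cubes.\<close>

theorem limsup_cube_content_pos:
  assumes s': "0 \<le> s'" "s' < s"
  shows "\<exists>\<kappa>>0. \<forall>(x :: nat \<Rightarrow> real ^ 'd) \<rho>. (\<forall>i. 0 < \<rho> i) \<longrightarrow>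
     {y \<in> cbox a b. infinite {n \<in> N. y \<in> E n}} \<subseteq> (\<Union>i. mcube (x i) (\<rho> i)) \<longrightarrow>
     ennreal \<kappa> \<le> (\<Sum>i. ennreal (\<rho> i powr s'))"
proof -
  obtain n c K where F: "\<And>k. frostman s' (c k) (K k)" and K_dec: "\<And>k. K (Suc k) \<subseteq> K k"
    and n_less: "\<And>k. n k < n (Suc k)" and nN: "\<And>k. n (Suc k) \<in> N"
    and KE: "\<And>k. K (Suc k) \<subseteq> E (n (Suc k))"
    using frostman_sequence[OF s'(2)] by metis
  let ?m = "measure lborel (cbox a b)"
  let ?A = "2 * 2 ^ CARD('d) :: real"
  define \<kappa> where "\<kappa> = min ((1/2) powr s') (?m / (2 * ?A * 2 powr s'))"
  show ?thesis
  proof (intro exI[of _ \<kappa>] conjI allI impI)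
    show "0 < \<kappa>" using start_pos by (simp add: \<kappa>_def)
    fix x :: "nat \<Rightarrow> real ^ 'd" and \<rho> :: "nat \<Rightarrow> real"
    assume \<rho>_pos: "\<forall>i. 0 < \<rho> i"
      and cov: "{y \<in> cbox a b. infinite {n \<in> N. y \<in> E n}} \<subseteq> (\<Union>i. mcube (x i) (\<rho> i))"
    have \<rho>: "0 < \<rho> i" for i using \<rho>_pos by simp
    show "ennreal \<kappa> \<le> (\<Sum>i. ennreal (\<rho> i powr s'))"
    proof (cases "\<exists>i. 1/2 < \<rho> i")
      case True
      \<comment> \<open>The Frostman condition is only available for cubes of half-side at most \<open>1\<close>; a larger cube is expensive enough by itself.\<close>
      then obtain i where "1/2 < \<rho> i" by blast
      then have "(1/2) powr s' \<le> \<rho> i powr s'" using s' by (intro powr_mono2) auto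
      then have "ennreal \<kappa> \<le> ennreal (\<rho> i powr s')" by (intro ennreal_leI) (simp add: \<kappa>_def)
      also have "\<dots> = (\<Sum>j\<in>{i}. ennreal (\<rho> j powr s'))" by simp
      also have "\<dots> \<le> (\<Sum>i. ennreal (\<rho> i powr s'))" by (rule sum_le_suminf) (rule summableI, auto)
      finally show ?thesis .
    next
      case False
      define O' where "O' = (\<lambda>i. box (x i - vec (2 * \<rho> i)) (x i + vec (2 * \<rho> i)))"
      have mcube_O: "mcube (x i) (\<rho> i) \<subseteq> O' i" for i
      proof
        fix y assume y: "y \<in> mcube (x i) (\<rho> i)"
        have "\<bar>y $ j - x i $ j\<bar> < 2 * \<rho> i" for j
        proof -
          have "\<bar>y $ j - x i $ j\<bar> \<le> \<rho> i" using y by (simp add: mcube_def)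
          then show ?thesis using \<rho>[of i] by linarith
        qed
        then have "x i $ j - 2 * \<rho> i < y $ j \<and> y $ j < x i $ j + 2 * \<rho> i" for j
          by (simp add: abs_less_iff algebra_simps)
        then show "y \<in> O' i" by (simp add: O'_def mem_box_cart)
      qed
      have O_mcube: "O' i \<subseteq> mcube (x i) (2 * \<rho> i)" for i
        unfolding O'_def mcube_eq_cbox by (rule box_subset_cbox)
      have K_compact: "compact (K k)" for k using F box_union_compact unfolding frostman_def by blast
      have K_mono: "K j \<subseteq> K i" if "i \<le> j" for i j
        by (rule lift_Suc_antimono_le[of K, OF K_dec that])
      have n_mono: "strict_mono n" using n_less by (simp add: strict_mono_Suc_iff)
      have inter: "(\<Inter>k. K k) \<subseteq> (\<Union>i. O' i)"
      proof
        fix y assume y: "y \<in> (\<Inter>k. K k)"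
        have "y \<in> cbox a b" using y F[of 0] unfolding frostman_def by blast
        moreover have "infinite {m \<in> N. y \<in> E m}"
        proof -
          have "(\<lambda>k. n (Suc k)) ` UNIV \<subseteq> {m \<in> N. y \<in> E m}" using y KE nN by blast
          moreover have "inj (\<lambda>k. n (Suc k))"
            using n_mono by (simp add: inj_on_def strict_mono_eq)
          ultimately show ?thesis by (meson finite_subset range_inj_infinite)
        qed
        ultimately have "y \<in> (\<Union>i. mcube (x i) (\<rho> i))" using cov by blast
        then show "y \<in> (\<Union>i. O' i)" using mcube_O by blast
      qed
      have "open (\<Union>i. O' i)" unfolding O'_def by (intro open_UN) auto
      have "\<exists>k. K k \<subseteq> (\<Union>i. O' i)"
      proof (rule ccontr)
        assume *: "\<nexists>k. K k \<subseteq> (\<Union>i. O' i)"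
        have "\<Inter> (range (\<lambda>k. K k - (\<Union>i. O' i))) \<noteq> {}"
        proof (rule compact_nest)
          show "compact (K k - (\<Union>i. O' i))" for k
            using K_compact \<open>open (\<Union>i. O' i)\<close> by (rule compact_diff)
          show "K k - (\<Union>i. O' i) \<noteq> {}" for k using * by blast
          show "K j - (\<Union>i. O' i) \<subseteq> K i - (\<Union>i. O' i)" if "i \<le> j" for i j
            using K_mono[OF that] by blast
        qed
        with inter show False by blast
      qed
      then obtain k where k: "K k \<subseteq> (\<Union>i. O' i)" by blast
      obtain I where I: "finite I" "K k \<subseteq> (\<Union>i\<in>I. O' i)"
        by (rule compactE_image[OF K_compact[of k], of UNIV O']) (use k in \<open>auto simp: O'_def\<close>)
      from F[of k] obtain C' where C': "C' < ?A"
        "\<And>x r. 0 < r \<Longrightarrow> r \<le> 1 \<Longrightarrow> c k * measure lborel (K k \<inter> mcube x r) \<le> C' * r powr s'"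
        and c: "0 < c k" and mK: "?m / 2 < c k * measure lborel (K k)"
        unfolding frostman_def by blast
      have KM: "K k \<inter> mcube (x i) r \<in> fmeasurable lborel" for i r
        by (rule fmeasurable_compact) (auto intro!: compact_Int K_compact simp: mcube_eq_cbox)
      have "?m / 2 \<le> c k * measure lborel (K k)" using mK by simp
      also have "\<dots> \<le> c k * measure lborel (\<Union>i\<in>I. K k \<inter> mcube (x i) (2 * \<rho> i))"
      proof (rule mult_left_mono[OF measure_mono_fmeasurable])
        show "K k \<subseteq> (\<Union>i\<in>I. K k \<inter> mcube (x i) (2 * \<rho> i))" using I(2) O_mcube by blast
        show "K k \<in> sets lborel" using K_compact fmeasurable_compact fmeasurableD by blast
        show "(\<Union>i\<in>I. K k \<inter> mcube (x i) (2 * \<rho> i)) \<in> fmeasurable lborel"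
          using I(1) KM by (intro fmeasurable.finite_UN) auto
      qed (use c in simp)
      also have "\<dots> \<le> c k * (\<Sum>i\<in>I. measure lborel (K k \<inter> mcube (x i) (2 * \<rho> i)))"
        by (intro mult_left_mono measure_UNION_le I(1) fmeasurableD[OF KM]) (use c in simp)
      also have "\<dots> = (\<Sum>i\<in>I. c k * measure lborel (K k \<inter> mcube (x i) (2 * \<rho> i)))"
        by (rule sum_distrib_left)
      also have "\<dots> \<le> (\<Sum>i\<in>I. ?A * (2 powr s' * \<rho> i powr s'))"
      proof (rule sum_mono)
        fix i
        have "\<rho> i \<le> 1/2" using False by (meson not_le)
        then have "2 * \<rho> i \<le> 1" by simp
        then have "c k * measure lborel (K k \<inter> mcube (x i) (2 * \<rho> i)) \<le> C' * (2 * \<rho> i) powr s'"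
          using \<rho>[of i] by (intro C'(2)) auto
        also have "\<dots> \<le> ?A * (2 * \<rho> i) powr s'" using C'(1) by (intro mult_right_mono) auto
        finally show "c k * measure lborel (K k \<inter> mcube (x i) (2 * \<rho> i)) \<le> ?A * (2 powr s' * \<rho> i powr s')"
          using \<rho>[of i] by (simp add: powr_mult)
      qed
      also have "\<dots> = (?A * 2 powr s') * (\<Sum>i\<in>I. \<rho> i powr s')"
        by (simp add: sum_distrib_left mult.assoc)
      finally have "?m / (2 * ?A * 2 powr s') \<le> (\<Sum>i\<in>I. \<rho> i powr s')"
        by (simp add: field_simps)
      then have "ennreal \<kappa> \<le> ennreal (\<Sum>i\<in>I. \<rho> i powr s')"
        by (intro ennreal_leI) (simp add: \<kappa>_def)
      also have "\<dots> = (\<Sum>i\<in>I. ennreal (\<rho> i powr s'))" by (simp add: sum_ennreal)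
      also have "\<dots> \<le> (\<Sum>i. ennreal (\<rho> i powr s'))" using I(1) by (intro sum_le_suminf) auto
      finally show ?thesis .
    qed
  qed
qed

end

section \<open>Boxes attached to a rectangular grid\<close>

lemma card_int_interval_le:
  fixes u v :: real
  assumes "u \<le> v + 1"
  shows "finite {k::int. u \<le> k \<and> k \<le> v}" "real (card {k::int. u \<le> k \<and> k \<le> v}) \<le> v - u + 1"
proof -
  have eq: "{k::int. u \<le> k \<and> k \<le> v} = {\<lceil>u\<rceil>..\<lfloor>v\<rfloor>}" by (auto simp: ceiling_le_iff le_floor_iff)
  show "finite {k::int. u \<le> k \<and> k \<le> v}" unfolding eq by simp
  have "real (nat (\<lfloor>v\<rfloor> + 1 - \<lceil>u\<rceil>)) \<le> v - u + 1"
    using assms by linarith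
  then show "real (card {k::int. u \<le> k \<and> k \<le> v}) \<le> v - u + 1" unfolding eq by simp
qed

lemma card_int_interval_ge:
  fixes u v :: real
  shows "max 0 (v - u - 1) \<le> real (card {k::int. u \<le> k \<and> k \<le> v})"
proof -
  have eq: "{k::int. u \<le> k \<and> k \<le> v} = {\<lceil>u\<rceil>..\<lfloor>v\<rfloor>}" by (auto simp: ceiling_le_iff le_floor_iff)
  have "v - u - 1 \<le> real (nat (\<lfloor>v\<rfloor> + 1 - \<lceil>u\<rceil>))" by linarith
  then show ?thesis unfolding eq by simp
qed

text \<open>In each coordinate the cells of the grid have side \<open>5 / G j\<close>. The box with index \<open>z\<close> has its centre \<open>c z\<close>
somewhere in the slab \<open>5 * z j - 1 \<le> G j * _ \<le> 5 * z j + 2\<close> and half-sides \<open>h\<close>. With spacing \<open>5\<close> these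
slabs, even after enlargement by \<open>h\<close>, are disjoint for different indices.\<close>

locale box_grid =
  fixes G :: "'d::finite \<Rightarrow> real" and c :: "('d \<Rightarrow> int) \<Rightarrow> real ^ 'd" and h :: "real ^ 'd"
  assumes G_pos: "\<And>j. 0 < G j"
    and h_pos: "\<And>j. 0 < h $ j" and h_le: "\<And>j. G j * h $ j \<le> 1/2"
    and c_bounds: "\<And>z j. 5 * of_int (z j) - 1 \<le> G j * c z $ j"
      "\<And>z j. G j * c z $ j \<le> 5 * of_int (z j) + 2"
begin

definition R where "R z = cbox (c z - h) (c z + h)"
text \<open>A finite index set that contains the indices of all boxes inside the unit cube, which is where the boxes are
needed; the upper bound is generous.\<close>

definition Z where "Z = {z. \<forall>j. 0 \<le> z j \<and> of_int (z j) \<le> G j}"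
definition E where "E = (\<Union>z\<in>Z. R z)"
text \<open>The quotient of the volumes of a box and of a cell of the grid.\<close>

definition density where "density = (\<Prod>j\<in>UNIV. 2 * h $ j * G j / 5)"

lemma R_bounds:
  assumes "y \<in> R z"
  shows "5 * of_int (z j) - 3/2 \<le> G j * y $ j" "G j * y $ j \<le> 5 * of_int (z j) + 5/2"
proof -
  have "c z $ j - h $ j \<le> y $ j" "y $ j \<le> c z $ j + h $ j"
    using assms by (auto simp: R_def mem_box_cart)
  then have "G j * (c z $ j - h $ j) \<le> G j * y $ j" "G j * y $ j \<le> G j * (c z $ j + h $ j)"
    using G_pos[of j] by (auto intro!: mult_left_mono)
  then show "5 * of_int (z j) - 3/2 \<le> G j * y $ j" "G j * y $ j \<le> 5 * of_int (z j) + 5/2"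
    using c_bounds[where z=z and j=j] h_le[of j] by (auto simp: algebra_simps)
qed

lemma R_disjnt:
  assumes "z \<noteq> z'" shows "disjnt (R z) (R z')"
  unfolding disjnt_def
proof (rule equals0I)
  fix y assume y: "y \<in> R z \<inter> R z'"
  have "z j = z' j" for j
    using R_bounds[where y=y and z=z and j=j] R_bounds[where y=y and z=z' and j=j] y by auto
  with assms show False by auto
qed

lemma finite_Z: "finite Z"
proof -
  have "Z \<subseteq> Pi\<^sub>E UNIV (\<lambda>j. {0..\<lfloor>G j\<rfloor>})" by (simp add: Z_def le_floor_iff subset_eq PiE_UNIV_domain)
  moreover have "finite (Pi\<^sub>E UNIV (\<lambda>j. {0..\<lfloor>G j\<rfloor>}))" by (rule finite_PiE) auto
  ultimately show ?thesis by (rule finite_subset)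
qed

lemma box_union_E: "box_union E"
  unfolding box_union_def E_def
proof (intro exI[of _ "R ` Z"] conjI)
  show "pairwise disjnt (R ` Z)"
    by (rule pairwise_imageI) (use R_disjnt in blast)
qed (use finite_Z in \<open>auto simp: R_def\<close>)

lemma measure_R: "measure lborel (R z) = (\<Prod>j\<in>UNIV. 2 * h $ j)"
  unfolding R_def using h_pos by (subst measure_cbox_cart) (auto simp: less_imp_le add_increasing)

lemma density_pos: "0 < density"
  unfolding density_def using h_pos G_pos by (intro prod_pos) auto

lemma R_fmeasurable: "R z \<in> fmeasurable lborel" by (simp add: R_def)

lemma R_Int_cbox_fmeasurable: "R z \<inter> cbox u v \<in> fmeasurable lborel"
  by (simp add: R_def fmeasurable_Int_fmeasurable)

lemma card_meeting:
  assumes "\<And>j. u $ j \<le> v $ j"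
  shows "real (card {z \<in> Z. R z \<inter> cbox u v \<noteq> {}}) \<le> (\<Prod>j\<in>UNIV. (G j * (v $ j - u $ j) + 9) / 5)"
proof -
  define I where "I = (\<lambda>j. {k::int. (G j * u $ j - 5/2) / 5 \<le> k \<and> k \<le> (G j * v $ j + 3/2) / 5})"
  have mono: "G j * u $ j \<le> G j * v $ j" for j using assms G_pos[of j] by (simp add: mult_left_mono)
  have le: "(G j * u $ j - 5/2) / 5 \<le> (G j * v $ j + 3/2) / 5 + 1" for j using mono[of j] by (simp add: field_simps)
  have sub: "{z \<in> Z. R z \<inter> cbox u v \<noteq> {}} \<subseteq> Pi\<^sub>E UNIV I"
  proof
    fix z assume "z \<in> {z \<in> Z. R z \<inter> cbox u v \<noteq> {}}"
    then obtain y where y: "y \<in> R z" "y \<in> cbox u v" by blast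
    have "z j \<in> I j" for j
    proof -
      have "G j * u $ j \<le> G j * y $ j" "G j * y $ j \<le> G j * v $ j"
        using y(2) G_pos[of j] by (auto simp: mem_box_cart intro!: mult_left_mono)
      with R_bounds[OF y(1), where j=j] show ?thesis by (simp add: I_def)
    qed
    then show "z \<in> Pi\<^sub>E UNIV I" by auto
  qed
  have fin: "finite (I j)" for j unfolding I_def by (rule card_int_interval_le(1)[OF le])
  have "card {z \<in> Z. R z \<inter> cbox u v \<noteq> {}} \<le> card (Pi\<^sub>E UNIV I)"
    using sub fin by (intro card_mono finite_PiE) auto
  also have "card (Pi\<^sub>E UNIV I) = (\<Prod>j\<in>UNIV. card (I j))" by (simp add: card_PiE)
  finally have "real (card {z \<in> Z. R z \<inter> cbox u v \<noteq> {}}) \<le> (\<Prod>j\<in>UNIV. real (card (I j)))"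
    by (simp flip: of_nat_prod)
  also have "\<dots> \<le> (\<Prod>j\<in>UNIV. (G j * (v $ j - u $ j) + 9) / 5)"
  proof (intro prod_mono conjI)
    fix j
    show "real (card (I j)) \<le> (G j * (v $ j - u $ j) + 9) / 5"
      using card_int_interval_le(2)[OF le[of j]] by (simp add: I_def field_simps)
  qed simp
  finally show ?thesis .
qed

lemma card_inside:
  assumes "\<And>j. 0 \<le> u $ j" "\<And>j. v $ j \<le> 1"
  shows "(\<Prod>j\<in>UNIV. max 0 ((G j * (v $ j - u $ j) - 9) / 5)) \<le> real (card {z \<in> Z. R z \<subseteq> cbox u v})"
proof -
  define I where "I = (\<lambda>j. {k::int. (G j * u $ j + 3/2) / 5 \<le> k \<and> k \<le> (G j * v $ j - 5/2) / 5})"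
  have sub: "Pi\<^sub>E UNIV I \<subseteq> {z \<in> Z. R z \<subseteq> cbox u v}"
  proof
    fix z assume z: "z \<in> Pi\<^sub>E UNIV I"
    have zj: "G j * u $ j + 3/2 \<le> 5 * of_int (z j)" "5 * of_int (z j) \<le> G j * v $ j - 5/2" for j
      using z unfolding I_def PiE_def Pi_def by (auto simp: field_simps)
    have "0 \<le> z j \<and> of_int (z j) \<le> G j" for j
    proof
      have "0 \<le> G j * u $ j" "G j * v $ j \<le> G j" using assms[of j] G_pos[of j] by auto
      with zj[of j] G_pos[of j] show "0 \<le> z j" "of_int (z j) \<le> G j" by linarith+
    qed
    moreover have "R z \<subseteq> cbox u v"
    proof
      fix y assume "y \<in> R z"
      have "G j * u $ j \<le> G j * y $ j \<and> G j * y $ j \<le> G j * v $ j" for j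
        using R_bounds[OF \<open>y \<in> R z\<close>, where j=j] zj[of j] by linarith
      then show "y \<in> cbox u v" using G_pos by (simp add: mem_box_cart)
    qed
    ultimately show "z \<in> {z \<in> Z. R z \<subseteq> cbox u v}" by (simp add: Z_def)
  qed
  have "(\<Prod>j\<in>UNIV. max 0 ((G j * (v $ j - u $ j) - 9) / 5)) \<le> (\<Prod>j\<in>UNIV. real (card (I j)))"
  proof (intro prod_mono conjI)
    fix j
    show "max 0 ((G j * (v $ j - u $ j) - 9) / 5) \<le> real (card (I j))"
      using card_int_interval_ge[of "(G j * v $ j - 5/2) / 5" "(G j * u $ j + 3/2) / 5"]
      by (simp add: I_def field_simps)
  qed simp
  also have "\<dots> = real (card (Pi\<^sub>E UNIV I))" by (simp add: card_PiE)
  also have "card (Pi\<^sub>E UNIV I) \<le> card {z \<in> Z. R z \<subseteq> cbox u v}"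
    using sub finite_Z by (intro card_mono) auto
  finally show ?thesis by simp
qed

lemma measure_E_Int_le:
  assumes "\<And>j. u $ j \<le> v $ j" "\<And>z. measure lborel (R z \<inter> cbox u v) \<le> B"
  shows "measure lborel (E \<inter> cbox u v) \<le> (\<Prod>j\<in>UNIV. (G j * (v $ j - u $ j) + 9) / 5) * B"
proof -
  let ?Z = "{z \<in> Z. R z \<inter> cbox u v \<noteq> {}}"
  have B: "0 \<le> B" using assms(2) measure_nonneg order_trans by blast
  have "E \<inter> cbox u v = (\<Union>z\<in>?Z. R z \<inter> cbox u v)" by (auto simp: E_def)
  also have "measure lborel \<dots> \<le> (\<Sum>z\<in>?Z. measure lborel (R z \<inter> cbox u v))"
    by (rule measure_UNION_le) (use finite_Z in simp, rule fmeasurableD, rule R_Int_cbox_fmeasurable)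
  also have "\<dots> \<le> (\<Sum>z\<in>?Z. B)" by (intro sum_mono assms(2))
  also have "\<dots> = real (card ?Z) * B" by simp
  also have "\<dots> \<le> (\<Prod>j\<in>UNIV. (G j * (v $ j - u $ j) + 9) / 5) * B"
    by (intro mult_right_mono card_meeting assms B)
  finally show ?thesis .
qed

lemma measure_cbox_upper:
  assumes "\<And>j. u $ j \<le> v $ j"
  shows "measure lborel (E \<inter> cbox u v) / density \<le> (\<Prod>j\<in>UNIV. v $ j - u $ j + 9 / G j)"
proof -
  have "measure lborel (E \<inter> cbox u v) \<le> (\<Prod>j\<in>UNIV. (G j * (v $ j - u $ j) + 9) / 5) * (\<Prod>j\<in>UNIV. 2 * h $ j)"
  proof (rule measure_E_Int_le[OF assms])
    fix z show "measure lborel (R z \<inter> cbox u v) \<le> (\<Prod>j\<in>UNIV. 2 * h $ j)"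
      unfolding measure_R[of z, symmetric]
      by (rule measure_mono_fmeasurable[OF _ fmeasurableD[OF R_Int_cbox_fmeasurable] R_fmeasurable]) simp
  qed
  also have "\<dots> = density * (\<Prod>j\<in>UNIV. v $ j - u $ j + 9 / G j)"
    unfolding density_def prod.distrib[symmetric]
    using G_pos by (intro prod.cong) (auto simp: field_simps less_imp_neq[symmetric])
  finally show ?thesis using density_pos by (simp add: field_simps)
qed

lemma measure_cbox_lower:
  assumes "\<And>j. 0 \<le> u $ j" "\<And>j. v $ j \<le> 1"
  shows "(\<Prod>j\<in>UNIV. max 0 (v $ j - u $ j - 9 / G j)) \<le> measure lborel (E \<inter> cbox u v) / density"
proof -
  let ?Z = "{z \<in> Z. R z \<subseteq> cbox u v}"
  have "density * (\<Prod>j\<in>UNIV. max 0 (v $ j - u $ j - 9 / G j))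
    = (\<Prod>j\<in>UNIV. max 0 ((G j * (v $ j - u $ j) - 9) / 5)) * (\<Prod>j\<in>UNIV. 2 * h $ j)"
    unfolding density_def prod.distrib[symmetric]
  proof (intro prod.cong refl)
    fix j
    have "G j * max 0 (v $ j - u $ j - 9 / G j) = max 0 (G j * (v $ j - u $ j) - 9)"
      using G_pos[of j] by (auto simp: max_def field_simps)
    moreover have "max 0 ((G j * (v $ j - u $ j) - 9) / 5) = max 0 (G j * (v $ j - u $ j) - 9) / 5"
      by (auto simp: max_def)
    ultimately show "2 * h $ j * G j / 5 * max 0 (v $ j - u $ j - 9 / G j)
        = max 0 ((G j * (v $ j - u $ j) - 9) / 5) * (2 * h $ j)"
      by simp
  qed
  also have "\<dots> \<le> real (card ?Z) * (\<Prod>j\<in>UNIV. 2 * h $ j)"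
    using h_pos by (intro mult_right_mono card_inside assms prod_nonneg) (auto simp: less_imp_le)
  also have "\<dots> = (\<Sum>z\<in>?Z. measure lborel (R z))" by (simp add: measure_R)
  also have "\<dots> = measure lborel (\<Union>z\<in>?Z. R z)"
    using finite_Z R_fmeasurable R_disjnt by (intro measure_UNION'[symmetric]) (auto simp: pairwise_def)
  also have "\<dots> \<le> measure lborel (E \<inter> cbox u v)"
  proof (rule measure_mono_fmeasurable)
    show "(\<Union>z\<in>?Z. R z) \<in> sets lborel" using R_fmeasurable finite_Z fmeasurableD by blast
    show "E \<inter> cbox u v \<in> fmeasurable lborel"
      by (intro fmeasurable_compact compact_Int box_union_compact box_union_E compact_cbox)
  qed (auto simp: E_def)
  finally show ?thesis using density_pos by (simp add: field_simps)
qed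

text \<open>The restriction to the cube of side \<open>1/2\<close> keeps all factors in \<open>[0, 1]\<close>, so that the difference of two
products is at most the sum of the differences of their factors.\<close>

lemma measure_cbox_close:
  assumes sub: "cbox u v \<subseteq> cbox 0 (vec (1/2))" and G: "\<And>j. 18 \<le> G j"
  shows "\<bar>measure lborel (E \<inter> cbox u v) / density - measure lborel (cbox u v)\<bar> \<le> (\<Sum>j\<in>UNIV. 9 / G j)"
proof (cases "cbox u v = {}")
  case True
  then show ?thesis using G_pos by (simp add: sum_nonneg less_imp_le)
next
  case False
  then have le: "u $ j \<le> v $ j" for j by (simp add: interval_ne_empty_cart)
  have "u \<in> cbox u v" "v \<in> cbox u v" using le by (auto simp: mem_box_cart)
  then have uv: "0 \<le> u $ j" "v $ j \<le> 1/2" for j using sub by (auto simp: mem_box_cart subset_iff)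
  have 9: "0 < 9 / G j" "9 / G j \<le> 1/2" for j using G[of j] by (auto simp: field_simps)
  have m: "measure lborel (cbox u v) = (\<Prod>j\<in>UNIV. v $ j - u $ j)" by (rule measure_cbox_cart[OF le])
  have d: "\<bar>v $ j - u $ j\<bar> \<le> 1/2" for j using le[of j] uv[of j] by auto
  have up: "(\<Prod>j\<in>UNIV. v $ j - u $ j + 9 / G j) \<le> (\<Prod>j\<in>UNIV. v $ j - u $ j) + (\<Sum>j\<in>UNIV. 9 / G j)"
  proof -
    have "norm ((\<Prod>j\<in>UNIV. v $ j - u $ j + 9 / G j) - (\<Prod>j\<in>UNIV. v $ j - u $ j))
      \<le> (\<Sum>j\<in>UNIV. norm ((v $ j - u $ j + 9 / G j) - (v $ j - u $ j)))"
    proof (rule norm_prod_diff)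
      fix j show "norm (v $ j - u $ j + 9 / G j) \<le> 1" "norm (v $ j - u $ j) \<le> 1"
        using d[of j] 9[of j] unfolding real_norm_def by linarith+
    qed
    also have "\<dots> = (\<Sum>j\<in>UNIV. 9 / G j)" using 9 by (intro sum.cong) (auto simp: less_imp_le)
    finally show ?thesis unfolding real_norm_def by linarith
  qed
  have lo: "(\<Prod>j\<in>UNIV. v $ j - u $ j) - (\<Sum>j\<in>UNIV. 9 / G j) \<le> (\<Prod>j\<in>UNIV. max 0 (v $ j - u $ j - 9 / G j))"
  proof -
    have "norm ((\<Prod>j\<in>UNIV. max 0 (v $ j - u $ j - 9 / G j)) - (\<Prod>j\<in>UNIV. v $ j - u $ j))
      \<le> (\<Sum>j\<in>UNIV. norm (max 0 (v $ j - u $ j - 9 / G j) - (v $ j - u $ j)))"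
    proof (rule norm_prod_diff)
      fix j show "norm (max 0 (v $ j - u $ j - 9 / G j)) \<le> 1" "norm (v $ j - u $ j) \<le> 1"
        using d[of j] 9[of j] unfolding real_norm_def by linarith+
    qed
    also have "\<dots> \<le> (\<Sum>j\<in>UNIV. 9 / G j)"
    proof (rule sum_mono)
      fix j show "norm (max 0 (v $ j - u $ j - 9 / G j) - (v $ j - u $ j)) \<le> 9 / G j"
        using le[of j] 9[of j] unfolding real_norm_def max_def by (simp split: if_splits)
    qed
    finally show ?thesis unfolding real_norm_def by linarith
  qed
  have "v $ j \<le> 1" for j using uv(2)[of j] by simp
  from measure_cbox_lower[OF uv(1) this] measure_cbox_upper[OF le] lo up
  show ?thesis unfolding m by linarith
qed

text \<open>The \<open>j\<close>-th factor \<open>2 * r + 9 / G j\<close> counts the slabs of the grid that meet the cube, and the factor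
\<open>min 1 (r / h j)\<close> is the part of one box that fits into the cube.\<close>

lemma measure_mcube_le:
  assumes r: "0 < r"
  shows "measure lborel (E \<inter> mcube x r) / density \<le> (\<Prod>j\<in>UNIV. (2 * r + 9 / G j) * min 1 (r / h $ j))"
proof -
  let ?u = "x - vec r" and ?v = "x + vec r"
  have "measure lborel (E \<inter> cbox ?u ?v) \<le>
      (\<Prod>j\<in>UNIV. (G j * (?v $ j - ?u $ j) + 9) / 5) * (\<Prod>j\<in>UNIV. min (2 * h $ j) (2 * r))"
  proof (rule measure_E_Int_le)
    show "?u $ j \<le> ?v $ j" for j using r by simp
    fix z
    have "R z \<inter> cbox ?u ?v = cbox (\<chi> j. max (c z $ j - h $ j) (x $ j - r)) (\<chi> j. min (c z $ j + h $ j) (x $ j + r))"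
      (is "_ = cbox ?a ?b")
    proof (rule set_eqI)
      fix y
      have "y \<in> R z \<inter> cbox ?u ?v \<longleftrightarrow> (\<forall>j. (c z $ j - h $ j \<le> y $ j \<and> y $ j \<le> c z $ j + h $ j) \<and>
          x $ j - r \<le> y $ j \<and> y $ j \<le> x $ j + r)"
        unfolding R_def Int_iff mem_box_cart by (simp add: all_conj_distrib)
      also have "\<dots> \<longleftrightarrow> (\<forall>j. max (c z $ j - h $ j) (x $ j - r) \<le> y $ j \<and> y $ j \<le> min (c z $ j + h $ j) (x $ j + r))"
        by (rule all_cong1) (simp only: max.bounded_iff min.bounded_iff, argo)
      finally show "y \<in> R z \<inter> cbox ?u ?v \<longleftrightarrow> y \<in> cbox ?a ?b" by (simp add: mem_box_cart)
    qed
    moreover have "measure lborel (cbox ?a ?b) \<le> (\<Prod>j\<in>UNIV. min (2 * h $ j) (2 * r))"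
    proof (cases "cbox ?a ?b = {}")
      case True
      then show ?thesis using h_pos r by (auto intro!: prod_nonneg simp: less_imp_le)
    next
      case False
      then have "\<forall>j. ?a $ j \<le> ?b $ j" by (simp only: interval_ne_empty_cart(1) simp_thms)
      then have ab: "?a $ j \<le> ?b $ j" for j by (rule spec)
      then have "measure lborel (cbox ?a ?b) = (\<Prod>j\<in>UNIV. ?b $ j - ?a $ j)" by (rule measure_cbox_cart)
      also have "\<dots> \<le> (\<Prod>j\<in>UNIV. min (2 * h $ j) (2 * r))"
      proof (intro prod_mono conjI)
        fix j
        show "0 \<le> ?b $ j - ?a $ j" using ab[of j] by simp
        show "?b $ j - ?a $ j \<le> min (2 * h $ j) (2 * r)" by (simp add: min_def max_def)
      qed
      finally show ?thesis .
    qed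
    ultimately show "measure lborel (R z \<inter> cbox ?u ?v) \<le> (\<Prod>j\<in>UNIV. min (2 * h $ j) (2 * r))" by simp
  qed
  also have "\<dots> = density * (\<Prod>j\<in>UNIV. (2 * r + 9 / G j) * min 1 (r / h $ j))"
    unfolding density_def prod.distrib[symmetric]
  proof (intro prod.cong refl)
    fix j
    have "min (2 * h $ j) (2 * r) = 2 * h $ j * min 1 (r / h $ j)"
      using h_pos[of j] by (auto simp: min_def field_simps)
    then show "(G j * (?v $ j - ?u $ j) + 9) / 5 * min (2 * h $ j) (2 * r)
      = 2 * h $ j * G j / 5 * ((2 * r + 9 / G j) * min 1 (r / h $ j))"
      using G_pos[of j] by (simp add: field_simps)
  qed
  finally show ?thesis using density_pos by (simp add: mcube_eq_cbox field_simps)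
qed

end

section \<open>The exponent of the measure of small cubes\<close>

text \<open>For the limsup of boxes with sides \<open>exp (- n * (\<tau> + l j))\<close> on a grid with spacings \<open>exp (- n * l j)\<close>, a cube of
side \<open>exp (- n * u)\<close> has normalized measure about \<open>exp (- n * phi l \<tau> u)\<close>. The first summand comes from the
number of grid points and the second from the part of a box inside the cube.\<close>

definition phi :: "('d::finite \<Rightarrow> real) \<Rightarrow> real \<Rightarrow> real \<Rightarrow> real" where
  "phi l \<tau> u = (\<Sum>j\<in>UNIV. min u (l j) + max 0 (u - \<tau> - l j))"

lemma min_concave:
  fixes a b c t :: real
  assumes "0 \<le> t" "t \<le> 1"
  shows "(1 - t) * min a c + t * min b c \<le> min ((1 - t) * a + t * b) c"
proof -
  have "(1 - t) * min a c \<le> (1 - t) * a" "(1 - t) * min a c \<le> (1 - t) * c"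
    "t * min b c \<le> t * b" "t * min b c \<le> t * c" using assms by (auto intro!: mult_left_mono)
  then show ?thesis by (simp add: algebra_simps)
qed

text \<open>The graph of \<open>phi l \<tau>\<close> bends upwards only at the points \<open>\<tau> + l i\<close>. Between two consecutive ones, and between \<open>0\<close> and
the first, it is concave, so it lies above its chords; beyond the last one its slope is the dimension, which
is at least \<open>s\<close>.\<close>

lemma phi_ge_linear:
  fixes l :: "'d::finite \<Rightarrow> real"
  assumes l: "\<And>j. 0 < l j" and \<tau>: "0 \<le> \<tau>" and u: "0 \<le> u"
    and knots: "\<And>i. s * (\<tau> + l i) \<le> phi l \<tau> (\<tau> + l i)"
  shows "s * u \<le> phi l \<tau> u"
proof -
  define A where "A = range (\<lambda>i. \<tau> + l i)"
  have A: "finite A" "A \<noteq> {}" and A_pos: "\<And>a. a \<in> A \<Longrightarrow> 0 < a" using l \<tau> by (auto simp: A_def add_nonneg_pos)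
  have A_knots: "s * a \<le> phi l \<tau> a" if "a \<in> A" for a using that knots by (auto simp: A_def)
  have lA: "\<tau> + l j \<in> A" for j by (simp add: A_def)
  show ?thesis
  proof (cases "Max A \<le> u")
    case True
    define m where "m = Max A"
    have mA: "m \<in> A" using A by (simp add: m_def)
    have ge: "\<tau> + l j \<le> m" for j unfolding m_def by (rule Max_ge[OF A(1) lA])
    have phi_eq: "phi l \<tau> v = real CARD('d) * (v - \<tau>)" if "m \<le> v" for v
    proof -
      have "phi l \<tau> v = (\<Sum>j\<in>(UNIV::'d set). v - \<tau>)"
        unfolding phi_def
      proof (intro sum.cong refl)
        fix j have "\<tau> + l j \<le> v" using ge[of j] that by linarith
        then show "min v (l j) + max 0 (v - \<tau> - l j) = v - \<tau>" using \<tau> by linarith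
      qed
      then show ?thesis by simp
    qed
    have "s \<le> real CARD('d)"
    proof -
      have "s * m \<le> real CARD('d) * (m - \<tau>)" using A_knots[OF mA] phi_eq[of m] by simp
      also have "\<dots> \<le> real CARD('d) * m" using \<tau> by (intro mult_left_mono) auto
      finally show ?thesis using A_pos[OF mA] by simp
    qed
    then have "s * (u - m) \<le> real CARD('d) * (u - m)" using True by (intro mult_right_mono) (auto simp: m_def)
    moreover have "phi l \<tau> u = phi l \<tau> m + real CARD('d) * (u - m)"
      using phi_eq[of u] phi_eq[of m] True by (simp add: m_def algebra_simps)
    ultimately show ?thesis using A_knots[OF mA] by (simp add: algebra_simps)
  next
    case False
    define hi where "hi = Min {a \<in> A. u < a}"
    define lo where "lo = Max (insert 0 {a \<in> A. a \<le> u})"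
    have "{a \<in> A. u < a} \<noteq> {}" using False A by (metis (mono_tags, lifting) Max_in empty_Collect_eq not_le)
    then have hi: "hi \<in> A" "u < hi" using A Min_in[of "{a \<in> A. u < a}"] by (auto simp: hi_def)
    have lo: "lo \<in> insert 0 A" "lo \<le> u"
      using A u Max_in[of "insert 0 {a \<in> A. a \<le> u}"] unfolding lo_def by auto
    have gap: "a \<le> lo \<or> hi \<le> a" if "a \<in> A" for a
      using that A unfolding lo_def hi_def by (cases "a \<le> u") (auto intro!: Max_ge Min_le)
    define t where "t = (u - lo) / (hi - lo)"
    have t: "0 \<le> t" "t \<le> 1" using hi lo by (auto simp: t_def divide_simps)
    have "t * (hi - lo) = u - lo" using hi lo by (simp add: t_def)
    then have ut: "u = (1 - t) * lo + t * hi" by (simp add: algebra_simps)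
    have "s * lo \<le> phi l \<tau> lo"
    proof (cases "lo = 0")
      case True
      have "phi l \<tau> 0 = (\<Sum>j\<in>(UNIV::'d set). 0)"
        unfolding phi_def
      proof (intro sum.cong refl)
        fix j show "min 0 (l j) + max 0 (0 - \<tau> - l j) = 0" using l[of j] \<tau> by linarith
      qed
      then show ?thesis using True by simp
    next
      case False
      then show ?thesis using lo A_knots by blast
    qed
    then have "(1 - t) * (s * lo) + t * (s * hi) \<le> (1 - t) * phi l \<tau> lo + t * phi l \<tau> hi"
      using A_knots[OF hi(1)] t by (intro add_mono mult_left_mono) auto
    also have "\<dots> = (\<Sum>j\<in>UNIV. ((1 - t) * min lo (l j) + t * min hi (l j))
        + ((1 - t) * max 0 (lo - \<tau> - l j) + t * max 0 (hi - \<tau> - l j)))"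
      unfolding phi_def sum_distrib_left sum.distrib[symmetric]
      by (intro sum.cong refl) (simp only: distrib_left ac_simps)
    also have "\<dots> \<le> phi l \<tau> u"
      unfolding phi_def
    proof (intro sum_mono add_mono)
      fix j
      show "(1 - t) * min lo (l j) + t * min hi (l j) \<le> min u (l j)"
        unfolding ut by (rule min_concave[OF t])
      from gap[OF lA[of j]] show "(1 - t) * max 0 (lo - \<tau> - l j) + t * max 0 (hi - \<tau> - l j) \<le> max 0 (u - \<tau> - l j)"
      proof
        assume *: "\<tau> + l j \<le> lo"
        have "(1 - t) * (lo - \<tau> - l j) + t * (hi - \<tau> - l j) = u - \<tau> - l j"
          unfolding ut by (simp add: algebra_simps)
        moreover have "max 0 (lo - \<tau> - l j) = lo - \<tau> - l j" "max 0 (hi - \<tau> - l j) = hi - \<tau> - l j"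
          using * lo hi by linarith+
        ultimately show ?thesis by simp
      next
        assume *: "hi \<le> \<tau> + l j"
        then have "max 0 (lo - \<tau> - l j) = 0" "max 0 (hi - \<tau> - l j) = 0"
          using lo hi by linarith+
        then show ?thesis by simp
      qed
    qed
    finally show ?thesis unfolding ut by (simp add: algebra_simps)
  qed
qed

section \<open>Bounds for the Hausdorff dimension\<close>

text \<open>The infimum in \<open>hausdorff_dim\<close> includes the exponent \<open>0\<close>. A set with vanishing \<open>0\<close>-dimensional measure is empty,
so its measures vanish for all positive exponents as well.\<close>

lemma hausdorff_dim_ge:
  fixes A :: "'a::metric_space set"
  assumes "\<And>s. 0 < s \<Longrightarrow> s < t \<Longrightarrow> hausdorff_measure s A \<noteq> 0"
  shows "ereal t \<le> hausdorff_dim A"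
  unfolding hausdorff_dim_def
proof (rule INF_greatest)
  fix s assume "s \<in> {s. 0 \<le> s \<and> hausdorff_measure s A = 0}"
  then have s: "0 \<le> s" "hausdorff_measure s A = 0" by auto
  show "ereal t \<le> ereal s"
  proof (rule ccontr)
    assume "\<not> ereal t \<le> ereal s"
    then have t: "s < t" by simp
    then have s0: "s = 0" using s assms[of s] by linarith
    have "hausdorff_pre 0 1 A \<le> hausdorff_measure 0 A"
      unfolding hausdorff_measure_def by (rule SUP_upper) simp
    then have "hausdorff_pre 0 1 A < 1" using s s0 by simp
    then obtain U :: "nat \<Rightarrow> 'a set" where U: "A \<subseteq> (\<Union>k. U k)" "(\<Sum>k. ennreal (diam_pow 0 (U k))) < 1"
      unfolding hausdorff_pre_def INF_less_iff by auto
    have "U k = {}" for k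
    proof (rule ccontr)
      assume "U k \<noteq> {}"
      then have "1 = (\<Sum>j\<in>{k}. ennreal (diam_pow 0 (U j)))" by (simp add: diam_pow_def)
      also have "\<dots> \<le> (\<Sum>k. ennreal (diam_pow 0 (U k)))" by (rule sum_le_suminf) (rule summableI, auto)
      finally show False using U(2) by simp
    qed
    then have A: "A = {}" using U(1) by simp
    have "hausdorff_pre (t/2) \<delta> A \<le> 0" if "\<delta> \<in> {0<..}" for \<delta>
    proof -
      have "hausdorff_pre (t/2) \<delta> A \<le> (\<Sum>k::nat. ennreal (diam_pow (t/2) ({} :: 'a set)))"
        unfolding hausdorff_pre_def by (rule INF_lower2[of "\<lambda>_. {}"]) (use that A in \<open>auto\<close>)
      then show ?thesis by (simp add: diam_pow_def)
    qed
    then have "hausdorff_measure (t/2) A \<le> 0"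
      unfolding hausdorff_measure_def by (rule SUP_least)
    then show False using assms[of "t/2"] t s0 by simp
  qed
qed

lemma hausdorff_pre_le_finite_covers:
  fixes A :: "'a::metric_space set" and \<U> :: "nat \<Rightarrow> 'a set set"
  assumes s: "0 < s"
    and fin: "\<And>n. finite (\<U> n)"
    and cover: "A \<subseteq> (\<Union>n. \<Union>(\<U> n))"
    and small: "\<And>n U. U \<in> \<U> n \<Longrightarrow> bounded U \<and> diameter U \<le> r n" and r: "\<And>n. 0 \<le> r n" "\<And>n. r n \<le> \<delta>"
  shows "hausdorff_pre s \<delta> A \<le> (\<Sum>n. ennreal (real (card (\<U> n)) * r n powr s))"
proof -
  have "\<forall>n. \<exists>e :: nat \<Rightarrow> 'a set. \<U> n = e ` {..<card (\<U> n)}"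
  proof
    fix n
    obtain e where "bij_betw e {0..<card (\<U> n)} (\<U> n)" using ex_bij_betw_nat_finite[OF fin] by blast
    then show "\<exists>e :: nat \<Rightarrow> 'a set. \<U> n = e ` {..<card (\<U> n)}"
      unfolding bij_betw_def by (metis lessThan_atLeast0)
  qed
  then obtain e where e: "\<And>n. \<U> n = e n ` {..<card (\<U> n)}" by metis
  define V where "V = (\<lambda>(n, m). if m < card (\<U> n) then e n m else {})"
  have V: "bounded (V (n, m)) \<and> diameter (V (n, m)) \<le> r n" for n m
    using small[of "e n m" n] e[of n] r(1)[of n] by (auto simp: V_def)
  have diam: "diam_pow s (V (n, m)) \<le> (if m < card (\<U> n) then r n powr s else 0)" for n m
  proof (cases "m < card (\<U> n)")
    case True
    have "diameter (V (n, m)) powr s \<le> r n powr s"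
      using V s by (intro powr_mono2) (auto intro: diameter_ge_0)
    then show ?thesis using True s by (simp add: diam_pow_def)
  qed (simp add: V_def diam_pow_def)
  have "hausdorff_pre s \<delta> A \<le> (\<Sum>k. ennreal (diam_pow s (V (prod_decode k))))"
    unfolding hausdorff_pre_def
  proof (rule INF_lower, safe)
    fix k
    obtain n m where "prod_decode k = (n, m)" by fastforce
    then show "bounded (V (prod_decode k))" "diameter (V (prod_decode k)) \<le> \<delta>"
      using V[of n m] r(2)[of n] by auto
  next
    fix x assume "x \<in> A"
    then obtain n where "x \<in> \<Union>(\<U> n)" using cover by blast
    then obtain m where "m < card (\<U> n)" "x \<in> e n m" using e[of n] by auto
    then have "x \<in> V (prod_decode (prod_encode (n, m)))" by (simp add: V_def)
    then show "x \<in> (\<Union>k. V (prod_decode k))" by blast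
  qed
  also have "\<dots> = (\<Sum>n. \<Sum>m. ennreal (diam_pow s (V (n, m))))"
    by (rule suminf_ennreal_2dimen) simp
  also have "\<dots> \<le> (\<Sum>n. ennreal (real (card (\<U> n)) * r n powr s))"
  proof (rule suminf_le)
    fix n
    have "(\<Sum>m. ennreal (diam_pow s (V (n, m)))) \<le> (\<Sum>m. ennreal (if m < card (\<U> n) then r n powr s else 0))"
      by (intro suminf_le ennreal_leI diam) auto
    also have "\<dots> = (\<Sum>m\<in>{..<card (\<U> n)}. ennreal (if m < card (\<U> n) then r n powr s else 0))"
      by (rule suminf_finite) auto
    also have "\<dots> = (\<Sum>m\<in>{..<card (\<U> n)}. ennreal (r n powr s))" by (intro sum.cong) auto
    also have "\<dots> = ennreal (real (card (\<U> n)) * r n powr s)"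
      by (simp add: ennreal_mult ennreal_of_nat_eq_real_of_nat)
    finally show "(\<Sum>m. ennreal (diam_pow s (V (n, m)))) \<le> ennreal (real (card (\<U> n)) * r n powr s)" .
  qed auto
  finally show ?thesis .
qed

text \<open>The covers of all stages \<open>n \<ge> N\<close> together form a cover of the limsup set. For \<open>s > a / u\<close> the corresponding sum is the
tail of a geometric series with ratio \<open>exp (a - u * s) < 1\<close>.\<close>

lemma hausdorff_dim_limsup_le:
  fixes A :: "'a::metric_space set" and \<U> :: "nat \<Rightarrow> 'a set set"
  assumes u: "0 < u" and a: "0 \<le> a" and C: "0 < C" and K: "0 \<le> K"
    and limsup: "\<And>x n. x \<in> A \<Longrightarrow> \<exists>m\<ge>n. x \<in> \<Union>(\<U> m)"
    and cover: "\<And>n. n0 \<le> n \<Longrightarrow> finite (\<U> n) \<and> real (card (\<U> n)) \<le> K * exp (real n * a)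
      \<and> (\<forall>U\<in>\<U> n. bounded U \<and> diameter U \<le> C * exp (- real n * u))"
  shows "hausdorff_dim A \<le> ereal (a / u)"
proof (rule ereal_le_epsilon2)
  fix e :: real assume e: "0 < e"
  define s where "s = a / u + e"
  have s: "0 < s" using a u e by (simp add: s_def add_nonneg_pos)
  define x where "x = exp (a - u * s)"
  have x: "0 < x" "x < 1" using u e by (auto simp: x_def s_def field_simps)
  have bound: "hausdorff_pre s \<delta> A \<le> ennreal (K * C powr s * (x ^ N / (1 - x)))"
    if \<delta>: "0 < \<delta>" and N: "n0 \<le> N" "C * exp (- real N * u) \<le> \<delta>" for \<delta> N
  proof -
    have "hausdorff_pre s \<delta> A \<le> (\<Sum>n. ennreal (real (card (\<U> (n + N))) * (C * exp (- real (n + N) * u)) powr s))"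
    proof (rule hausdorff_pre_le_finite_covers[OF s])
      fix n
      show "finite (\<U> (n + N))" using cover N(1) by simp
      show "0 \<le> C * exp (- real (n + N) * u)" using C by simp
      have "C * exp (- real (n + N) * u) \<le> C * exp (- real N * u)"
        using C u by (intro mult_left_mono) (auto simp: algebra_simps)
      then show "C * exp (- real (n + N) * u) \<le> \<delta>" using N(2) by simp
      show "bounded U \<and> diameter U \<le> C * exp (- real (n + N) * u)" if "U \<in> \<U> (n + N)" for U
        using cover[of "n + N"] N(1) that by simp
    next
      show "A \<subseteq> (\<Union>n. \<Union> (\<U> (n + N)))"
      proof
        fix x assume "x \<in> A"
        then obtain m where "N \<le> m" "x \<in> \<Union>(\<U> m)" using limsup by blast
        then have "x \<in> \<Union>(\<U> ((m - N) + N))" by simp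
        then show "x \<in> (\<Union>n. \<Union> (\<U> (n + N)))" by blast
      qed
    qed
    also have "\<dots> \<le> (\<Sum>n. ennreal (K * C powr s * x ^ N * x ^ n))"
    proof (intro suminf_le ennreal_leI)
      fix n
      have e1: "(C * exp (- real (n + N) * u)) powr s = C powr s * exp (- real (n + N) * u * s)"
        using C by (simp add: powr_mult exp_powr_real)
      have e2: "exp (real (n + N) * (a - u * s)) = x ^ N * x ^ n"
        unfolding x_def exp_of_nat_mult[symmetric] by (simp add: exp_add[symmetric] algebra_simps)
      have "real (card (\<U> (n + N))) * (C * exp (- real (n + N) * u)) powr s
        \<le> K * exp (real (n + N) * a) * (C * exp (- real (n + N) * u)) powr s"
        using cover[of "n + N"] N(1) by (intro mult_right_mono) auto
      also have "\<dots> = K * C powr s * exp (real (n + N) * (a - u * s))"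
        unfolding e1 by (simp add: exp_add[symmetric] algebra_simps mult_exp_exp)
      also have "\<dots> = K * C powr s * x ^ N * x ^ n" unfolding e2 by (simp only: mult.assoc)
      finally show "real (card (\<U> (n + N))) * (C * exp (- real (n + N) * u)) powr s \<le> K * C powr s * x ^ N * x ^ n" .
    qed auto
    also have "\<dots> = ennreal (\<Sum>n. K * C powr s * x ^ N * x ^ n)"
      using x K by (intro suminf_ennreal2 summable_mult summable_geometric) auto
    also have "(\<Sum>n. K * C powr s * x ^ N * x ^ n) = K * C powr s * (x ^ N / (1 - x))"
      using x by (simp add: suminf_mult suminf_geometric summable_geometric)
    finally show ?thesis .
  qed
  have "hausdorff_pre s \<delta> A \<le> 0" if \<delta>: "\<delta> \<in> {0<..}" for \<delta>
  proof -
    have lim: "(\<lambda>N. ennreal (K * C powr s * (x ^ N / (1 - x)))) \<longlonglongrightarrow> ennreal (K * C powr s * (0 / (1 - x)))"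
      using x by (intro tendsto_intros LIMSEQ_power_zero) auto
    have "(\<lambda>N. C * exp (- real N * u)) \<longlonglongrightarrow> 0"
    proof -
      have "(\<lambda>N. C * exp (- u) ^ N) \<longlonglongrightarrow> C * 0"
        using u by (intro tendsto_mult tendsto_const LIMSEQ_power_zero) auto
      then show ?thesis by (simp add: exp_of_nat_mult[symmetric])
    qed
    then have "\<forall>\<^sub>F N in sequentially. C * exp (- real N * u) < \<delta>"
      using \<delta> by (intro order_tendstoD) auto
    then have "\<forall>\<^sub>F N in sequentially. hausdorff_pre s \<delta> A \<le> ennreal (K * C powr s * (x ^ N / (1 - x)))"
      using eventually_ge_at_top[of n0]
    proof eventually_elim
      case (elim N)
      show ?case by (rule bound) (use elim \<delta> in auto)
    qed
    then have "hausdorff_pre s \<delta> A \<le> ennreal (K * C powr s * (0 / (1 - x)))"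
      by (intro tendsto_lowerbound[OF lim]) auto
    then show ?thesis by simp
  qed
  then have "hausdorff_measure s A = 0"
    unfolding hausdorff_measure_def using SUP_least le_zero_eq by metis
  then have "hausdorff_dim A \<le> ereal s"
    unfolding hausdorff_dim_def using s by (intro INF_lower) auto
  then show "hausdorff_dim A \<le> ereal (a / u) + ereal e" by (simp add: s_def)
qed

text \<open>A cover of \<open>A\<close> pulls back under \<open>\<Theta>\<close> to a cover of \<open>L\<close> by sets of comparable diameter, and each of these lies in
a cube around one of its points.\<close>

lemma hausdorff_measure_nonzero_of_content:
  fixes A :: "'a::metric_space set" and L :: "(real ^ 'd) set" and \<Theta> :: "real ^ 'd \<Rightarrow> 'a"
  assumes s: "0 < s" and \<kappa>: "0 < \<kappa>" and M: "0 < M"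
    and LA: "\<And>y. y \<in> L \<Longrightarrow> \<Theta> y \<in> A"
    and bilip: "\<And>y y'. y \<in> L \<Longrightarrow> y' \<in> L \<Longrightarrow> norm (y - y') \<le> M * dist (\<Theta> y) (\<Theta> y')"
    and content: "\<And>(x :: nat \<Rightarrow> real ^ 'd) \<rho>. (\<And>i. 0 < \<rho> i) \<Longrightarrow>
       L \<subseteq> (\<Union>i. mcube (x i) (\<rho> i)) \<Longrightarrow> ennreal \<kappa> \<le> (\<Sum>i. ennreal (\<rho> i powr s))"
  shows "hausdorff_measure s A \<noteq> 0"
proof
  assume "hausdorff_measure s A = 0"
  moreover have "hausdorff_pre s 1 A \<le> hausdorff_measure s A"
    unfolding hausdorff_measure_def by (rule SUP_upper) simp
  ultimately have "hausdorff_pre s 1 A < ennreal (\<kappa> / (4 * M powr s))" using \<kappa> M by simp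
  then obtain U :: "nat \<Rightarrow> 'a set" where U: "A \<subseteq> (\<Union>k. U k)" "\<And>k. bounded (U k)"
    "(\<Sum>k. ennreal (diam_pow s (U k))) < ennreal (\<kappa> / (4 * M powr s))"
    unfolding hausdorff_pre_def INF_less_iff by auto
  define V where "V = (\<lambda>k. {y \<in> L. \<Theta> y \<in> U k})"
  define x where "x = (\<lambda>k. SOME y. y \<in> V k)"
  \<comment> \<open>The cubes need positive side, also for covering sets of diameter \<open>0\<close>; the lower bounds \<open>t k\<close> for the sides contribute only \<open>\<kappa> / 4\<close> in total.\<close>
  define t where "t = (\<lambda>k::nat. (\<kappa> / 4 * (1/2) ^ Suc k) powr (1 / s))"
  define \<rho> where "\<rho> = (\<lambda>k. max (M * diameter (U k)) (t k))"
  have t: "0 < t k" "t k powr s = \<kappa> / 4 * (1/2) ^ Suc k" for k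
    using \<kappa> s by (auto simp: t_def powr_powr)
  have "ennreal \<kappa> \<le> (\<Sum>k. ennreal (\<rho> k powr s))"
  proof (rule content)
    show "0 < \<rho> k" for k using t(1)[of k] by (simp add: \<rho>_def less_max_iff_disj)
    show "L \<subseteq> (\<Union>k. mcube (x k) (\<rho> k))"
    proof
      fix y assume y: "y \<in> L"
      then obtain k where k: "\<Theta> y \<in> U k" using LA U(1) by blast
      then have yV: "y \<in> V k" using y by (simp add: V_def)
      then have xV: "x k \<in> V k" unfolding x_def by (rule someI)
      have "norm (y - x k) \<le> M * dist (\<Theta> y) (\<Theta> (x k))" using yV xV by (intro bilip) (auto simp: V_def)
      also have "\<dots> \<le> M * diameter (U k)"
        using yV xV M U(2)[of k] by (intro mult_left_mono diameter_bounded_bound) (auto simp: V_def)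
      also have "\<dots> \<le> \<rho> k" by (simp add: \<rho>_def)
      finally have "norm (y - x k) \<le> \<rho> k" .
      then have "\<bar>y $ i - x k $ i\<bar> \<le> \<rho> k" for i
        using component_le_norm_cart[of "y - x k" i] by simp
      then show "y \<in> (\<Union>k. mcube (x k) (\<rho> k))" by (auto simp: mcube_def)
    qed
  qed
  also have "\<dots> \<le> (\<Sum>k. ennreal (M powr s) * ennreal (diam_pow s (U k)) + ennreal (\<kappa> / 4 * (1/2) ^ Suc k))"
  proof (rule suminf_le)
    fix k
    have d: "0 \<le> diameter (U k)" using U(2) by (rule diameter_ge_0)
    have dp: "diam_pow s (U k) = diameter (U k) powr s" using s by (simp add: diam_pow_def)
    have "\<rho> k powr s \<le> (M * diameter (U k)) powr s + t k powr s"
      by (simp add: \<rho>_def max_def)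
    also have "\<dots> = M powr s * diam_pow s (U k) + \<kappa> / 4 * (1/2) ^ Suc k"
      using d M by (simp add: powr_mult dp t(2))
    finally have "ennreal (\<rho> k powr s) \<le> ennreal (M powr s * diam_pow s (U k) + \<kappa> / 4 * (1/2) ^ Suc k)"
      by (rule ennreal_leI)
    also have "\<dots> = ennreal (M powr s) * ennreal (diam_pow s (U k)) + ennreal (\<kappa> / 4 * (1/2) ^ Suc k)"
      using \<kappa> by (simp add: ennreal_plus ennreal_mult dp)
    finally show "ennreal (\<rho> k powr s) \<le> \<dots>" .
  qed auto
  also have "\<dots> = ennreal (M powr s) * (\<Sum>k. ennreal (diam_pow s (U k))) + (\<Sum>k. ennreal (\<kappa> / 4 * (1/2) ^ Suc k))"
    by (simp add: suminf_add[symmetric] ennreal_suminf_cmult)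
  also have "(\<Sum>k. ennreal (\<kappa> / 4 * (1/2) ^ Suc k)) = ennreal (\<kappa> / 4)"
  proof -
    have "(\<lambda>k. \<kappa> / 4 * (1/2) ^ Suc k) sums (\<kappa> / 4 * 1)" by (intro sums_mult power_half_series)
    then show ?thesis using \<kappa> by (subst suminf_ennreal2) (auto simp: sums_iff)
  qed
  also have "ennreal (M powr s) * (\<Sum>k. ennreal (diam_pow s (U k))) \<le> ennreal (M powr s) * ennreal (\<kappa> / (4 * M powr s))"
    using U(3) by (intro mult_left_mono) auto
  also have "ennreal (M powr s) * ennreal (\<kappa> / (4 * M powr s)) = ennreal (\<kappa> / 4)"
    using \<kappa> M by (simp flip: ennreal_mult)
  also have "ennreal (\<kappa> / 4) + ennreal (\<kappa> / 4) = ennreal (\<kappa> / 2)"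
    using \<kappa> by (simp flip: ennreal_plus)
  also have "\<dots> < ennreal \<kappa>" using \<kappa> by (simp add: ennreal_less_iff)
  finally show False by simp
qed

text \<open>If \<open>B\<close> is a coarse label of the points and \<open>g\<close> a fine one, the fine labels are counted within each coarse class.\<close>

lemma card_image_fibres:
  assumes B: "finite (B ` Y)"
    and fib: "\<And>y. y \<in> Y \<Longrightarrow> finite (g ` {y' \<in> Y. B y' = B y}) \<and> real (card (g ` {y' \<in> Y. B y' = B y})) \<le> M"
  shows "finite (g ` Y)" "real (card (g ` Y)) \<le> real (card (B ` Y)) * M"
proof -
  have eq: "g ` Y = (\<Union>b\<in>B ` Y. g ` {y' \<in> Y. B y' = b})" by auto
  show "finite (g ` Y)" unfolding eq by (rule finite_UN_I[OF B]) (use fib in \<open>elim imageE, simp\<close>)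
  have "card (g ` Y) \<le> (\<Sum>b\<in>B ` Y. card (g ` {y' \<in> Y. B y' = b}))"
    unfolding eq by (rule card_UN_le[OF B])
  then have "real (card (g ` Y)) \<le> (\<Sum>b\<in>B ` Y. real (card (g ` {y' \<in> Y. B y' = b})))"
    by (simp flip: of_nat_sum)
  also have "\<dots> \<le> (\<Sum>b\<in>B ` Y. M)" using fib by (intro sum_mono) auto
  finally show "real (card (g ` Y)) \<le> real (card (B ` Y)) * M" by simp
qed

section \<open>Diagonalizable torus maps\<close>

lemma dist_to_circle: "dist (to_circle a) (to_circle b) = dist_to_int (a - b)"
  by transfer simp

lemma to_circle_rep_circle [simp]: "to_circle (rep_circle x) = x"
  by (rule Quotient_abs_rep[OF Quotient_circle])

lemma to_circle_eq_iff: "to_circle a = to_circle b \<longleftrightarrow> a - b \<in> \<int>"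
  by (simp add: circle.abs_eq_iff circle_rel_def)

lemma dist_to_int_le_abs: "dist_to_int x \<le> \<bar>x\<bar>"
  using dist_to_int_le[of x 0] by simp

lemma dist_to_int_nonneg: "0 \<le> dist_to_int x"
  by (simp add: dist_to_int_def)

lemma dist_to_int_eq_abs:
  assumes "\<bar>x\<bar> \<le> 1/2" shows "dist_to_int x = \<bar>x\<bar>"
proof -
  have "\<bar>x\<bar> \<le> \<bar>x - of_int (round x)\<bar>"
  proof (cases "round x = 0")
    case False
    then have "1 \<le> \<bar>round x\<bar>" by linarith
    then have "1 \<le> \<bar>real_of_int (round x)\<bar>" by linarith
    then show ?thesis using assms by linarith
  qed simp
  then show ?thesis using dist_to_int_le_abs[of x] by (simp add: dist_to_int_def)
qed

lemma dist_to_int_mult_int: "dist_to_int (of_int m * x) \<le> \<bar>of_int m\<bar> * dist_to_int x"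
proof -
  have "dist_to_int (of_int m * x) \<le> \<bar>of_int m * x - of_int (m * round x)\<bar>"
    by (rule dist_to_int_le)
  also have "\<dots> = \<bar>of_int m\<bar> * dist_to_int x"
    by (simp add: dist_to_int_def abs_mult[symmetric] right_diff_distrib)
  finally show ?thesis .
qed

lemma dist_to_int_sum: "dist_to_int (\<Sum>i\<in>A. f i) \<le> (\<Sum>i\<in>A. dist_to_int (f i))"
proof (induction A rule: infinite_finite_induct)
  case (insert x A)
  then show ?case using dist_to_int_triangle[of "f x" "sum f A"] by simp
qed (simp_all add: dist_to_int_eq_abs)

lemma dist_circle_le: "dist (x :: circle) y \<le> 1/2"
proof transfer
  fix x y :: real show "dist_to_int (x - y) \<le> 1/2"
    using of_int_round_abs_le[of "x - y"] by (simp add: dist_to_int_def abs_minus_commute)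
qed

lemma dist_vec_le_sum: "dist x y \<le> (\<Sum>i\<in>UNIV. dist (x $ i) (y $ i))"
  for x y :: "'a::metric_space ^ 'd"
  unfolding dist_vec_def by (rule L2_set_le_sum) simp

lemma map_matrix_of_int_mult:
  fixes A B :: "int ^ 'd ^ 'd"
  shows "map_matrix real_of_int (A ** B) = map_matrix real_of_int A ** map_matrix real_of_int B"
  by (simp add: vec_eq_iff matrix_matrix_mult_def)

lemma map_matrix_of_int_mat1: "map_matrix real_of_int (mat 1) = mat 1"
  by (simp add: vec_eq_iff mat_def)

lemma norm_matrix_vector_le:
  fixes A :: "real ^ 'd ^ 'd"
  shows "norm (A *v w) \<le> (onorm ((*v) A) + 1) * norm w"
proof -
  have "norm (A *v w) \<le> onorm ((*v) A) * norm w"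
    by (rule onorm) (rule matrix_vector_mul_bounded_linear)
  also have "\<dots> \<le> (onorm ((*v) A) + 1) * norm w" by (rule mult_right_mono) auto
  finally show ?thesis .
qed

text \<open>\<open>Q\<close> is the inverse of \<open>P\<close> over the integers. The eigenvalues are integers greater than \<open>1\<close>, whence \<open>2 \<le> D i\<close>.\<close>

locale diag_torus =
  fixes T P Q :: "int ^ 'd ^ 'd" and D :: "'d \<Rightarrow> int"
  assumes PQ: "P ** Q = mat 1" and QP: "Q ** P = mat 1"
    and conj: "P ** T ** Q = (\<chi> i j. if i = j then D i else 0)"
    and D_ge: "\<And>i. 2 \<le> D i"
begin

abbreviation Pr :: "real ^ 'd ^ 'd" where "Pr \<equiv> map_matrix real_of_int P"
abbreviation Qr :: "real ^ 'd ^ 'd" where "Qr \<equiv> map_matrix real_of_int Q"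

definition \<theta> :: "real ^ 'd \<Rightarrow> 'd torus" where "\<theta> y = to_torus (Qr *v y)"
definition dil :: "nat \<Rightarrow> real ^ 'd \<Rightarrow> real ^ 'd" where
  "dil n y = (\<chi> j. of_int (D j) ^ n * y $ j)"
text \<open>\<open>CQ\<close> and \<open>CP\<close> are bounds for operator norms, made positive by the summand \<open>1\<close>; \<open>CL\<close> is a Lipschitz constant of
\<open>\<theta>\<close>; and \<open>CD\<close> bounds the effect of \<open>P\<close> on coordinatewise distances to the integers.\<close>

definition CQ :: real where "CQ = onorm ((*v) Qr) + 1"
definition CP :: real where "CP = onorm ((*v) Pr) + 1"
definition CD :: real where "CD = (\<Sum>j\<in>UNIV. \<Sum>i\<in>UNIV. \<bar>of_int (P $ j $ i)\<bar>)"
definition CL :: real where "CL = real CARD('d) * CQ"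

lemma CQ_pos: "0 < CQ" and CP_pos: "0 < CP" and CD_nonneg: "0 \<le> CD"
  unfolding CQ_def CP_def CD_def
  by (auto intro!: add_nonneg_pos onorm_pos_le sum_nonneg matrix_vector_mul_bounded_linear)

lemma CL_pos: "0 < CL" using CQ_pos by (simp add: CL_def)

lemma D_real_ge: "2 \<le> real_of_int (D j)" using D_ge[of j] by linarith

lemma D_pow_ge: "2 ^ n \<le> real_of_int (D j) ^ n"
  by (intro power_mono D_real_ge) auto

lemma D_pow_ge_1: "1 \<le> real_of_int (D j) ^ n"
  using D_real_ge[of j] by (intro one_le_power) simp

lemma D_pow_pos: "0 < real_of_int (D j) ^ n"
  using D_pow_ge_1[where j=j and n=n] by linarith

lemma PrQr: "Pr ** Qr = mat 1" and QrPr: "Qr ** Pr = mat 1"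
  by (simp_all add: PQ QP map_matrix_of_int_mat1 flip: map_matrix_of_int_mult)

lemma Pr_Qr_vec: "Pr *v (Qr *v w) = w" and Qr_Pr_vec: "Qr *v (Pr *v w) = w"
  by (simp_all add: matrix_vector_mul_assoc PrQr QrPr)

lemma norm_Qr_le: "norm (Qr *v w) \<le> CQ * norm w" and norm_Pr_le: "norm (Pr *v w) \<le> CP * norm w"
  unfolding CQ_def CP_def by (rule norm_matrix_vector_le)+

lemma \<theta>_nth: "\<theta> y $ i = to_circle ((Qr *v y) $ i)"
  by (simp add: \<theta>_def to_torus_def)

lemma dist_\<theta>_nth: "dist (\<theta> y $ i) (\<theta> y' $ i) = dist_to_int ((Qr *v (y - y')) $ i)"
  by (simp add: \<theta>_nth dist_to_circle matrix_vector_mult_diff_distrib)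

lemma dist_\<theta>_le: "dist (\<theta> y) (\<theta> y') \<le> CL * norm (y - y')"
proof -
  have "dist (\<theta> y) (\<theta> y') \<le> (\<Sum>i\<in>UNIV. dist (\<theta> y $ i) (\<theta> y' $ i))" by (rule dist_vec_le_sum)
  also have "\<dots> \<le> (\<Sum>i\<in>(UNIV::'d set). CQ * norm (y - y'))"
  proof (rule sum_mono)
    fix i
    have "dist (\<theta> y $ i) (\<theta> y' $ i) \<le> \<bar>(Qr *v (y - y')) $ i\<bar>"
      unfolding dist_\<theta>_nth by (rule dist_to_int_le_abs)
    also have "\<dots> \<le> norm (Qr *v (y - y'))" by (rule component_le_norm_cart)
    also have "\<dots> \<le> CQ * norm (y - y')" by (rule norm_Qr_le)
    finally show "dist (\<theta> y $ i) (\<theta> y' $ i) \<le> CQ * norm (y - y')" .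
  qed
  also have "\<dots> = CL * norm (y - y')" by (simp add: CL_def)
  finally show ?thesis .
qed

lemma Qr_of_int: "(Qr *v (\<chi> j. of_int (z j))) $ i \<in> \<int>"
  by (auto simp: matrix_vector_mult_def intro!: Ints_sum)

lemma \<theta>_add_int: "\<theta> (y + (\<chi> j. of_int (z j))) = \<theta> y"
proof (simp add: vec_eq_iff \<theta>_nth to_circle_eq_iff, intro allI)
  fix i
  show "(Qr *v (y + (\<chi> j. of_int (z j)))) $ i - (Qr *v y) $ i \<in> \<int>"
    using Qr_of_int[of z i] by (simp add: matrix_vector_right_distrib)
qed

lemma \<theta>_surj_unit:
  obtains y where "\<And>j. 0 \<le> y $ j" "\<And>j. y $ j < 1" "\<theta> y = x"
proof -
  define v where "v = Pr *v lift_torus x"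
  define y where "y = (\<chi> j. frac (v $ j))"
  have "\<theta> v = x"
    by (simp add: vec_eq_iff v_def \<theta>_nth Qr_Pr_vec lift_torus_def)
  moreover have "v = y + (\<chi> j. of_int \<lfloor>v $ j\<rfloor>)"
    by (simp add: vec_eq_iff y_def frac_def)
  ultimately have "\<theta> y = x" using \<theta>_add_int[of y "\<lambda>j. \<lfloor>v $ j\<rfloor>"] by simp
  then show ?thesis by (intro that[of y]) (auto simp: y_def frac_lt_1)
qed

lemma torus_map_\<theta>: "torus_map T (\<theta> y) = \<theta> (dil 1 y)"
proof -
  let ?Dm = "map_matrix real_of_int (P ** T ** Q)"
  have "Q ** (P ** T ** Q) = T ** Q"
    by (metis QP matrix_mul_assoc matrix_mul_lid)
  then have "map_matrix real_of_int T ** Qr = Qr ** ?Dm"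
    by (metis map_matrix_of_int_mult)
  then have "map_matrix real_of_int T *v (Qr *v y) = Qr *v (?Dm *v y)"
    by (metis matrix_vector_mul_assoc)
  moreover have "?Dm *v y = dil 1 y"
    unfolding conj
    by (simp add: vec_eq_iff matrix_vector_mult_def dil_def if_distrib[of real_of_int] if_distrib[of "\<lambda>x. x * _"]
        cong: if_cong)
  ultimately show ?thesis by (simp add: \<theta>_def torus_map_to_torus)
qed

lemma dil_Suc: "dil 1 (dil n y) = dil (Suc n) y"
  by (simp add: dil_def vec_eq_iff mult.assoc)

lemma torus_map_pow_\<theta>: "(torus_map T ^^ n) (\<theta> y) = \<theta> (dil n y)"
proof (induction n)
  case 0
  then show ?case by (simp add: dil_def)
next
  case (Suc n)
  then show ?case by (simp only: funpow.simps o_apply torus_map_\<theta> dil_Suc)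
qed

lemma dil_diff: "dil n y - dil n y' = dil n (y - y')"
  by (simp add: dil_def vec_eq_iff right_diff_distrib)

text \<open>A change of coordinates in \<open>GL\<close> over the integers preserves closeness to the integer lattice up to a factor.\<close>

lemma dist_to_int_of_Qr:
  assumes "\<And>i. dist_to_int ((Qr *v w) $ i) \<le> \<epsilon>"
  shows "dist_to_int (w $ j) \<le> CD * \<epsilon>"
proof -
  have \<epsilon>: "0 \<le> \<epsilon>" using assms dist_to_int_nonneg order_trans by blast
  have "w $ j = (\<Sum>i\<in>UNIV. of_int (P $ j $ i) * (Qr *v w) $ i)"
    by (subst Pr_Qr_vec[symmetric]) (simp add: matrix_vector_mult_def)
  then have "dist_to_int (w $ j) \<le> (\<Sum>i\<in>UNIV. dist_to_int (of_int (P $ j $ i) * (Qr *v w) $ i))"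
    by (simp add: dist_to_int_sum)
  also have "\<dots> \<le> (\<Sum>i\<in>UNIV. \<bar>of_int (P $ j $ i)\<bar> * \<epsilon>)"
    by (intro sum_mono order_trans[OF dist_to_int_mult_int] mult_left_mono assms) auto
  also have "\<dots> = (\<Sum>i\<in>UNIV. \<bar>of_int (P $ j $ i)\<bar>) * \<epsilon>" by (simp add: sum_distrib_right)
  also have "\<dots> \<le> CD * \<epsilon>"
    unfolding CD_def
    by (intro mult_right_mono[OF _ \<epsilon>] member_le_sum[where f="\<lambda>j. \<Sum>i\<in>UNIV. \<bar>of_int (P $ j $ i)\<bar>"])
      (auto intro: sum_nonneg)
  finally show ?thesis .
qed

definition hits :: "(nat \<Rightarrow> 'd torus \<Rightarrow> 'd torus) \<Rightarrow> nat \<Rightarrow> real \<Rightarrow> 'd torus set" where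
  "hits f n q = {x. (torus_map T ^^ n) x \<in> target (f n x) q}"

text \<open>Two points of the same stage whose images are close to moving targets: since the targets move in a Lipschitz way,
the images are close to each other.\<close>

lemma hits_close:
  assumes lip: "\<And>x y. dist (f n x) (f n y) \<le> c * dist x y" and c: "0 < c"
    and y: "\<theta> y \<in> hits f n q" and y': "\<theta> y' \<in> hits f n q"
  shows "dist_to_int (of_int (D j) ^ n * (y $ j - y' $ j)) \<le> CD * (2 * q + c * CL * norm (y - y'))"
proof -
  have "dist_to_int ((Qr *v (dil n (y - y'))) $ i) \<le> 2 * q + c * CL * norm (y - y')" for i
  proof -
    let ?A = "\<theta> (dil n y) $ i" and ?A' = "\<theta> (dil n y') $ i"
    let ?B = "f n (\<theta> y) $ i" and ?B' = "f n (\<theta> y') $ i"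
    have "dist ?A ?B < q" "dist ?A' ?B' < q"
      using y y' by (auto simp: hits_def target_def torus_map_pow_\<theta>)
    moreover have "dist ?B ?B' \<le> c * (CL * norm (y - y'))"
    proof -
      have "dist ?B ?B' \<le> dist (f n (\<theta> y)) (f n (\<theta> y'))" by (rule dist_vec_nth_le)
      also have "\<dots> \<le> c * dist (\<theta> y) (\<theta> y')" by (rule lip)
      also have "\<dots> \<le> c * (CL * norm (y - y'))" using c by (intro mult_left_mono dist_\<theta>_le) auto
      finally show ?thesis .
    qed
    moreover have "dist ?A ?A' \<le> dist ?A ?B + dist ?B ?B' + dist ?A' ?B'"
      using dist_triangle[of ?A ?A' ?B] dist_triangle[of ?B ?A' ?B'] by (simp add: dist_commute)
    moreover have "dist ?A ?A' = dist_to_int ((Qr *v (dil n (y - y'))) $ i)"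
      by (simp add: dist_\<theta>_nth dil_diff)
    ultimately show ?thesis by simp
  qed
  from dist_to_int_of_Qr[OF this, of j] show ?thesis by (simp add: dil_def)
qed

text \<open>On vectors of norm at most \<open>1/2\<close> the distance to the lattice point \<open>0\<close> is the distance to the lattice.\<close>

lemma \<theta>_bilipschitz:
  assumes "norm (y - y') \<le> 1 / (2 * CQ)"
  shows "norm (y - y') \<le> CP * dist (\<theta> y) (\<theta> y')"
proof -
  let ?w = "Qr *v (y - y')"
  have "norm ?w \<le> 1/2"
  proof -
    have "norm ?w \<le> CQ * norm (y - y')" by (rule norm_Qr_le)
    also have "\<dots> \<le> CQ * (1 / (2 * CQ))" using assms CQ_pos by (intro mult_left_mono) auto
    finally show ?thesis using CQ_pos by simp
  qed
  then have "dist (\<theta> y $ i) (\<theta> y' $ i) = \<bar>?w $ i\<bar>" for i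
    unfolding dist_\<theta>_nth using component_le_norm_cart[of ?w i] by (intro dist_to_int_eq_abs) linarith
  then have "dist (\<theta> y) (\<theta> y') = norm ?w"
    by (simp add: dist_vec_def norm_vec_def)
  then show ?thesis using norm_Pr_le[of ?w] by (simp add: Pr_Qr_vec)
qed

text \<open>A section \<open>lf\<close> of \<open>\<theta>\<close> that is Lipschitz near \<open>\<theta> w0\<close>: among the lifts of a point each coordinate is chosen as the representative nearest to
that of \<open>w0\<close>. Two points at distance at most \<open>1/4\<close> from \<open>\<theta> w0\<close> have lifts that differ by at most \<open>1/2\<close> in each
coordinate, so there the section does not increase distances in the original coordinates.\<close>

lemma local_lift:
  obtains lf where "\<And>p. \<theta> (lf p) = p" "\<And>p. norm (lf p - w0) \<le> CP * dist p (\<theta> w0)"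
    "\<And>p p'. dist p (\<theta> w0) \<le> 1/4 \<Longrightarrow> dist p' (\<theta> w0) \<le> 1/4 \<Longrightarrow> norm (lf p - lf p') \<le> CP * dist p p'"
proof -
  define v0 where "v0 = Qr *v w0"
  define g where "g = (\<lambda>a::real. a - of_int (round a))"
  have g_abs: "\<bar>g a\<bar> = dist_to_int a" for a by (simp add: g_def dist_to_int_def)
  define v where "v = (\<lambda>p :: 'd torus. \<chi> i. v0 $ i + g (rep_circle (p $ i) - v0 $ i))"
  define lf where "lf = (\<lambda>p. Pr *v v p)"
  have to_v: "to_circle (v p $ i) = p $ i" for p i
  proof -
    have "v p $ i - rep_circle (p $ i) \<in> \<int>" by (simp add: v_def g_def)
    then have "to_circle (v p $ i) = to_circle (rep_circle (p $ i))" by (simp only: to_circle_eq_iff)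
    then show ?thesis by simp
  qed
  have \<theta>0: "\<theta> w0 $ i = to_circle (v0 $ i)" for i by (simp add: \<theta>_nth v0_def)
  have v_v0: "\<bar>v p $ i - v0 $ i\<bar> = dist (p $ i) (\<theta> w0 $ i)" for p i
  proof -
    have "dist (p $ i) (\<theta> w0 $ i) = dist_to_int (rep_circle (p $ i) - v0 $ i)"
      unfolding \<theta>0 by (metis dist_to_circle to_circle_rep_circle)
    then show ?thesis by (simp add: v_def g_abs dist_to_circle)
  qed
  show ?thesis
  proof (rule that[of lf])
    show "\<theta> (lf p) = p" for p
      by (simp add: vec_eq_iff \<theta>_nth lf_def Qr_Pr_vec to_v)
    show "norm (lf p - w0) \<le> CP * dist p (\<theta> w0)" for p
    proof -
      have "norm (v p - v0) = dist p (\<theta> w0)"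
        by (simp add: norm_vec_def dist_vec_def v_v0)
      moreover have "lf p - w0 = Pr *v (v p - v0)"
        by (simp add: lf_def v0_def matrix_vector_mult_diff_distrib Pr_Qr_vec)
      ultimately show ?thesis using norm_Pr_le[of "v p - v0"] by simp
    qed
    fix p p' assume p: "dist p (\<theta> w0) \<le> 1/4" "dist p' (\<theta> w0) \<le> 1/4"
    have "\<bar>v p $ i - v p' $ i\<bar> = dist (p $ i) (p' $ i)" for i
    proof -
      have "\<bar>v p $ i - v0 $ i\<bar> \<le> 1/4" "\<bar>v p' $ i - v0 $ i\<bar> \<le> 1/4"
        unfolding v_v0 using p dist_vec_nth_le order_trans by blast+
      then have "dist_to_int (v p $ i - v p' $ i) = \<bar>v p $ i - v p' $ i\<bar>"
        by (intro dist_to_int_eq_abs) linarith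
      then show ?thesis using dist_to_circle[of "v p $ i" "v p' $ i"] by (simp add: to_v)
    qed
    then have "norm (v p - v p') = dist p p'"
      by (simp add: norm_vec_def dist_vec_def)
    moreover have "lf p - lf p' = Pr *v (v p - v p')"
      by (simp add: lf_def matrix_vector_mult_diff_distrib)
    ultimately show "norm (lf p - lf p') \<le> CP * dist p p'" using norm_Pr_le[of "v p - v p'"] by simp
  qed
qed

lemma norm_undil_le:
  assumes "\<And>j. \<bar>of_int (D j) ^ n * w $ j\<bar> \<le> B"
  shows "norm w \<le> real CARD('d) * B / 2 ^ n"
proof -
  have "norm w \<le> (\<Sum>j\<in>UNIV. \<bar>w $ j\<bar>)" by (rule norm_le_l1_cart)
  also have "\<dots> \<le> (\<Sum>j\<in>(UNIV::'d set). B / 2 ^ n)"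
  proof (rule sum_mono)
    fix j
    have "\<bar>w $ j\<bar> * 2 ^ n \<le> \<bar>w $ j\<bar> * of_int (D j) ^ n"
      by (intro mult_left_mono D_pow_ge) auto
    also have "\<dots> = \<bar>of_int (D j) ^ n * w $ j\<bar>"
      using D_pow_pos[where j=j and n=n] by (simp add: abs_mult mult.commute)
    also have "\<dots> \<le> B" by (rule assms)
    finally show "\<bar>w $ j\<bar> \<le> B / 2 ^ n" by (simp add: field_simps)
  qed
  finally show ?thesis by simp
qed

text \<open>Solving \<open>\<theta> (dil n x) = f n (\<theta> x)\<close> near the grid point with index \<open>z\<close> means finding a fixed point of
\<open>y \<mapsto> D\<^sup>-\<^sup>n (5 * z + u y)\<close>, where \<open>u\<close> is a lift of \<open>f n \<circ> \<theta>\<close>. The factor \<open>D\<^sup>-\<^sup>n\<close> makes this a contraction.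
The slab has width \<open>3\<close> because the lift at the grid point lies in \<open>[0, 1)\<close> and varies by at most \<open>1\<close> over the slab.\<close>

lemma solution_in_cell:
  assumes lip: "\<And>x y. dist (f n x) (f n y) \<le> c * dist x y" and c: "0 < c"
    and n1: "c * CL * (2 * real CARD('d)) / 2 ^ n \<le> 1/4"
    and n2: "CP * (c * CL * (2 * real CARD('d)) / 2 ^ n) \<le> 1"
    and n3: "CP * (c * CL * (real CARD('d))) / 2 ^ n \<le> 1/2"
  shows "\<exists>x. \<theta> (dil n x) = f n (\<theta> x) \<and>
    (\<forall>j. 5 * of_int (z j) - 1 \<le> of_int (D j) ^ n * x $ j \<and> of_int (D j) ^ n * x $ j \<le> 5 * of_int (z j) + 2)"
proof -
  let ?d = "real CARD('d)"
  let ?G = "\<lambda>j. real_of_int (D j) ^ n"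
  define b where "b = (\<chi> j. 5 * of_int (z j) / ?G j)"
  obtain w0 where w0: "\<And>j. 0 \<le> w0 $ j" "\<And>j. w0 $ j < 1" "\<theta> w0 = f n (\<theta> b)"
    using \<theta>_surj_unit[of "f n (\<theta> b)"] by metis
  obtain lf where lf: "\<And>p. \<theta> (lf p) = p" "\<And>p. norm (lf p - w0) \<le> CP * dist p (\<theta> w0)"
    "\<And>p p'. dist p (\<theta> w0) \<le> 1/4 \<Longrightarrow> dist p' (\<theta> w0) \<le> 1/4 \<Longrightarrow> norm (lf p - lf p') \<le> CP * dist p p'"
    using local_lift[of w0] by metis
  define u where "u = (\<lambda>y. lf (f n (\<theta> y)))"
  define S where "S = {y. \<forall>j. 5 * of_int (z j) - 1 \<le> ?G j * y $ j \<and> ?G j * y $ j \<le> 5 * of_int (z j) + 2}"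
  define H where "H = (\<lambda>y. \<chi> j. (5 * of_int (z j) + u y $ j) / ?G j)"
  have GH: "?G j * H y $ j = 5 * of_int (z j) + u y $ j" for y j
    using D_ge[of j] by (simp add: H_def)
  have S_cbox: "S = cbox (\<chi> j. (5 * of_int (z j) - 1) / ?G j) (\<chi> j. (5 * of_int (z j) + 2) / ?G j)"
    unfolding S_def by (auto simp: mem_box_cart divide_le_eq le_divide_eq D_pow_pos mult.commute)
  have dist_f: "dist (f n (\<theta> y)) (f n (\<theta> y')) \<le> c * CL * norm (y - y')" for y y'
  proof -
    have "dist (f n (\<theta> y)) (f n (\<theta> y')) \<le> c * dist (\<theta> y) (\<theta> y')" by (rule lip)
    also have "\<dots> \<le> c * (CL * norm (y - y'))" using c by (intro mult_left_mono dist_\<theta>_le) auto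
    finally show ?thesis by simp
  qed
  have cCL: "0 \<le> c * CL" using c CL_pos by simp
  have near: "dist (f n (\<theta> y)) (\<theta> w0) \<le> c * CL * (2 * ?d) / 2 ^ n" if "y \<in> S" for y
  proof -
    have "norm (y - b) \<le> ?d * 2 / 2 ^ n"
    proof (rule norm_undil_le)
      fix j
      have "?G j * (y - b) $ j = ?G j * y $ j - 5 * of_int (z j)"
        using D_ge[of j] by (simp add: b_def right_diff_distrib)
      moreover have "5 * of_int (z j) - 1 \<le> ?G j * y $ j" "?G j * y $ j \<le> 5 * of_int (z j) + 2"
        using that by (auto simp: S_def)
      ultimately show "\<bar>?G j * (y - b) $ j\<bar> \<le> 2" by linarith
    qed
    then have "c * CL * norm (y - b) \<le> c * CL * (?d * 2 / 2 ^ n)" using cCL by (intro mult_left_mono)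
    with dist_f[of y b] show ?thesis unfolding w0(3) by (simp add: mult.commute mult.left_commute)
  qed
  have "\<exists>!x\<in>S. H x = x"
  proof (rule Banach_fix[where c="1/2"])
    show "complete S" unfolding S_cbox by (rule compact_imp_complete) simp
    have "?G j * b $ j = 5 * of_int (z j)" for j using D_ge[of j] by (simp add: b_def)
    then have "b \<in> S" by (simp add: S_def)
    then show "S \<noteq> {}" by blast
    show "H ` S \<subseteq> S"
    proof
      fix x assume "x \<in> H ` S"
      then obtain y where y: "y \<in> S" "x = H y" by blast
      have "norm (u y - w0) \<le> 1"
      proof -
        have "norm (u y - w0) \<le> CP * dist (f n (\<theta> y)) (\<theta> w0)" unfolding u_def by (rule lf(2))
        also have "\<dots> \<le> CP * (c * CL * (2 * ?d) / 2 ^ n)"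
          using near[OF y(1)] CP_pos by (intro mult_left_mono) auto
        finally show ?thesis using n2 by linarith
      qed
      then have "\<bar>u y $ j - w0 $ j\<bar> \<le> 1" for j
        using component_le_norm_cart[of "u y - w0" j] by simp
      then have "- 1 \<le> u y $ j \<and> u y $ j \<le> 2" for j
        using w0(1)[of j] w0(2)[of j] by (smt (verit))
      then show "x \<in> S" unfolding y(2) S_def by (simp add: GH)
    qed
    fix y y' assume y: "y \<in> S" "y' \<in> S"
    have "norm (u y - u y') \<le> CP * dist (f n (\<theta> y)) (f n (\<theta> y'))"
      unfolding u_def by (intro lf(3) order_trans[OF near n1]) (use y in auto)
    also have "\<dots> \<le> CP * (c * CL * norm (y - y'))" using CP_pos by (intro mult_left_mono dist_f) auto
    finally have u: "norm (u y - u y') \<le> CP * (c * CL * norm (y - y'))" .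
    have "norm (H y - H y') \<le> ?d * (CP * (c * CL * norm (y - y'))) / 2 ^ n"
    proof (rule norm_undil_le)
      fix j
      have "?G j * (H y - H y') $ j = u y $ j - u y' $ j"
        using GH[of j y] GH[of j y'] by (simp add: right_diff_distrib)
      then show "\<bar>?G j * (H y - H y') $ j\<bar> \<le> CP * (c * CL * norm (y - y'))"
        using component_le_norm_cart[of "u y - u y'" j] u by simp
    qed
    also have "\<dots> = CP * (c * CL * ?d) / 2 ^ n * norm (y - y')" by (simp add: algebra_simps)
    also have "\<dots> \<le> 1/2 * norm (y - y')" using n3 by (intro mult_right_mono) auto
    finally show "dist (H y) (H y') \<le> 1/2 * dist y y'" by (simp add: dist_norm)
  qed auto
  then obtain x where x: "x \<in> S" "H x = x" by blast
  have "dil n x = u x + (\<chi> j. of_int (5 * z j))"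
    using GH[of _ x] unfolding x(2) by (simp add: vec_eq_iff dil_def)
  then have "\<theta> (dil n x) = f n (\<theta> x)"
    by (simp only: \<theta>_add_int) (simp add: u_def lf(1))
  then show ?thesis using x(1) unfolding S_def by blast
qed

text \<open>The expansion by \<open>D ^ n\<close> and the variation of the target are both at most a constant multiple of \<open>\<eta> * q\<close>, so a small \<open>\<eta>\<close>
suffices.\<close>

lemma near_solution_hits:
  assumes lip: "\<And>x y. dist (f n x) (f n y) \<le> c * dist x y" and c: "0 < c"
    and x: "\<theta> (dil n x) = f n (\<theta> x)"
    and y: "\<And>j. \<bar>of_int (D j) ^ n * (y $ j - x $ j)\<bar> \<le> \<eta> * q"
    and \<eta>: "\<eta> * (CL * real CARD('d) * (1 + c)) < 1" and q: "0 < q"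
  shows "\<theta> y \<in> hits f n q"
proof -
  let ?d = "real CARD('d)"
  have "norm (dil n (y - x)) \<le> (\<Sum>j\<in>UNIV. \<bar>dil n (y - x) $ j\<bar>)" by (rule norm_le_l1_cart)
  also have "\<dots> \<le> (\<Sum>j\<in>(UNIV::'d set). \<eta> * q)" using y by (intro sum_mono) (simp add: dil_def)
  finally have 1: "norm (dil n (y - x)) \<le> ?d * (\<eta> * q)" by simp
  have "norm (y - x) \<le> ?d * (\<eta> * q) / 2 ^ n" by (rule norm_undil_le) (use y in simp)
  also have "\<dots> \<le> ?d * (\<eta> * q)"
  proof -
    have "0 \<le> \<eta> * q" using y[of undefined] by linarith
    then have "?d * (\<eta> * q) / 2 ^ n \<le> ?d * (\<eta> * q) / 1" by (intro divide_left_mono) auto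
    then show ?thesis by simp
  qed
  finally have 2: "norm (y - x) \<le> ?d * (\<eta> * q)" .
  have "dist (\<theta> (dil n y) $ i) (f n (\<theta> y) $ i) < q" for i
  proof -
    have "dist (\<theta> (dil n y) $ i) (f n (\<theta> y) $ i) \<le> dist (\<theta> (dil n y)) (f n (\<theta> y))" by (rule dist_vec_nth_le)
    also have "\<dots> \<le> dist (\<theta> (dil n y)) (\<theta> (dil n x)) + dist (f n (\<theta> x)) (f n (\<theta> y))"
      unfolding x[symmetric] by (rule dist_triangle)
    also have "dist (\<theta> (dil n y)) (\<theta> (dil n x)) \<le> CL * (?d * (\<eta> * q))"
      using order_trans[OF dist_\<theta>_le[of "dil n y" "dil n x"], unfolded dil_diff]
        mult_left_mono[OF 1 less_imp_le[OF CL_pos]] by blast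
    also have "dist (f n (\<theta> x)) (f n (\<theta> y)) \<le> c * (CL * (?d * (\<eta> * q)))"
    proof -
      have "dist (f n (\<theta> x)) (f n (\<theta> y)) \<le> c * dist (\<theta> y) (\<theta> x)" using lip[of "\<theta> x" "\<theta> y"] by (simp add: dist_commute)
      also have "\<dots> \<le> c * (CL * norm (y - x))" using c by (intro mult_left_mono dist_\<theta>_le) auto
      also have "\<dots> \<le> c * (CL * (?d * (\<eta> * q)))" using c CL_pos by (intro mult_left_mono 2) auto
      finally show ?thesis .
    qed
    also have "CL * (?d * (\<eta> * q)) + c * (CL * (?d * (\<eta> * q))) = (\<eta> * (CL * ?d * (1 + c))) * q"
      by (simp add: algebra_simps)
    also have "\<dots> < 1 * q" using \<eta> q by (intro mult_strict_right_mono)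
    finally show ?thesis by simp
  qed
  then show ?thesis by (simp add: hits_def target_def torus_map_pow_\<theta>)
qed

end

section \<open>The upper bound\<close>

lemma bounded_torus: "bounded (S :: 'd::finite torus set)"
proof -
  have "dist x y \<le> (\<Sum>i\<in>(UNIV::'d set). 1/2)" for x y :: "'d torus"
    by (rule order_trans[OF dist_vec_le_sum]) (intro sum_mono dist_circle_le)
  then show ?thesis unfolding bounded_def by blast
qed

lemma diameter_le_dist:
  assumes "0 \<le> d" "\<And>x y. x \<in> S \<Longrightarrow> y \<in> S \<Longrightarrow> dist x y \<le> d"
  shows "diameter S \<le> d"
  using assms unfolding diameter_def by (auto intro!: cSUP_least)

lemma card_le_PiE:
  fixes F :: "('d::finite \<Rightarrow> int) set"
  assumes "\<And>g j. g \<in> F \<Longrightarrow> u j \<le> of_int (g j) \<and> of_int (g j) \<le> v j"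
    and uv: "\<And>j. u j \<le> v j + 1" and w: "\<And>j. v j - u j + 1 \<le> w j"
  shows "finite F" "real (card F) \<le> (\<Prod>j\<in>UNIV. w j)"
proof -
  let ?I = "\<lambda>j. {k::int. u j \<le> of_int k \<and> of_int k \<le> v j}"
  have sub: "F \<subseteq> Pi\<^sub>E UNIV ?I" using assms(1) by auto
  have fin: "finite (Pi\<^sub>E UNIV ?I)" using card_int_interval_le(1)[OF uv] by (intro finite_PiE) auto
  show "finite F" by (rule finite_subset[OF sub fin])
  have "card F \<le> card (Pi\<^sub>E UNIV ?I)" by (rule card_mono[OF fin sub])
  also have "\<dots> = (\<Prod>j\<in>UNIV. card (?I j))" by (simp add: card_PiE)
  finally have "real (card F) \<le> (\<Prod>j\<in>UNIV. real (card (?I j)))" by (simp flip: of_nat_prod)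
  also have "\<dots> \<le> (\<Prod>j\<in>UNIV. w j)"
    by (intro prod_mono conjI order_trans[OF card_int_interval_le(2)[OF uv] w]) auto
  finally show "real (card F) \<le> (\<Prod>j\<in>UNIV. w j)" .
qed

lemma eventually_small_const: "\<forall>\<^sub>F n in sequentially. a / 2 ^ n \<le> (b::real)" if "0 < b"
proof -
  have "(\<lambda>n. a * (1/2) ^ n) \<longlonglongrightarrow> a * 0" by (intro tendsto_intros LIMSEQ_power_zero) auto
  then have "(\<lambda>n. a / 2 ^ n) \<longlonglongrightarrow> 0" by (simp add: power_one_over)
  then have "\<forall>\<^sub>F n in sequentially. a / 2 ^ n < b" using that by (rule order_tendstoD)
  then show ?thesis by eventually_elim simp
qed

context diag_torus
begin

definition l :: "'d \<Rightarrow> real" where "l j = ln (of_int (D j))"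

lemma l_pos: "0 < l j" using D_real_ge[of j] by (simp add: l_def)

lemma D_pow_exp: "real_of_int (D j) ^ n = exp (real n * l j)"
  using D_real_ge[of j] by (simp add: l_def exp_of_nat_mult)

text \<open>The points \<open>y\<close> of the unit cube over the \<open>n\<close>-th set are sorted into cubes of side \<open>r\<close>. In direction \<open>j\<close> a coarse label records \<open>y $ j\<close> up to
\<open>t j\<close>, the larger of \<open>r\<close> and a quarter of the cell side \<open>1 / D j ^ n\<close>; on a quarter of a cell the image under \<open>T\<^sup>n\<close> does
not wrap around the circle. Points with equal coarse labels agree in direction \<open>j\<close> up to
\<open>r + C2 * q / D j ^ n\<close>, so in that direction they occupy only about \<open>max 1 (D i ^ n / D j ^ n)\<close> of the cubes.\<close>

lemma cover_hits:
  assumes lip: "\<And>x y. dist (f n x) (f n y) \<le> c * dist x y" and c: "0 < c"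
    and q: "0 < q" "q \<le> 1"
    and n: "CD * (2 + c * CL) * real CARD('d) / 2 ^ n \<le> 1/2"
    and r: "r = q / real_of_int (D i) ^ n"
  defines "K \<equiv> 5 + 2 * (CD * (2 + c * CL) * (2 * real CARD('d) + 2))"
  shows "\<exists>\<U>. finite \<U> \<and> hits f n q \<subseteq> \<Union>\<U> \<and>
     real (card \<U>) \<le> (8 * K) ^ CARD('d) * (\<Prod>j\<in>UNIV. min (1 / r) (real_of_int (D j) ^ n)
        * max 1 (real_of_int (D i) ^ n / real_of_int (D j) ^ n)) \<and>
     (\<forall>U\<in>\<U>. bounded U \<and> diameter U \<le> CL * real CARD('d) * r)"
proof -
  let ?d = "real CARD('d)"
  let ?G = "\<lambda>j. real_of_int (D j) ^ n"
  have G1: "1 \<le> ?G j" for j by (rule D_pow_ge_1)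
  have G0: "0 < ?G j" for j by (rule D_pow_pos)
  define C1 where "C1 = CD * (2 + c * CL)"
  define C2 where "C2 = C1 * (2 * ?d + 2)"
  have C1: "0 \<le> C1" using CD_nonneg c CL_pos by (simp add: C1_def)
  have C2: "0 \<le> C2" using C1 by (simp add: C2_def)
  have K: "K = 5 + 2 * C2" by (simp add: K_def C2_def C1_def)
  have r0: "0 < r" "r \<le> q" using q G0[of i] G1[of i] by (auto simp: r divide_le_eq)
  have r1: "r \<le> 1" using r0 q by simp
  define Y where "Y = {y. (\<forall>j. 0 \<le> y $ j \<and> y $ j < 1) \<and> \<theta> y \<in> hits f n q}"
  define t where "t = (\<lambda>j. max r (1 / (4 * ?G j)))"
  have t0: "0 < t j" for j using r0 by (simp add: t_def less_max_iff_disj)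
  have t1: "t j \<le> 1" for j using r1 G1[of j] by (simp add: t_def divide_le_eq)
  define g where "g = (\<lambda>y :: real ^ 'd. \<lambda>j. \<lfloor>y $ j / r\<rfloor>)"
  define B where "B = (\<lambda>y :: real ^ 'd. \<lambda>j. \<lfloor>y $ j / t j\<rfloor>)"
  define w where "w = (\<lambda>j. 2 + C2 * (?G i / ?G j))"
  have floor_close: "\<bar>a - b\<bar> < \<epsilon>" if "\<lfloor>a / \<epsilon>\<rfloor> = \<lfloor>b / \<epsilon>\<rfloor>" "0 < \<epsilon>" for a b \<epsilon> :: real
  proof -
    have "\<bar>a / \<epsilon> - b / \<epsilon>\<bar> < 1" using that(1) by linarith
    then have "\<bar>a - b\<bar> / \<epsilon> < 1" using that(2) by (simp add: diff_divide_distrib[symmetric] abs_divide)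
    then show ?thesis using that(2) by simp
  qed
  have close: "\<bar>of_int (g y j) - of_int (g y' j)\<bar> \<le> w j"
    if y: "y \<in> Y" "y' \<in> Y" and Beq: "B y' = B y" for y y' j
  proof -
    let ?m = "norm (y - y')"
    have Bj: "\<bar>y $ j - y' $ j\<bar> < t j" for j
      using fun_cong[OF Beq, of j] t0[of j] by (intro floor_close) (auto simp: B_def)
    have coord: "\<bar>y $ j - y' $ j\<bar> \<le> r + C1 * (q + ?m) / ?G j" for j
    \<comment> \<open>If \<open>t j = r\<close> the coarse label already determines the coordinate up to \<open>r\<close>; otherwise \<open>hits_close\<close> is used.\<close>
    proof (cases "1 / (4 * ?G j) \<le> r")
      case True
      then have "\<bar>y $ j - y' $ j\<bar> \<le> r" using Bj[of j] by (simp add: t_def)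
      moreover have "0 \<le> C1 * (q + ?m) / ?G j" using C1 q G0[of j] by simp
      ultimately show ?thesis by linarith
    next
      case False
      then have "\<bar>y $ j - y' $ j\<bar> < 1 / (4 * ?G j)" using Bj[of j] by (simp add: t_def)
      then have "?G j * \<bar>y $ j - y' $ j\<bar> \<le> 1/2" using G0[of j] by (simp add: field_simps)
      then have "\<bar>?G j * (y $ j - y' $ j)\<bar> \<le> 1/2" using G0[of j] by (simp only: abs_mult abs_of_pos)
      then have "?G j * \<bar>y $ j - y' $ j\<bar> = dist_to_int (?G j * (y $ j - y' $ j))"
        using G0[of j] by (simp only: dist_to_int_eq_abs abs_mult abs_of_pos)
      also have "\<dots> \<le> CD * (2 * q + c * CL * ?m)"
        using y by (intro hits_close[where f=f and n=n and c=c and q=q, OF lip c]) (auto simp: Y_def)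
      also have "\<dots> \<le> CD * ((2 + c * CL) * (q + ?m))"
        using q c CL_pos CD_nonneg by (intro mult_left_mono) (auto simp: algebra_simps)
      also have "\<dots> = C1 * (q + ?m)" by (simp add: C1_def)
      finally have "\<bar>y $ j - y' $ j\<bar> \<le> C1 * (q + ?m) / ?G j" using G0[of j] by (simp add: field_simps)
      then show ?thesis using r0 by linarith
    qed
    \<comment> \<open>The coordinatewise bound involves the distance \<open>?m\<close> of the two points; its factor is small for large \<open>n\<close>, so it can be absorbed.\<close>
    have m_le: "?m \<le> (2 * ?d + 1) * q"
    proof -
      have "?m \<le> (\<Sum>j\<in>UNIV. \<bar>(y - y') $ j\<bar>)" by (rule norm_le_l1_cart)
      also have "\<dots> \<le> (\<Sum>j\<in>(UNIV::'d set). q + C1 * (q + ?m) / 2 ^ n)"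
      proof (rule sum_mono)
        fix j
        have "C1 * (q + ?m) / ?G j \<le> C1 * (q + ?m) / 2 ^ n"
          using C1 q D_pow_ge[of n j] by (intro divide_left_mono) (auto intro!: mult_pos_pos G0)
        then show "\<bar>(y - y') $ j\<bar> \<le> q + C1 * (q + ?m) / 2 ^ n"
          using coord[of j] r0 by simp
      qed
      also have "\<dots> = ?d * q + (C1 * ?d / 2 ^ n) * (q + ?m)" by (simp add: algebra_simps)
      also have "\<dots> \<le> ?d * q + 1/2 * (q + ?m)"
        using n q by (intro add_left_mono mult_right_mono) (auto simp: C1_def)
      finally show ?thesis by (simp add: algebra_simps)
    qed
    have "\<bar>y $ j - y' $ j\<bar> \<le> r + C2 * q / ?G j"
    proof -
      have "C1 * (q + ?m) \<le> C1 * ((2 * ?d + 2) * q)"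
        using m_le C1 by (intro mult_left_mono) (auto simp: algebra_simps)
      then have "C1 * (q + ?m) / ?G j \<le> C2 * q / ?G j"
        using G0[of j] by (intro divide_right_mono) (auto simp: C2_def)
      then show ?thesis using coord[of j] by linarith
    qed
    then have "\<bar>y $ j - y' $ j\<bar> / r \<le> (r + C2 * q / ?G j) / r"
      using r0 by (intro divide_right_mono) auto
    also have "\<dots> = 1 + C2 * (?G i / ?G j)"
    proof -
      have "(q / a + C2 * q / b) / (q / a) = 1 + C2 * (a / b)" if "0 < a" "0 < b" for a b :: real
        using that q by (simp add: field_simps)
      from this[OF G0[of i] G0[of j]] show ?thesis by (simp only: r)
    qed
    finally have "\<bar>y $ j / r - y' $ j / r\<bar> \<le> 1 + C2 * (?G i / ?G j)"
      using r0 by (simp add: diff_divide_distrib[symmetric] abs_divide)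
    then show ?thesis unfolding g_def w_def by linarith
  qed
  have w0: "0 \<le> w j" for j using C2 G0[of i] G0[of j] by (simp add: w_def)
  have B_card: "finite (B ` Y)" "real (card (B ` Y)) \<le> (\<Prod>j\<in>UNIV. 8 * min (1 / r) (?G j))"
  proof -
    have *: "0 \<le> real_of_int (b j) \<and> real_of_int (b j) \<le> 1 / t j" if "b \<in> B ` Y" for b j
    proof -
      obtain y where y: "y \<in> Y" "b = B y" using \<open>b \<in> B ` Y\<close> by blast
      then have yj: "0 \<le> y $ j" "y $ j < 1" by (auto simp: Y_def)
      have "y $ j / t j \<le> 1 / t j" using yj t0[of j] by (intro divide_right_mono) auto
      moreover have "0 \<le> y $ j / t j" using yj t0[of j] by simp
      ultimately have "0 \<le> \<lfloor>y $ j / t j\<rfloor>" "real_of_int \<lfloor>y $ j / t j\<rfloor> \<le> 1 / t j"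
        by (simp, linarith)
      then show ?thesis unfolding y(2) B_def by simp
    qed
    have w': "1 / t j - 0 + 1 \<le> 8 * min (1 / r) (?G j)" for j
    proof -
      have "1 / t j \<le> 1 / r" using r0 t0[of j] by (intro divide_left_mono) (auto simp: t_def)
      moreover have "1 / t j \<le> 1 / (1 / (4 * ?G j))"
        using G0[of j] t0[of j] by (intro divide_left_mono) (auto simp: t_def)
      moreover have "1 \<le> 1 / t j" using t0[of j] t1[of j] by (simp add: field_simps)
      ultimately show ?thesis by (auto simp: min_def)
    qed
    have **: "0 \<le> 1 / t j + 1" for j using t0[of j] by simp
    show "finite (B ` Y)"
      by (rule card_le_PiE(1)[of _ "\<lambda>_. 0" "\<lambda>j. 1 / t j"], erule *, rule **, rule w')
    show "real (card (B ` Y)) \<le> (\<Prod>j\<in>UNIV. 8 * min (1 / r) (?G j))"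
      by (rule card_le_PiE(2)[of _ "\<lambda>_. 0" "\<lambda>j. 1 / t j"], erule *, rule **, rule w')
  qed
  have fib: "finite (g ` {y' \<in> Y. B y' = B y}) \<and>
      real (card (g ` {y' \<in> Y. B y' = B y})) \<le> (\<Prod>j\<in>UNIV. K * max 1 (?G i / ?G j))" if "y \<in> Y" for y
  proof -
    let ?F = "g ` {y' \<in> Y. B y' = B y}"
    have *: "of_int (g y j) - w j \<le> of_int (h j) \<and> of_int (h j) \<le> of_int (g y j) + w j" if h: "h \<in> ?F" for h j
    proof -
      obtain y' where "y' \<in> Y" "B y' = B y" "h = g y'" using h by blast
      then show ?thesis using close[OF \<open>y \<in> Y\<close>, of y' j] unfolding abs_le_iff by auto
    qed
    have **: "of_int (g y j) - w j \<le> of_int (g y j) + w j + 1" for j using w0[of j] by linarith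
    have ***: "of_int (g y j) + w j - (of_int (g y j) - w j) + 1 \<le> K * max 1 (?G i / ?G j)" for j
    proof -
      have "2 * (2 + C2 * x) + 1 \<le> (5 + 2 * C2) * m" if "1 \<le> m" "x \<le> m" for x m :: real
      proof -
        have C2m: "C2 * x \<le> C2 * m" using C2 that by (intro mult_left_mono)
        have "5 * 1 + 2 * (C2 * x) \<le> 5 * m + 2 * (C2 * m)"
          by (intro add_mono mult_left_mono[OF that(1)] mult_left_mono[OF C2m]) auto
        then show ?thesis by (simp add: algebra_simps)
      qed
      from this[of "max 1 (?G i / ?G j)" "?G i / ?G j"] show ?thesis unfolding w_def K by simp
    qed
    have "finite ?F"
      by (rule card_le_PiE(1)[of _ "\<lambda>j. of_int (g y j) - w j" "\<lambda>j. of_int (g y j) + w j"], erule *, rule **, rule ***)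
    moreover have "real (card ?F) \<le> (\<Prod>j\<in>UNIV. K * max 1 (?G i / ?G j))"
      by (rule card_le_PiE(2)[of _ "\<lambda>j. of_int (g y j) - w j" "\<lambda>j. of_int (g y j) + w j"], erule *, rule **, rule ***)
    ultimately show ?thesis ..
  qed
  note gY = card_image_fibres[OF B_card(1) fib]
  define \<U> where "\<U> = (\<lambda>a. \<theta> ` {y \<in> Y. g y = a}) ` (g ` Y)"
  have "finite \<U>" unfolding \<U>_def using gY(1) by simp
  moreover have "hits f n q \<subseteq> \<Union>\<U>"
  proof
    fix x assume x: "x \<in> hits f n q"
    obtain y where "\<And>j. 0 \<le> y $ j" "\<And>j. y $ j < 1" "\<theta> y = x" using \<theta>_surj_unit[of x] by metis
    with x have "y \<in> Y" by (simp add: Y_def)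
    then show "x \<in> \<Union>\<U>" unfolding \<U>_def using \<open>\<theta> y = x\<close> by blast
  qed
  moreover have "real (card \<U>) \<le> (8 * K) ^ CARD('d) * (\<Prod>j\<in>UNIV. min (1 / r) (?G j) * max 1 (?G i / ?G j))"
  proof -
    have "real (card \<U>) \<le> real (card (g ` Y))"
      unfolding \<U>_def using card_image_le[OF gY(1)] by simp
    also have "\<dots> \<le> real (card (B ` Y)) * (\<Prod>j\<in>UNIV. K * max 1 (?G i / ?G j))" by (rule gY(2))
    also have "\<dots> \<le> (\<Prod>j\<in>UNIV. 8 * min (1 / r) (?G j)) * (\<Prod>j\<in>UNIV. K * max 1 (?G i / ?G j))"
      using K C2 by (intro mult_right_mono B_card(2) prod_nonneg) auto
    also have "\<dots> = (\<Prod>j\<in>UNIV. (8 * K) * (min (1 / r) (?G j) * max 1 (?G i / ?G j)))"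
      by (simp only: prod.distrib[symmetric]) (intro prod.cong refl, simp only: ac_simps)
    also have "\<dots> = (8 * K) ^ CARD('d) * (\<Prod>j\<in>UNIV. min (1 / r) (?G j) * max 1 (?G i / ?G j))"
      by (simp only: prod.distrib prod_constant power_mult_distrib)
    finally show ?thesis .
  qed
  moreover have "\<forall>U\<in>\<U>. bounded U \<and> diameter U \<le> CL * ?d * r"
  proof (intro ballI conjI bounded_torus)
    fix U assume "U \<in> \<U>"
    then obtain y0 where y0: "U = \<theta> ` {y \<in> Y. g y = g y0}" unfolding \<U>_def by blast
    show "diameter U \<le> CL * ?d * r"
    proof (rule diameter_le_dist)
      show "0 \<le> CL * ?d * r" using CL_pos r0 by simp
      fix a b assume "a \<in> U" "b \<in> U"
      then obtain y y' where yy: "g y = g y0" "g y' = g y0" "a = \<theta> y" "b = \<theta> y'" unfolding y0 by blast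
      have "norm (y - y') \<le> (\<Sum>j\<in>UNIV. \<bar>(y - y') $ j\<bar>)" by (rule norm_le_l1_cart)
      also have "\<dots> \<le> (\<Sum>j\<in>(UNIV::'d set). r)"
      proof (rule sum_mono)
        fix j
        have "\<lfloor>y $ j / r\<rfloor> = \<lfloor>y' $ j / r\<rfloor>" using fun_cong[OF yy(1), of j] fun_cong[OF yy(2), of j] by (simp add: g_def)
        from floor_close[OF this r0(1)] show "\<bar>(y - y') $ j\<bar> \<le> r" by simp
      qed
      finally have "CL * norm (y - y') \<le> CL * (?d * r)" using CL_pos by (intro mult_left_mono) auto
      then show "dist a b \<le> CL * ?d * r" using dist_\<theta>_le[of y y'] yy by simp
    qed
  qed
  ultimately show ?thesis by blast
qed

text \<open>The three factors that occur in the counting and measure estimates, in logarithmic scale.\<close>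

lemma prod_eq_exp_phi:
  assumes n: "0 < n" and r: "r = exp (- real n * u)" and q: "q = exp (- real n * \<tau>)"
  shows "min (1 / r) (real_of_int (D j) ^ n) = exp (real n * min u (l j))"
    "max r (1 / real_of_int (D j) ^ n) = exp (- real n * min u (l j))"
    "min 1 (r * real_of_int (D j) ^ n / q) = exp (- real n * max 0 (u - \<tau> - l j))"
proof -
  have e: "1 / exp x = exp (- x)" for x :: real by (simp add: exp_minus field_simps)
  have n': "0 < real n" using n by simp
  show "min (1 / r) (real_of_int (D j) ^ n) = exp (real n * min u (l j))"
    unfolding D_pow_exp r e using n' by (simp add: min_def)
  show "max r (1 / real_of_int (D j) ^ n) = exp (- real n * min u (l j))"
    unfolding D_pow_exp r e using n' by (simp add: min_def max_def)
  have "r * real_of_int (D j) ^ n / q = exp (- real n * (u - \<tau> - l j))"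
    unfolding D_pow_exp r q by (simp add: exp_add[symmetric] exp_diff[symmetric] algebra_simps)
  then show "min 1 (r * real_of_int (D j) ^ n / q) = exp (- real n * max 0 (u - \<tau> - l j))"
    using n' by (auto simp: min_def max_def mult_le_0_iff zero_le_mult_iff)
qed

lemma phi_nonneg: "0 \<le> \<tau> \<Longrightarrow> 0 \<le> u \<Longrightarrow> 0 \<le> phi l \<tau> u"
  unfolding phi_def using l_pos by (intro sum_nonneg add_nonneg_nonneg) (auto simp: less_imp_le)

lemma phi_le: "0 \<le> \<tau> \<Longrightarrow> phi l \<tau> u \<le> real CARD('d) * u"
proof -
  assume "0 \<le> \<tau>"
  then have "phi l \<tau> u \<le> (\<Sum>j\<in>(UNIV::'d set). u)"
    unfolding phi_def by (intro sum_mono) linarith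
  then show ?thesis by simp
qed

text \<open>At the scale \<open>u = \<tau> + l i\<close> the count of \<open>cover_hits\<close> is \<open>exp (n * phi l \<tau> u)\<close> up to a constant, because
\<open>u - \<tau> - l j = l i - l j\<close>.\<close>

lemma dim_limsup_hits_le:
  assumes c: "0 < c" and lip: "\<And>n x y. 1 \<le> n \<Longrightarrow> dist (f n x) (f n y) \<le> c * dist x y"
    and \<tau>: "0 \<le> \<tau>"
    and small: "\<forall>\<^sub>F n in sequentially. hits f n (\<psi> n) \<subseteq> hits f n (exp (- real n * \<tau>))"
  shows "hausdorff_dim {x. infinite {n. 1 \<le> n \<and> x \<in> hits f n (\<psi> n)}}
    \<le> ereal (phi l \<tau> (\<tau> + l i) / (\<tau> + l i))"
proof -
  let ?d = "real CARD('d)"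
  define u where "u = \<tau> + l i"
  have u: "0 < u" using \<tau> l_pos[of i] by (simp add: u_def)
  have "\<forall>\<^sub>F n in sequentially. 1 \<le> n \<and> hits f n (\<psi> n) \<subseteq> hits f n (exp (- real n * \<tau>)) \<and>
      CD * (2 + c * CL) * ?d / 2 ^ n \<le> 1/2"
    by (intro eventually_conj small eventually_ge_at_top eventually_small_const) simp
  then obtain n0 where n0: "\<And>n. n0 \<le> n \<Longrightarrow> 1 \<le> n \<and> hits f n (\<psi> n) \<subseteq> hits f n (exp (- real n * \<tau>)) \<and>
      CD * (2 + c * CL) * ?d / 2 ^ n \<le> 1/2"
    unfolding eventually_sequentially by blast
  define K where "K = (8 * (5 + 2 * (CD * (2 + c * CL) * (2 * ?d + 2)))) ^ CARD('d)"
  have K: "0 \<le> K" using CD_nonneg c CL_pos unfolding K_def by (intro zero_le_power) simp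
  have "\<exists>\<U>. finite \<U> \<and> hits f n (\<psi> n) \<subseteq> \<Union>\<U> \<and> real (card \<U>) \<le> K * exp (real n * phi l \<tau> u) \<and>
      (\<forall>U\<in>\<U>. bounded U \<and> diameter U \<le> CL * ?d * exp (- real n * u))" if n: "n0 \<le> n" for n
  proof -
    have n1: "1 \<le> n" "0 < n" using n0[OF n] by auto
    have r: "exp (- real n * u) = exp (- real n * \<tau>) / real_of_int (D i) ^ n"
      unfolding D_pow_exp u_def by (simp add: exp_diff[symmetric] algebra_simps)
    obtain \<U> where U: "finite \<U>" "hits f n (exp (- real n * \<tau>)) \<subseteq> \<Union>\<U>"
      "real (card \<U>) \<le> K * (\<Prod>j\<in>UNIV. min (1 / exp (- real n * u)) (real_of_int (D j) ^ n)
        * max 1 (real_of_int (D i) ^ n / real_of_int (D j) ^ n))"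
      "\<forall>U\<in>\<U>. bounded U \<and> diameter U \<le> CL * ?d * exp (- real n * u)"
      unfolding K_def using cover_hits[where f=f and n=n, OF lip[OF n1(1)] c _ _ _ r] n0[OF n] \<tau> by auto
    have "(\<Prod>j\<in>UNIV. min (1 / exp (- real n * u)) (real_of_int (D j) ^ n)
        * max 1 (real_of_int (D i) ^ n / real_of_int (D j) ^ n)) = exp (real n * phi l \<tau> u)"
    proof -
      have "max 1 (real_of_int (D i) ^ n / real_of_int (D j) ^ n) = exp (real n * max 0 (u - \<tau> - l j))" for j
        unfolding D_pow_exp exp_diff[symmetric] u_def using n1 by (simp add: max_def zero_le_mult_iff flip: right_diff_distrib)
      then show ?thesis
        unfolding prod_eq_exp_phi(1)[OF n1(2) refl refl] phi_def sum_distrib_left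
        by (simp add: exp_sum exp_add distrib_left)
    qed
    then show ?thesis using U n0[OF n] by (intro exI[of _ \<U>]) auto
  qed
  then obtain \<U> where U: "\<And>n. n0 \<le> n \<Longrightarrow> finite (\<U> n) \<and> hits f n (\<psi> n) \<subseteq> \<Union>(\<U> n) \<and>
      real (card (\<U> n)) \<le> K * exp (real n * phi l \<tau> u) \<and>
      (\<forall>U\<in>\<U> n. bounded U \<and> diameter U \<le> CL * ?d * exp (- real n * u))"
    by metis
  have "hausdorff_dim {x. infinite {n. 1 \<le> n \<and> x \<in> hits f n (\<psi> n)}} \<le> ereal (phi l \<tau> u / u)"
  proof (rule hausdorff_dim_limsup_le[where C = "CL * ?d" and K = K and \<U> = \<U> and ?n0.0 = n0, OF u])
    fix x n assume "x \<in> {x. infinite {n. 1 \<le> n \<and> x \<in> hits f n (\<psi> n)}}"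
    then obtain m where "max n n0 < m" "x \<in> hits f m (\<psi> m)"
      unfolding infinite_nat_iff_unbounded by blast
    then show "\<exists>m\<ge>n. x \<in> \<Union> (\<U> m)" using U[of m] by (intro exI[of _ m]) auto
  qed (use U K \<tau> u CL_pos phi_nonneg in auto)
  then show ?thesis by (simp add: u_def)
qed

end

section \<open>The lower bound\<close>

context diag_torus
begin

text \<open>The boxes are those around the solutions of \<open>solution_in_cell\<close>, with half-sides
\<open>\<eta> * exp (- n * \<tau>) / D j ^ n\<close>; they fulfil the hypotheses of \<open>equidistributed_boxes\<close> on a cube of side \<open>a\<close> that is so small that
\<open>\<theta>\<close> is bi-Lipschitz on it.\<close>

lemma dim_limsup_hits_ge:
  assumes c: "0 < c" and lip: "\<And>n x y. 1 \<le> n \<Longrightarrow> dist (f n x) (f n y) \<le> c * dist x y"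
    and \<tau>: "0 \<le> \<tau>"
    and often: "infinite {n. hits f n (exp (- real n * \<tau>)) \<subseteq> hits f n (\<psi> n)}"
    and knots: "\<And>i. s * (\<tau> + l i) \<le> phi l \<tau> (\<tau> + l i)"
  shows "ereal s \<le> hausdorff_dim {x. infinite {n. 1 \<le> n \<and> x \<in> hits f n (\<psi> n)}}"
proof -
  let ?d = "real CARD('d)"
  let ?q = "\<lambda>n. exp (- real n * \<tau>)"
  let ?G = "\<lambda>n j. real_of_int (D j) ^ n"
  let ?W = "{x. infinite {n. 1 \<le> n \<and> x \<in> hits f n (\<psi> n)}}"
  \<comment> \<open>The bound \<open>1/2\<close> keeps the boxes in their slabs, the other one keeps them in the \<open>n\<close>-th set by \<open>near_solution_hits\<close>.\<close>
  define \<eta> where "\<eta> = min (1/2) (1 / (2 * (CL * ?d * (1 + c))))"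
  have cc: "0 < CL * ?d * (1 + c)" using CL_pos c by simp
  have \<eta>: "0 < \<eta>" "\<eta> \<le> 1/2" using cc by (auto simp: \<eta>_def)
  have \<eta>2: "\<eta> * (CL * ?d * (1 + c)) < 1"
  proof -
    have "\<eta> * (CL * ?d * (1 + c)) \<le> (1 / (2 * (CL * ?d * (1 + c)))) * (CL * ?d * (1 + c))"
      using cc by (intro mult_right_mono) (auto simp: \<eta>_def)
    also have "\<dots> = 1/2"
    proof -
      have "(1 / (2 * x)) * x = 1/2" if "0 < x" for x :: real using that by simp
      from this[OF cc] show ?thesis .
    qed
    finally show ?thesis by simp
  qed
  have "\<forall>\<^sub>F n in sequentially. 1 \<le> n \<and> c * CL * (2 * ?d) / 2 ^ n \<le> 1/4 \<and>
      CP * (c * CL * (2 * ?d)) / 2 ^ n \<le> 1 \<and> CP * (c * CL * ?d) / 2 ^ n \<le> 1/2 \<and> 18 / 2 ^ n \<le> (1::real)"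
    by (intro eventually_conj eventually_ge_at_top eventually_small_const) simp_all
  then obtain n0 where n0: "\<And>n. n0 \<le> n \<Longrightarrow> 1 \<le> n \<and> c * CL * (2 * ?d) / 2 ^ n \<le> 1/4 \<and>
      CP * (c * CL * (2 * ?d)) / 2 ^ n \<le> 1 \<and> CP * (c * CL * ?d) / 2 ^ n \<le> 1/2 \<and> 18 / 2 ^ n \<le> (1::real)"
    unfolding eventually_sequentially by blast
  define N where "N = {n. n0 \<le> n \<and> hits f n (?q n) \<subseteq> hits f n (\<psi> n)}"
  have "infinite N"
  proof
    assume "finite N"
    then have "finite (N \<union> {..<n0})" by simp
    moreover have "{n. hits f n (?q n) \<subseteq> hits f n (\<psi> n)} \<subseteq> N \<union> {..<n0}" by (auto simp: N_def)
    ultimately show False using often finite_subset by blast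
  qed
  have "\<exists>x. n0 \<le> n \<longrightarrow> (\<theta> (dil n x) = f n (\<theta> x) \<and>
    (\<forall>j. 5 * of_int (z j) - 1 \<le> ?G n j * x $ j \<and> ?G n j * x $ j \<le> 5 * of_int (z j) + 2))" for n z
  proof (cases "n0 \<le> n")
    case True
    with n0[OF True] solution_in_cell[where f=f and n=n and c=c and z=z, OF lip c] show ?thesis by auto
  qed simp
  then obtain xc where xc: "\<And>n z. n0 \<le> n \<longrightarrow> (\<theta> (dil n (xc n z)) = f n (\<theta> (xc n z)) \<and>
    (\<forall>j. 5 * of_int (z j) - 1 \<le> ?G n j * xc n z $ j \<and> ?G n j * xc n z $ j \<le> 5 * of_int (z j) + 2))"
    by metis
  define h where "h = (\<lambda>n. (\<chi> j. \<eta> * ?q n / ?G n j) :: real ^ 'd)"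
  have h_nth: "h n $ j = \<eta> * ?q n / ?G n j" for n j by (simp add: h_def)
  have Gh: "?G n j * h n $ j = \<eta> * ?q n" for n j
    using D_ge[of j] by (simp add: h_def)
  have q1: "?q n \<le> 1" for n using \<tau> by simp
  have \<eta>q: "\<eta> * ?q n \<le> 1/2" for n
    using \<eta> q1[of n] mult_mono[of \<eta> "1/2" "?q n" 1] by simp
  have h_pos: "0 < h n $ j" for n j
    unfolding h_nth using \<eta> D_pow_pos[where j=j and n=n] by simp
  have grid: "box_grid (?G n) (xc n) (h n)" if "n0 \<le> n" for n
  proof
    show "0 < ?G n j" for j by (rule D_pow_pos)
    show "0 < h n $ j" for j by (rule h_pos)
    show "?G n j * h n $ j \<le> 1/2" for j unfolding Gh by (rule \<eta>q)
  qed (use xc that in auto)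
  define E where "E = (\<lambda>n. box_grid.E (?G n) (xc n) (h n))"
  define p where "p = (\<lambda>n. box_grid.density (?G n) (h n))"
  define \<delta> where "\<delta> = (\<lambda>n. \<Sum>j\<in>UNIV. 9 / ?G n j)"
  define a where "a = min (1/2) (1 / (2 * CQ * ?d))"
  have a: "0 < a" "a \<le> 1/2" using CQ_pos by (auto simp: a_def)
  have a2: "?d * a \<le> 1 / (2 * CQ)"
  proof -
    have "?d * a \<le> ?d * (1 / (2 * CQ * ?d))" by (intro mult_left_mono) (auto simp: a_def)
    also have "\<dots> = 1 / (2 * CQ)" using CQ_pos by (simp add: field_simps)
    finally show ?thesis .
  qed
  define C where "C = (11 / \<eta>) ^ CARD('d)"
  have phi_lin: "s * u \<le> phi l \<tau> u" if "0 \<le> u" for u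
    by (rule phi_ge_linear[OF l_pos \<tau> that knots])
  have s_le: "s \<le> ?d" using phi_lin[of 1] phi_le[OF \<tau>, of 1] by simp
  interpret eb: equidistributed_boxes 0 "vec a" E p \<delta> N s C
  proof
    show "infinite N" by fact
    show "box_union (E n)" if "n \<in> N" for n
      unfolding E_def using that by (intro box_grid.box_union_E grid) (simp add: N_def)
    show "0 < p n" if "n \<in> N" for n
      unfolding p_def using that by (intro box_grid.density_pos[OF grid]) (simp add: N_def)
    show "\<bar>measure lborel (E n \<inter> cbox u v) / p n - measure lborel (cbox u v)\<bar> \<le> \<delta> n"
      if n: "n \<in> N" and sub: "cbox u v \<subseteq> cbox 0 (vec a)" for n u v
      unfolding E_def p_def \<delta>_def
    proof (rule box_grid.measure_cbox_close[OF grid])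
      show "n0 \<le> n" using n by (simp add: N_def)
      show "cbox u v \<subseteq> cbox 0 (vec (1/2))"
      proof
        fix y assume "y \<in> cbox u v"
        then have "0 \<le> y $ i \<and> y $ i \<le> a" for i using sub by (auto simp: mem_box_cart subset_iff)
        then have "0 \<le> y $ i \<and> y $ i \<le> 1/2" for i using a(2) order_trans by blast
        then show "y \<in> cbox 0 (vec (1/2))" by (simp add: mem_box_cart)
      qed
      have "18 \<le> (2::real) ^ n" using n0[of n] n by (simp add: N_def)
      then show "18 \<le> ?G n j" for j using D_pow_ge[of n j] by linarith
    qed
    have "(\<lambda>n. 9 / ?G n j) \<longlonglongrightarrow> 0" for j
    proof -
      have "(\<lambda>n. 9 * (1 / real_of_int (D j)) ^ n) \<longlonglongrightarrow> 9 * 0"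
        using D_real_ge[of j] by (intro tendsto_intros LIMSEQ_power_zero) auto
      then show ?thesis by (simp add: power_one_over)
    qed
    then show "\<delta> \<longlonglongrightarrow> 0" unfolding \<delta>_def by (rule tendsto_null_sum)
    show "0 \<le> C" using \<eta> by (simp add: C_def)
    show "0 < measure lborel (cbox 0 (vec a) :: (real ^ 'd) set)"
      using a by (subst measure_cbox_cart) auto
    show "s \<le> ?d" by (rule s_le)
    show "measure lborel (E n \<inter> mcube x r) / p n \<le> C * r powr s"
      if n: "n \<in> N" and r: "0 < r" "r \<le> 1" for n x r
    proof -
      have nn: "n0 \<le> n" "0 < n" using n n0[of n] by (auto simp: N_def)
      \<comment> \<open>The scale of the cube in the normalization of \<open>phi\<close>.\<close>
      define u where "u = - ln r / real n"
      have u: "0 \<le> u" using r nn by (simp add: u_def divide_nonpos_pos)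
      have r_exp: "r = exp (- real n * u)" using r nn by (simp add: u_def)
      have "measure lborel (E n \<inter> mcube x r) / p n \<le> (\<Prod>j\<in>UNIV. (2 * r + 9 / ?G n j) * min 1 (r / h n $ j))"
        unfolding E_def p_def by (rule box_grid.measure_mcube_le[OF grid[OF nn(1)] r(1)])
      also have "\<dots> \<le> (\<Prod>j\<in>UNIV. (11 * max r (1 / ?G n j)) * (1 / \<eta> * min 1 (r * ?G n j / ?q n)))"
      proof (intro prod_mono conjI mult_mono)
        fix j
        have G0: "0 < ?G n j" by (rule D_pow_pos)
        show "0 \<le> (2 * r + 9 / ?G n j) * min 1 (r / h n $ j)"
          using r G0 h_pos[of n j] by (intro mult_nonneg_nonneg) auto
        show "0 \<le> min 1 (r / h n $ j)" using r h_pos[of n j] by simp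
        show "0 \<le> 11 * max r (1 / ?G n j)" using r by simp
        have "9 / ?G n j = 9 * (1 / ?G n j)" by simp
        then show "2 * r + 9 / ?G n j \<le> 11 * max r (1 / ?G n j)" by linarith
        have "r / h n $ j = 1 / \<eta> * (r * ?G n j / ?q n)"
        proof -
          have "r / (\<eta> * Q / G) = 1 / \<eta> * (r * G / Q)" if "0 < Q" "0 < G" for Q G :: real
            using that \<eta> by (simp add: field_simps)
          from this[OF exp_gt_zero G0] show ?thesis unfolding h_nth .
        qed
        moreover have "1 \<le> 1 / \<eta>" using \<eta> by (simp add: field_simps)
        moreover have "min 1 (e * X) \<le> e * min 1 X" if "1 \<le> e" for e X :: real
          using that by (cases "X \<le> 1") (simp_all add: min_absorb1 min_absorb2 min.coboundedI1)
        ultimately show "min 1 (r / h n $ j) \<le> 1 / \<eta> * min 1 (r * ?G n j / ?q n)"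
          by metis
      qed
      also have "\<dots> = (\<Prod>j\<in>UNIV. (11 / \<eta>) * exp (- real n * (min u (l j) + max 0 (u - \<tau> - l j))))"
        unfolding prod_eq_exp_phi(2,3)[OF nn(2) r_exp refl]
        by (intro prod.cong refl) (simp add: exp_add[symmetric] distrib_left mult_exp_exp)
      also have "\<dots> = C * exp (- real n * phi l \<tau> u)"
        by (simp only: prod.distrib prod_constant C_def phi_def sum_distrib_left exp_sum[OF finite])
      also have "\<dots> \<le> C * exp (- real n * (s * u))"
        using \<eta> phi_lin[OF u] by (intro mult_left_mono) (auto simp: C_def mult_left_mono)
      also have "exp (- real n * (s * u)) = r powr s"
        using r nn by (simp add: powr_def u_def)
      finally show ?thesis .
    qed
  qed
  show ?thesis
  proof (rule hausdorff_dim_ge)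
    fix s' assume s': "0 < s'" "s' < s"
    define L where "L = {y \<in> cbox 0 (vec a). infinite {n \<in> N. y \<in> E n}}"
    obtain \<kappa> where \<kappa>: "0 < \<kappa>" "\<forall>(x :: nat \<Rightarrow> real ^ 'd) \<rho>. (\<forall>i. 0 < \<rho> i) \<longrightarrow>
     L \<subseteq> (\<Union>i. mcube (x i) (\<rho> i)) \<longrightarrow> ennreal \<kappa> \<le> (\<Sum>i. ennreal (\<rho> i powr s'))"
      using eb.limsup_cube_content_pos[OF less_imp_le[OF s'(1)] s'(2), folded L_def] by (elim exE conjE)
    show "hausdorff_measure s' ?W \<noteq> 0"
    proof (rule hausdorff_measure_nonzero_of_content[OF s'(1) \<kappa>(1) CP_pos])
      fix x :: "nat \<Rightarrow> real ^ 'd" and \<rho> :: "nat \<Rightarrow> real"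
      assume "\<And>i. 0 < \<rho> i" "L \<subseteq> (\<Union>i. mcube (x i) (\<rho> i))"
      then show "ennreal \<kappa> \<le> (\<Sum>i. ennreal (\<rho> i powr s'))" using \<kappa>(2) by simp
    next
      fix y assume y: "y \<in> L"
      have "{n \<in> N. y \<in> E n} \<subseteq> {n. 1 \<le> n \<and> \<theta> y \<in> hits f n (\<psi> n)}"
      proof safe
        fix n assume n: "n \<in> N" "y \<in> E n"
        then have nn: "n0 \<le> n" "1 \<le> n" using n0[of n] by (auto simp: N_def)
        then show "1 \<le> n" by simp
        obtain z where z: "y \<in> box_grid.R (xc n) (h n) z"
          using n(2) unfolding E_def box_grid.E_def[OF grid[OF nn(1)]] by blast
        have "\<bar>?G n j * (y $ j - xc n z $ j)\<bar> \<le> \<eta> * ?q n" for j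
        proof -
          have "\<bar>y $ j - xc n z $ j\<bar> \<le> h n $ j"
            using z unfolding box_grid.R_def[OF grid[OF nn(1)]] mem_box_cart
            by (metis abs_le_iff add.commute diff_le_eq minus_diff_eq vector_add_component vector_minus_component)
          then have "?G n j * \<bar>y $ j - xc n z $ j\<bar> \<le> ?G n j * h n $ j"
            using D_pow_pos[where j=j and n=n] by (intro mult_left_mono) auto
          then show ?thesis unfolding Gh abs_mult using D_pow_pos[where j=j and n=n] by simp
        qed
        then have "\<theta> y \<in> hits f n (?q n)"
          using xc nn \<eta>2 by (intro near_solution_hits[where f=f and n=n and c=c and \<eta>=\<eta> and x="xc n z", OF lip c]) auto
        then show "\<theta> y \<in> hits f n (\<psi> n)" using n(1) by (auto simp: N_def)
      qed
      then show "\<theta> y \<in> ?W" using y finite_subset unfolding L_def by blast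
    next
      fix y y' assume y: "y \<in> L" "y' \<in> L"
      have "norm (y - y') \<le> (\<Sum>j\<in>UNIV. \<bar>(y - y') $ j\<bar>)" by (rule norm_le_l1_cart)
      also have "\<dots> \<le> (\<Sum>j\<in>(UNIV::'d set). a)"
      proof (rule sum_mono)
        fix j
        have "0 \<le> y $ j \<and> y $ j \<le> a" "0 \<le> y' $ j \<and> y' $ j \<le> a"
          using y by (auto simp: L_def mem_box_cart)
        then show "\<bar>(y - y') $ j\<bar> \<le> a" by (auto simp: abs_le_iff)
      qed
      also have "\<dots> \<le> 1 / (2 * CQ)" using a2 by simp
      finally show "norm (y - y') \<le> CP * dist (\<theta> y) (\<theta> y')" by (rule \<theta>_bilipschitz)
    qed
  qed
qed

end

section \<open>Eigenvalues\<close>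

text \<open>The characteristic polynomial is a determinant over the ring of polynomials, so similarity has to be transported there.\<close>

definition const_matrix :: "int ^ 'd ^ 'd \<Rightarrow> real poly ^ 'd ^ 'd" where
  "const_matrix A = map_matrix (\<lambda>a. [:real_of_int a:]) A"

lemma sum_const_poly: "(\<Sum>k\<in>A. [:f k:]) = [:\<Sum>k\<in>A. f k:]"
  for f :: "'a \<Rightarrow> 'b::comm_monoid_add"
  by (induction A rule: infinite_finite_induct) auto

lemma const_matrix_mult: "const_matrix (A ** B) = const_matrix A ** const_matrix B"
  by (simp add: const_matrix_def vec_eq_iff matrix_matrix_mult_def sum_const_poly mult.commute)

lemma const_matrix_mat1: "const_matrix (mat 1) = mat 1"
  by (auto simp: const_matrix_def vec_eq_iff mat_def one_pCons)

lemma charpoly_similar: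
  fixes A P Q :: "int ^ 'd ^ 'd"
  assumes PQ: "P ** Q = mat 1"
  shows "charpoly (P ** A ** Q) = charpoly A"
proof -
  let ?X = "(\<chi> i j. if i = j then [:0, 1:] else 0) :: real poly ^ 'd ^ 'd"
  have cp: "charpoly B = det (?X - const_matrix B)" for B :: "int ^ 'd ^ 'd"
    unfolding charpoly_def by (intro arg_cong[where f=det]) (simp add: vec_eq_iff const_matrix_def)
  have X: "?X ** B = (\<chi> i j. [:0, 1:] * B $ i $ j)" "B ** ?X = (\<chi> i j. [:0, 1:] * B $ i $ j)"
    for B :: "real poly ^ 'd ^ 'd"
    by (simp_all add: vec_eq_iff matrix_matrix_mult_def if_distrib[of "\<lambda>x. x * _"] if_distrib[of "\<lambda>x. _ * x"] mult.commute
        cong: if_cong)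
  have diff: "(B - C) ** E = B ** E - C ** E" "E ** (B - C) = E ** B - E ** C" for B C E :: "real poly ^ 'd ^ 'd"
    by (simp_all add: vec_eq_iff matrix_matrix_mult_def sum_subtractf left_diff_distrib right_diff_distrib)
  have "?X - const_matrix (P ** A ** Q) = const_matrix P ** (?X - const_matrix A) ** const_matrix Q"
  proof -
    have "const_matrix P ** ?X ** const_matrix Q = ?X ** (const_matrix P ** const_matrix Q)"
      by (simp add: X[symmetric] matrix_mul_assoc) (simp add: X)
    also have "\<dots> = ?X" by (simp add: const_matrix_mult[symmetric] PQ const_matrix_mat1)
    finally show ?thesis by (simp add: diff const_matrix_mult)
  qed
  then have "charpoly (P ** A ** Q) = det (const_matrix P) * charpoly A * det (const_matrix Q)"
    by (simp add: cp det_mul)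
  also have "\<dots> = det (const_matrix P ** const_matrix Q) * charpoly A" by (simp add: det_mul mult.commute mult.left_commute)
  also have "\<dots> = charpoly A" by (simp add: const_matrix_mult[symmetric] PQ const_matrix_mat1)
  finally show ?thesis .
qed

lemma charpoly_diagonal:
  "charpoly (\<chi> i j. if i = j then D i else 0 :: int ^ 'd ^ 'd) = (\<Prod>i\<in>(UNIV::'d::finite set). [:- real_of_int (D i), 1:])"
  unfolding charpoly_def by (subst det_diagonal) simp_all

text \<open>The diagonal entries and the numbers \<open>\<beta> j\<close> are the roots of the same polynomial, with multiplicities. The dimension formula depends on
them only through symmetric sums and the set of values.\<close>

lemma diagonal_entries_eq_eigenvalues:
  fixes T P Q :: "int ^ 'd ^ 'd" and D :: "'d \<Rightarrow> int"
  assumes ev: "eigenvalue_list T \<beta>" and PQ: "P ** Q = mat 1"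
    and conj: "P ** T ** Q = (\<chi> i j. if i = j then D i else 0)"
  shows "(\<Sum>j=1..CARD('d). g (\<beta> j)) = (\<Sum>j\<in>UNIV. g (real_of_int (D j)) :: real)"
    and "\<beta> ` {1..CARD('d)} = range (\<lambda>j. real_of_int (D j))"
proof -
  have "(\<Prod>i=1..CARD('d). [: - \<beta> i, 1 :]) = (\<Prod>i\<in>(UNIV::'d set). [:- real_of_int (D i), 1:])"
    using ev charpoly_similar[OF PQ, of T] unfolding conj charpoly_diagonal eigenvalue_list_def by simp
  then have "proots (\<Prod>i=1..CARD('d). [: - \<beta> i, 1 :]) = proots (\<Prod>i\<in>(UNIV::'d set). [:- real_of_int (D i), 1:])"
    by simp
  then have eq: "(\<Sum>i=1..CARD('d). {#\<beta> i#}) = (\<Sum>i\<in>(UNIV::'d set). {#real_of_int (D i)#})"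
    by (simp add: proots_prod)
  have img: "(\<Sum>i\<in>A. {#f i#}) = image_mset f (mset_set A)" for f :: "'b \<Rightarrow> real" and A
    by (induction A rule: infinite_finite_induct) auto
  have "image_mset \<beta> (mset_set {1..CARD('d)}) = image_mset (\<lambda>j. real_of_int (D j)) (mset_set UNIV)"
    using eq unfolding img .
  then have "set_mset (image_mset \<beta> (mset_set {1..CARD('d)})) = set_mset (image_mset (\<lambda>j. real_of_int (D j)) (mset_set UNIV))"
    and "sum_mset (image_mset g (image_mset \<beta> (mset_set {1..CARD('d)})))
      = sum_mset (image_mset g (image_mset (\<lambda>j. real_of_int (D j)) (mset_set UNIV)))" by simp_all
  then show "\<beta> ` {1..CARD('d)} = range (\<lambda>j. real_of_int (D j))"
    "(\<Sum>j=1..CARD('d). g (\<beta> j)) = (\<Sum>j\<in>UNIV. g (real_of_int (D j)))"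
    by (simp_all add: image_mset.compositionality o_def sum_unfold_sum_mset)
qed

lemma diagonalizable_int_imp_ex:
  fixes T :: "int ^ 'd ^ 'd"
  assumes "diagonalizable_int T"
  shows "\<exists>(P :: int ^ 'd ^ 'd) (Q :: int ^ 'd ^ 'd) D. P ** Q = mat 1 \<and> Q ** P = mat 1 \<and> P ** T ** Q = (\<chi> i j. if i = j then D i else 0)"
  using assms unfolding diagonalizable_int_def
proof (elim exE conjE)
  fix P :: "int ^ 'd ^ 'd"
  assume P: "invertible P" "\<forall>i j. i \<noteq> j \<longrightarrow> (P ** T ** matrix_inv P) $ i $ j = 0"
  have "P ** matrix_inv P = mat 1 \<and> matrix_inv P ** P = mat 1"
    using P(1) unfolding invertible_def matrix_inv_def by (rule someI_ex)
  moreover have "P ** T ** matrix_inv P = (\<chi> i j. if i = j then (P ** T ** matrix_inv P) $ i $ i else 0)"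
    using P(2) by (simp add: vec_eq_iff)
  ultimately show ?thesis
    by (intro exI[of _ P] exI[of _ "matrix_inv P"] exI[of _ "\<lambda>i. (P ** T ** matrix_inv P) $ i $ i"])
      (elim conjE, intro conjI)
qed

section \<open>The dimension formula\<close>

text \<open>The quantity \<open>dim_ratio\<close> as a function of the value \<open>x = ln (\<beta> i)\<close>, symmetric in the eigenvalues (see \<open>dim_ratio_eq\<close>).
Unlike \<open>phi l \<tau> (\<tau> + x) / (\<tau> + x)\<close> it agrees with \<open>dim_ratio\<close> also for negative \<open>\<tau>\<close>.\<close>

definition ratio :: "('d::finite \<Rightarrow> real) \<Rightarrow> real \<Rightarrow> real \<Rightarrow> real" where
  "ratio l \<tau> x = (\<Sum>j\<in>UNIV. max x (l j) - max 0 (l j - x - \<tau>)) / (\<tau> + x)"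

text \<open>As the eigenvalues are sorted, \<open>max (ln (\<beta> i)) (ln (\<beta> j))\<close> is \<open>ln (\<beta> i)\<close> for \<open>j \<le> i\<close> and \<open>ln (\<beta> j)\<close> for \<open>j > i\<close>.\<close>

lemma dim_ratio_eq:
  assumes pos: "\<forall>i\<in>{1..d}. 1 < \<beta> i" and mono: "mono_on {1..d} \<beta>" and i: "i \<in> {1..d}"
  shows "dim_ratio d \<beta> \<tau> i =
    (\<Sum>j=1..d. max (ln (\<beta> i)) (ln (\<beta> j)) - max 0 (ln (\<beta> j) - ln (\<beta> i) - \<tau>)) / (\<tau> + ln (\<beta> i))"
proof -
  have \<beta>: "0 < \<beta> j" if "j \<in> {1..d}" for j using pos that by force
  have 1: "(\<Sum>j | j \<in> {1..d} \<and> \<beta> j > \<beta> i * exp \<tau>. ln (\<beta> j) - ln (\<beta> i) - \<tau>)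
    = (\<Sum>j=1..d. max 0 (ln (\<beta> j) - ln (\<beta> i) - \<tau>))"
  proof -
    have cond: "\<beta> i * exp \<tau> < \<beta> j \<longleftrightarrow> 0 < ln (\<beta> j) - ln (\<beta> i) - \<tau>" if j: "j \<in> {1..d}" for j
    proof -
      have "\<beta> i * exp \<tau> < \<beta> j \<longleftrightarrow> ln (\<beta> i * exp \<tau>) < ln (\<beta> j)"
        using \<beta>[OF i] \<beta>[OF j] by (intro ln_less_cancel_iff[symmetric]) auto
      also have "ln (\<beta> i * exp \<tau>) = ln (\<beta> i) + \<tau>" using \<beta>[OF i] by (simp add: ln_mult)
      finally show ?thesis by (simp add: algebra_simps)
    qed
    have "(\<Sum>j | j \<in> {1..d} \<and> \<beta> j > \<beta> i * exp \<tau>. ln (\<beta> j) - ln (\<beta> i) - \<tau>)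
      = (\<Sum>j\<in>{1..d}. if \<beta> j > \<beta> i * exp \<tau> then ln (\<beta> j) - ln (\<beta> i) - \<tau> else 0)"
      by (rule sum.inter_filter) simp
    also have "\<dots> = (\<Sum>j=1..d. max 0 (ln (\<beta> j) - ln (\<beta> i) - \<tau>))"
      by (intro sum.cong refl) (simp add: cond max_def)
    finally show ?thesis .
  qed
  have 2: "real i * ln (\<beta> i) + (\<Sum>j\<in>{i<..d}. ln (\<beta> j)) = (\<Sum>j=1..d. max (ln (\<beta> i)) (ln (\<beta> j)))"
  proof -
    have "{1..d} = {1..i} \<union> {i<..d}" using i by auto
    then have "(\<Sum>j=1..d. max (ln (\<beta> i)) (ln (\<beta> j)))
      = (\<Sum>j=1..i. max (ln (\<beta> i)) (ln (\<beta> j))) + (\<Sum>j\<in>{i<..d}. max (ln (\<beta> i)) (ln (\<beta> j)))"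
      by (simp only:) (rule sum.union_disjoint, auto)
    also have "(\<Sum>j=1..i. max (ln (\<beta> i)) (ln (\<beta> j))) = (\<Sum>j=1..i. ln (\<beta> i))"
    proof (intro sum.cong refl max_absorb1)
      fix j assume j: "j \<in> {1..i}"
      then have "\<beta> j \<le> \<beta> i" using i by (intro mono_onD[OF mono]) auto
      then show "ln (\<beta> j) \<le> ln (\<beta> i)" using \<beta>[of j] \<beta>[OF i] i j by simp
    qed
    also have "(\<Sum>j\<in>{i<..d}. max (ln (\<beta> i)) (ln (\<beta> j))) = (\<Sum>j\<in>{i<..d}. ln (\<beta> j))"
    proof (intro sum.cong refl max_absorb2)
      fix j assume j: "j \<in> {i<..d}"
      then have "\<beta> i \<le> \<beta> j" using i by (intro mono_onD[OF mono]) auto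
      then show "ln (\<beta> i) \<le> ln (\<beta> j)" using \<beta>[of j] \<beta>[OF i] i j by simp
    qed
    finally show ?thesis by simp
  qed
  show ?thesis
    unfolding dim_ratio_def 1 sum_subtractf[of "\<lambda>j. max (ln (\<beta> i)) (ln (\<beta> j))"] 2[symmetric]
    by simp
qed

lemma phi_knot:
  assumes "0 \<le> \<tau>"
  shows "phi l \<tau> (\<tau> + l i) / (\<tau> + l i) = ratio l \<tau> (l i)"
proof -
  have "phi l \<tau> (\<tau> + l i) = (\<Sum>j\<in>UNIV. max (l i) (l j) - max 0 (l j - l i - \<tau>))"
    unfolding phi_def using assms by (intro sum.cong refl) (auto simp: max_def min_def)
  then show ?thesis by (simp add: ratio_def)
qed

text \<open>Every summand of the numerator is at least \<open>\<tau> + l i\<close>, with equality throughout when \<open>l i\<close> is the smallest exponent.\<close>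

lemma Min_ratio_nonpos:
  fixes l :: "'d::finite \<Rightarrow> real"
  assumes \<tau>: "\<tau> \<le> 0" and pos: "\<And>i. 0 < \<tau> + l i"
  shows "(MIN i. ratio l \<tau> (l i)) = real CARD('d)"
proof (rule Min_eqI)
  fix y assume "y \<in> range (\<lambda>i. ratio l \<tau> (l i))"
  then obtain i where y: "y = ratio l \<tau> (l i)" by blast
  have "(\<Sum>j\<in>(UNIV::'d set). \<tau> + l i) \<le> (\<Sum>j\<in>UNIV. max (l i) (l j) - max 0 (l j - l i - \<tau>))"
    using \<tau> by (intro sum_mono) (auto simp: max_def)
  then show "real CARD('d) \<le> y" unfolding y ratio_def using pos[of i] by (simp add: pos_le_divide_eq)
next
  obtain i where i: "\<And>j. l i \<le> l j"
    using arg_min_least[of UNIV _ l] by (metis UNIV_I UNIV_not_empty finite)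
  have "(\<Sum>j\<in>UNIV. max (l i) (l j) - max 0 (l j - l i - \<tau>)) = (\<Sum>j\<in>(UNIV::'d set). \<tau> + l i)"
  proof (intro sum.cong refl)
    fix j show "max (l i) (l j) - max 0 (l j - l i - \<tau>) = \<tau> + l i" using i[of j] \<tau> by (simp add: max_def)
  qed
  then have "ratio l \<tau> (l i) = real CARD('d)" unfolding ratio_def using pos[of i] by simp
  then show "real CARD('d) \<in> range (\<lambda>i. ratio l \<tau> (l i))" by (metis rangeI)
qed simp

lemma ratio_tendsto:
  assumes "0 < \<tau> + x"
  shows "((\<lambda>t. ratio l t x) \<longlongrightarrow> ratio l \<tau> x) (at \<tau> within S)"
  unfolding ratio_def using assms by (intro tendsto_intros) auto

lemma ratio_le_at_infinity:
  assumes "0 \<le> \<tau>" "0 < x"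
  shows "ratio l \<tau> x \<le> (\<Sum>j\<in>UNIV. max x (l j)) / (\<tau> + x)"
  unfolding ratio_def using assms by (intro divide_right_mono sum_mono) auto

lemma target_mono: "r \<le> r' \<Longrightarrow> target y r \<subseteq> target y r'"
  by (auto simp: target_def intro: less_le_trans)

lemma target_subset_unit: "target y r \<subseteq> target y 1"
proof
  fix x
  have "dist (x $ i) (y $ i) < 1" for i using dist_circle_le[of "x $ i" "y $ i"] by linarith
  then show "x \<in> target y 1" by (simp add: target_def)
qed

(* tau_gt says that every denominator tau + ln (beta i) is positive (automatic if tau >= 0);
   without it the dimension formula can be undefined or false. *)
theorem theorem1p6:
  fixes T :: "int ^ 'd ^ 'd"
    and f :: "nat \<Rightarrow> 'd torus \<Rightarrow> 'd torus"
    and \<psi> :: "nat \<Rightarrow> real"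
    and \<beta> :: "nat \<Rightarrow> real"
    and \<tau> :: ereal
  assumes nonsingular: "det T \<noteq> 0"
    and lipschitz: "\<exists>c>0. \<forall>n\<ge>1. \<forall>x y. dist (f n x) (f n y) \<le> c * dist x y"
    and psi_pos: "\<forall>n\<ge>1. \<psi> n > 0"
    and tau_def: "\<tau> = liminf (\<lambda>n. ereal (- ln (\<psi> n) / real n))"
    and tau_gt: "- ereal (ln (\<beta> 1)) < \<tau>"
    and diagonalizable: "diagonalizable_int T"
    and eigenvalues: "eigenvalue_list T \<beta>"
    and expanding: "\<forall>i\<in>{1..CARD('d)}. 1 < \<beta> i"
    and sorted: "mono_on {1..CARD('d)} \<beta>"
  shows "hausdorff_dim (W_set T \<psi> f) =
    (if \<tau> = \<infinity> then 0
     else ereal (MIN i\<in>{1..CARD('d)}. dim_ratio CARD('d) \<beta> (real_of_ereal \<tau>) i))"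
proof -
  let ?d = "CARD('d)"
  obtain P Q :: "int ^ 'd ^ 'd" and D where PQ: "P ** Q = mat 1" "Q ** P = mat 1"
    and conj: "P ** T ** Q = (\<chi> i j. if i = j then D i else 0)"
    using diagonalizable_int_imp_ex[OF diagonalizable] by iprover
  note sums = diagonal_entries_eq_eigenvalues(1)[OF eigenvalues PQ(1) conj]
  note imgs = diagonal_entries_eq_eigenvalues(2)[OF eigenvalues PQ(1) conj]
  have "2 \<le> D i" for i
  proof -
    have "real_of_int (D i) \<in> \<beta> ` {1..?d}" unfolding imgs by blast
    then have "1 < real_of_int (D i)" using expanding by auto
    then show ?thesis by linarith
  qed
  then interpret diag_torus T P Q D using PQ conj by unfold_locales
  obtain c where c: "0 < c" and lip: "\<And>n x y. 1 \<le> n \<Longrightarrow> dist (f n x) (f n y) \<le> c * dist x y"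
    using lipschitz by blast
  have W: "W_set T \<psi> f = {x. infinite {n. 1 \<le> n \<and> x \<in> hits f n (\<psi> n)}}"
    by (simp add: W_set_def hits_def)
  have ratio: "dim_ratio ?d \<beta> t ` {1..?d} = range (\<lambda>i. ratio l t (l i))" for t
  proof -
    define h where "h = (\<lambda>b. (\<Sum>j\<in>UNIV. max (ln b) (l j) - max 0 (l j - ln b - t)) / (t + ln b))"
    have "dim_ratio ?d \<beta> t i = h (\<beta> i)" if "i \<in> {1..?d}" for i
      unfolding dim_ratio_eq[OF expanding sorted that] h_def l_def
      by (subst sums[of "\<lambda>b. max (ln (\<beta> i)) (ln b) - max 0 (ln b - ln (\<beta> i) - t)"]) (rule refl)
    then have "dim_ratio ?d \<beta> t ` {1..?d} = h ` (\<beta> ` {1..?d})" by (simp add: image_image)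
    also have "\<dots> = range (\<lambda>i. ratio l t (l i))"
      unfolding imgs by (simp add: image_image h_def ratio_def l_def)
    finally show ?thesis .
  qed
  have upper: "hausdorff_dim (W_set T \<psi> f) \<le> ereal (ratio l t (l i))"
    if t: "0 \<le> t" and small: "\<forall>\<^sub>F n in sequentially. hits f n (\<psi> n) \<subseteq> hits f n (exp (- real n * t))" for t i
    unfolding W phi_knot[OF t, symmetric] by (rule dim_limsup_hits_le[OF c lip t small])
  have upper_tau: "hausdorff_dim (W_set T \<psi> f) \<le> ereal (ratio l t (l i))"
    if t: "0 \<le> t" "ereal t < \<tau>" for t i
  proof (rule upper[OF t(1)])
    have "\<forall>\<^sub>F n in sequentially. ereal t < ereal (- ln (\<psi> n) / real n)"
      using t(2) unfolding tau_def by (rule less_LiminfD)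
    then show "\<forall>\<^sub>F n in sequentially. hits f n (\<psi> n) \<subseteq> hits f n (exp (- real n * t))"
      using eventually_ge_at_top[of 1]
    proof eventually_elim
      case (elim n)
      then have "ln (\<psi> n) < - real n * t" by (simp add: field_simps)
      then have "\<psi> n < exp (- real n * t)" using psi_pos elim by (metis exp_less_cancel_iff exp_ln)
      then show ?case unfolding hits_def using target_mono[of "\<psi> n" "exp (- real n * t)"] by auto
    qed
  qed
  have lower: "ereal (MIN i. ratio l t (l i)) \<le> hausdorff_dim (W_set T \<psi> f)"
    if t: "0 \<le> t" "\<tau> < ereal t" for t
    unfolding W
  proof (rule dim_limsup_hits_ge[OF c lip t(1)])
    show "infinite {n. hits f n (exp (- real n * t)) \<subseteq> hits f n (\<psi> n)}"
    proof
      assume fin: "finite {n. hits f n (exp (- real n * t)) \<subseteq> hits f n (\<psi> n)}"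
      have "\<forall>\<^sub>F n in sequentially. ereal t \<le> ereal (- ln (\<psi> n) / real n)"
      proof -
        have "\<forall>\<^sub>F n in sequentially. n \<notin> {n. hits f n (exp (- real n * t)) \<subseteq> hits f n (\<psi> n)}"
          using fin by (simp add: eventually_cofinite flip: cofinite_eq_sequentially)
        then show ?thesis using eventually_ge_at_top[of 1]
        proof eventually_elim
          case (elim n)
          then have "\<psi> n < exp (- real n * t)"
            unfolding hits_def using target_mono[of "exp (- real n * t)" "\<psi> n"] by force
          then have "ln (\<psi> n) < - real n * t" using psi_pos elim by (metis exp_less_cancel_iff exp_ln)
          then show ?case using elim by (simp add: field_simps)
        qed
      qed
      then have "ereal t \<le> \<tau>" unfolding tau_def by (rule Liminf_bounded)
      then show False using t(2) by simp
    qed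
    fix i
    have "(MIN i. ratio l t (l i)) \<le> ratio l t (l i)" by (intro Min_le) auto
    then show "(MIN i. ratio l t (l i)) * (t + l i) \<le> phi l t (t + l i)"
      unfolding phi_knot[OF t(1), symmetric] using t(1) l_pos[of i] by (simp add: pos_le_divide_eq)
  qed
  show ?thesis
  proof (cases "\<tau> = \<infinity>")
    \<comment> \<open>The upper bound holds for every finite \<open>t\<close> and tends to \<open>0\<close> as \<open>t\<close> tends to infinity.\<close>
    case True
    have "hausdorff_dim (W_set T \<psi> f) \<le> ereal 0"
    proof (rule tendsto_lowerbound)
      fix i :: 'd
      let ?S = "\<Sum>j\<in>UNIV. max (l i) (l j)"
      show "((\<lambda>t. ereal (?S / (t + l i))) \<longlongrightarrow> ereal 0) at_top"
      proof (intro tendsto_ereal tendsto_divide_0[OF tendsto_const] filterlim_at_top_imp_at_infinity)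
        have "LIM t at_top. l i + t :> at_top"
          by (rule filterlim_tendsto_add_at_top[OF tendsto_const filterlim_ident])
        then show "LIM t at_top. t + l i :> at_top" by (simp only: add.commute)
      qed
      show "\<forall>\<^sub>F t in at_top. hausdorff_dim (W_set T \<psi> f) \<le> ereal (?S / (t + l i))"
        using eventually_ge_at_top[of 0]
      proof eventually_elim
        case (elim t)
        show ?case
          by (rule order_trans[OF upper_tau[OF elim, of i]]) (use True elim l_pos ratio_le_at_infinity in auto)
      qed
    qed simp
    moreover have "0 \<le> hausdorff_dim (W_set T \<psi> f)"
      unfolding hausdorff_dim_def by (rule INF_greatest) simp
    ultimately show ?thesis using True by (simp add: zero_ereal_def)
  next
    case False
    then obtain t where t: "\<tau> = ereal t" using tau_gt by (cases \<tau>) auto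
    have pos: "0 < t + l i" for i
    proof -
      have "real_of_int (D i) \<in> \<beta> ` {1..?d}" unfolding imgs by blast
      then obtain k where k: "k \<in> {1..?d}" "real_of_int (D i) = \<beta> k" by blast
      then have "\<beta> 1 \<le> \<beta> k" by (intro mono_onD[OF sorted]) auto
      moreover have "1 < \<beta> 1" using expanding k by auto
      ultimately have "ln (\<beta> 1) \<le> l i" unfolding l_def k(2) by simp
      then show ?thesis using tau_gt by (simp add: t)
    qed
    define m where "m = (\<lambda>t. MIN i. ratio l t (l i))"
    \<comment> \<open>For \<open>t \<le> 0\<close> the formula has the constant value \<open>CARD('d)\<close>, so it suffices to treat \<open>max t 0\<close>.\<close>
    have m_eq: "m t = m (max t 0)"
      using Min_ratio_nonpos[of t l] Min_ratio_nonpos[of 0 l] pos l_pos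
      by (cases "t \<le> 0") (auto simp: m_def max_def)
    have "hausdorff_dim (W_set T \<psi> f) \<le> ereal (m (max t 0))"
    proof (cases "0 < t")
      case True
      have "hausdorff_dim (W_set T \<psi> f) \<le> ereal (ratio l t (l i))" for i
      proof (rule tendsto_lowerbound)
        show "((\<lambda>t. ereal (ratio l t (l i))) \<longlongrightarrow> ereal (ratio l t (l i))) (at_left t)"
          by (intro tendsto_ereal ratio_tendsto pos)
        show "\<forall>\<^sub>F t in at_left t. hausdorff_dim (W_set T \<psi> f) \<le> ereal (ratio l t (l i))"
          using eventually_at_left_real[OF True]
          by eventually_elim (auto intro!: upper_tau simp: t)
      qed simp
      moreover have "m t \<in> range (\<lambda>i. ratio l t (l i))" unfolding m_def by (rule Min_in) auto
      ultimately show ?thesis using True by (auto simp: max_def)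
    next
      case False
      have "m 0 \<in> range (\<lambda>i. ratio l 0 (l i))" unfolding m_def by (rule Min_in) auto
      moreover have "hausdorff_dim (W_set T \<psi> f) \<le> ereal (ratio l 0 (l i))" for i
      proof (rule upper)
        show "\<forall>\<^sub>F n in sequentially. hits f n (\<psi> n) \<subseteq> hits f n (exp (- real n * 0))"
          using target_subset_unit by (intro always_eventually) (auto simp: hits_def)
      qed simp
      ultimately show ?thesis using False by (auto simp: max_def)
    qed
    moreover have "ereal (m (max t 0)) \<le> hausdorff_dim (W_set T \<psi> f)"
    proof (rule dense_le)
      fix x assume "x < ereal (m (max t 0))"
      then obtain y where y: "x < ereal y" "y < m (max t 0)"
        using ereal_dense2[of x "ereal (m (max t 0))"] by auto
      have "\<forall>\<^sub>F s in at_right (max t 0). \<forall>i\<in>UNIV. y < ratio l s (l i)"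
      proof (intro eventually_ball_finite ballI finite)
        fix i
        have "m (max t 0) \<le> ratio l (max t 0) (l i)" unfolding m_def by (rule Min_le) auto
        then show "\<forall>\<^sub>F s in at_right (max t 0). y < ratio l s (l i)"
          using pos[of i] y(2) by (intro order_tendstoD(1)[OF ratio_tendsto]) auto
      qed
      then have "\<forall>\<^sub>F s in at_right (max t 0). (\<forall>i. y < ratio l s (l i)) \<and> max t 0 < s"
        using eventually_at_right_less by eventually_elim simp
      then obtain s where s: "\<And>i. y < ratio l s (l i)" "max t 0 < s"
        using eventually_happens'[OF trivial_limit_at_right_real] by blast
      have "y < m s" unfolding m_def by (subst Min_gr_iff) (use s in auto)
      then have "x \<le> ereal (m s)" using y(1) by (meson ereal_less_eq(3) less_imp_le order_trans)
      also have "\<dots> \<le> hausdorff_dim (W_set T \<psi> f)" unfolding m_def using s(2) by (intro lower) (auto simp: t)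
      finally show "x \<le> hausdorff_dim (W_set T \<psi> f)" .
    qed
    ultimately have "hausdorff_dim (W_set T \<psi> f) = ereal (m t)" using m_eq by simp
    then show ?thesis unfolding ratio by (simp add: t m_def)
  qed
qed

end
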